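(* Let $M$ be an $F$-structure manifold of degree $K$. The distribution $D_m$ is integrable if and only if $$N_F(mX,mY)=0\quad\text{for all vector fields }X,Y\text{ on }M,$$ or, equivalently, if and only if $l\,N_F(mX,mY)=0$ for all vector fields $X,Y$ on $M$.
   Context: An $F$-structure manifold of degree $K$ is a smooth $n$-dimensional manifold $M$ with a nonzero smooth $(1,1)$-tensor field $F$ of constant rank $r$ satisfying $\alpha F^{K+1}+\beta F^{K}+F=0$, where $K\ge 3$ is an integer and $\alpha,\beta$ are real or complex numbers (polynomials in $F$ with complex coefficients are regarded as endomorphisms of the complexified tangent bundle). Put $l=-(\alpha F^{K}+\beta F^{K-1})$ and $m=I+\alpha F^{K}+\beta F^{K-1}$; $D_l=\mathrm{Im}\,l$ and $D_m=\mathrm{Im}\,m$ are complementary distributions of dimensions $r$ and $n-r$. For a $(1,1)$-tensor field $T$, the Nijenhuis tensor is $N_T(X,Y)=[TX,TY]-T[TX,Y]-T[X,TY]+T^2[X,Y]$. A distribution $D$ is integrable if through each point of $M$ there is an integral manifold of $D$ (equivalently, by Frobenius, $D$ is involutive). *)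

theory Defs
  imports "HOL-Analysis.Analysis"
begin

section \<open>Smooth maps between open subsets of Euclidean spaces\<close>

text \<open>Meant for open sets only; all iterated directional derivatives exist and are continuous.\<close>

fun Ck_on :: "nat \<Rightarrow> 'a::euclidean_space set \<Rightarrow> ('a \<Rightarrow> 'b::real_normed_vector) \<Rightarrow> bool" where
  "Ck_on 0 U f \<longleftrightarrow> continuous_on U f"
| "Ck_on (Suc k) U f \<longleftrightarrow>
     (\<forall>x\<in>U. f differentiable (at x)) \<and> (\<forall>v. Ck_on k U (\<lambda>x. frechet_derivative f (at x) v))"

definition smooth_on :: "'a::euclidean_space set \<Rightarrow> ('a \<Rightarrow> 'b::real_normed_vector) \<Rightarrow> bool" where
  "smooth_on U f \<longleftrightarrow> (\<forall>k. Ck_on k U f)"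


section \<open>Smooth manifolds\<close>

text \<open>A chart consists of its domain and its coordinate map; the values of the coordinate map
  outside the domain are irrelevant.\<close>

type_synonym ('m, 'n) chart = "'m set \<times> ('m \<Rightarrow> real^'n)"

abbreviation dom_chart :: "('m, 'n) chart \<Rightarrow> 'm set" where
  "dom_chart c \<equiv> fst c"

abbreviation coord :: "('m, 'n) chart \<Rightarrow> 'm \<Rightarrow> real^'n" where
  "coord c \<equiv> snd c"

definition coord_inv :: "('m, 'n) chart \<Rightarrow> real^'n \<Rightarrow> 'm" where
  "coord_inv c = inv_into (dom_chart c) (coord c)"

definition is_chart :: "('m::topological_space, 'n::finite) chart \<Rightarrow> bool" where
  "is_chart c \<longleftrightarrow> open (dom_chart c) \<and> open (coord c ` dom_chart c) \<and>
     homeomorphism (dom_chart c) (coord c ` dom_chart c) (coord c) (coord_inv c)"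

definition transition :: "('m, 'n) chart \<Rightarrow> ('m, 'n) chart \<Rightarrow> real^'n \<Rightarrow> real^'n" where
  "transition c d = coord d \<circ> coord_inv c"

definition compatible :: "('m, 'n::finite) chart \<Rightarrow> ('m, 'n) chart \<Rightarrow> bool" where
  "compatible c d \<longleftrightarrow> smooth_on (coord c ` (dom_chart c \<inter> dom_chart d)) (transition c d)"

text \<open>The manifold is the whole type \<open>'m\<close>, its dimension is \<open>CARD('n)\<close>, and its smooth
  structure is the one generated by the (not necessarily maximal) atlas \<open>A\<close>.\<close>

definition smooth_manifold ::
    "('m::{t2_space, second_countable_topology}, 'n::finite) chart set \<Rightarrow> bool" where
  "smooth_manifold A \<longleftrightarrow> (\<forall>c\<in>A. is_chart c) \<and> (\<Union>c\<in>A. dom_chart c) = UNIV \<and>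
     (\<forall>c\<in>A. \<forall>d\<in>A. compatible c d)"

definition maximal_atlas :: "('m::topological_space, 'n::finite) chart set \<Rightarrow> ('m, 'n) chart set" where
  "maximal_atlas A = {d. is_chart d \<and> (\<forall>c\<in>A. compatible c d \<and> compatible d c)}"

definition charts_at :: "('m, 'n) chart set \<Rightarrow> 'm \<Rightarrow> ('m, 'n) chart set" where
  "charts_at A p = {c\<in>A. p \<in> dom_chart c}"

definition jacobian :: "('m, 'n::finite) chart \<Rightarrow> ('m, 'n) chart \<Rightarrow> 'm \<Rightarrow> real^'n^'n" where
  "jacobian c d p = matrix (frechet_derivative (transition c d) (at (coord c p)))"


section \<open>Vector fields and (1,1)-tensor fields, real and complexified\<close>

text \<open>A tangent vector at \<open>p\<close> is a family of coordinate vectors, one for each chart of the atlas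
  around \<open>p\<close>, related by the Jacobians of the coordinate changes (and \<open>0\<close> at all other charts, so
  that equality of tangent vectors is equality of functions).  Scalars \<open>'k = real\<close> give the tangent
  space at \<open>p\<close>; scalars \<open>'k = complex\<close> give its complexification.\<close>

type_synonym ('m, 'n, 'k) tvec = "('m, 'n) chart \<Rightarrow> 'k^'n"
type_synonym ('m, 'n, 'k) vfield = "'m \<Rightarrow> ('m, 'n, 'k) tvec"
type_synonym ('m, 'n, 'k) tensor11 = "'m \<Rightarrow> ('m, 'n) chart \<Rightarrow> 'k^'n^'n"

definition tangent_space ::
    "('m, 'n::finite) chart set \<Rightarrow> 'm \<Rightarrow> ('m, 'n, 'k::real_normed_field) tvec set" where
  "tangent_space A p =
     {v. (\<forall>c\<in>charts_at A p. \<forall>d\<in>charts_at A p. v d = map_matrix of_real (jacobian c d p) *v v c) \<and>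
         (\<forall>c. c \<notin> charts_at A p \<longrightarrow> v c = 0)}"

definition smooth_vector_field ::
    "('m, 'n::finite) chart set \<Rightarrow> ('m, 'n, 'k::real_normed_field) vfield \<Rightarrow> bool" where
  "smooth_vector_field A X \<longleftrightarrow> (\<forall>p. X p \<in> tangent_space A p) \<and>
     (\<forall>c\<in>A. smooth_on (coord c ` dom_chart c) (\<lambda>x. X (coord_inv c x) c))"

definition smooth_tensor11 ::
    "('m, 'n::finite) chart set \<Rightarrow> ('m, 'n, 'k::real_normed_field) tensor11 \<Rightarrow> bool" where
  "smooth_tensor11 A T \<longleftrightarrow>
     (\<forall>p. \<forall>c\<in>charts_at A p. \<forall>d\<in>charts_at A p.
        T p d ** map_matrix of_real (jacobian c d p) = map_matrix of_real (jacobian c d p) ** T p c) \<and>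
     (\<forall>p c. c \<notin> charts_at A p \<longrightarrow> T p c = 0) \<and>
     (\<forall>c\<in>A. smooth_on (coord c ` dom_chart c) (\<lambda>x. T (coord_inv c x) c))"

text \<open>The action of an endomorphism on a tangent vector, and of a tensor field on a vector field.\<close>

definition endo_app ::
    "(('m, 'n) chart \<Rightarrow> 'k::real_normed_field^'n^'n) \<Rightarrow> ('m, 'n::finite, 'k) tvec \<Rightarrow> ('m, 'n, 'k) tvec" where
  "endo_app T v = (\<lambda>c. T c *v v c)"

definition tensor_app ::
    "('m, 'n, 'k::real_normed_field) tensor11 \<Rightarrow> ('m, 'n::finite, 'k) vfield \<Rightarrow> ('m, 'n, 'k) vfield" where
  "tensor_app T X = (\<lambda>p. endo_app (T p) (X p))"

text \<open>\<open>[X,Y] = \<Sum>\<^sub>i (X\<^sub>i \<partial>\<^sub>i Y - Y\<^sub>i \<partial>\<^sub>i X)\<close> in every chart.\<close>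

definition coord_deriv ::
    "('m, 'n::finite) chart \<Rightarrow> 'm \<Rightarrow> 'n \<Rightarrow> ('m, 'n, 'k::real_normed_field) vfield \<Rightarrow> 'k^'n" where
  "coord_deriv c p i X =
     frechet_derivative (\<lambda>x. X (coord_inv c x) c) (at (coord c p)) (axis i 1)"

definition lie_bracket ::
    "('m, 'n::finite) chart set \<Rightarrow> ('m, 'n, 'k::real_normed_field) vfield \<Rightarrow> ('m, 'n, 'k) vfield \<Rightarrow>
     ('m, 'n, 'k) vfield" where
  "lie_bracket A X Y = (\<lambda>p c. if c \<in> charts_at A p
     then (\<Sum>i\<in>UNIV. (X p c $ i) *s coord_deriv c p i Y - (Y p c $ i) *s coord_deriv c p i X)
     else 0)"

definition nijenhuis ::
    "('m, 'n::finite) chart set \<Rightarrow> ('m, 'n, 'k::real_normed_field) tensor11 \<Rightarrow>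
     ('m, 'n, 'k) vfield \<Rightarrow> ('m, 'n, 'k) vfield \<Rightarrow> ('m, 'n, 'k) vfield" where
  "nijenhuis A T X Y = (\<lambda>p c.
       lie_bracket A (tensor_app T X) (tensor_app T Y) p c
     - tensor_app T (lie_bracket A (tensor_app T X) Y) p c
     - tensor_app T (lie_bracket A X (tensor_app T Y)) p c
     + tensor_app T (tensor_app T (lie_bracket A X Y)) p c)"

definition complex_field :: "('m, 'n::finite, real) vfield \<Rightarrow> ('m, 'n, complex) vfield" where
  "complex_field X = (\<lambda>p c. \<chi> i. complex_of_real (X p c $ i))"

definition complex_tensor :: "('m, 'n::finite, real) tensor11 \<Rightarrow> ('m, 'n, complex) tensor11" where
  "complex_tensor T = (\<lambda>p c. map_matrix complex_of_real (T p c))"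

text \<open>\<open>V + \<i> V\<close> for a set \<open>V\<close> of real tangent vectors.\<close>

definition complexification :: "('m, 'n::finite, real) tvec set \<Rightarrow> ('m, 'n, complex) tvec set" where
  "complexification V = {\<lambda>c. \<chi> i. Complex (u c $ i) (w c $ i) | u w. u \<in> V \<and> w \<in> V}"


section \<open>Integrable distributions\<close>

text \<open>An immersed submanifold is given by a topology \<open>N\<close> on a subset of the manifold, possibly
  finer than the subspace topology: every point of \<open>N\<close> has an \<open>N\<close>-open neighbourhood \<open>W\<close> that is the
  slice of a chart of the manifold by a linear subspace \<open>S\<close> and on which \<open>N\<close> induces the subspace
  topology.\<close>

definition adapted_chart ::
    "('m::topological_space, 'n::finite) chart set \<Rightarrow> 'm topology \<Rightarrow> 'm \<Rightarrow> ('m, 'n) chart \<Rightarrow>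
     (real^'n) set \<Rightarrow> bool" where
  "adapted_chart A N q d S \<longleftrightarrow> d \<in> maximal_atlas A \<and> subspace S \<and>
     (let W = {x \<in> dom_chart d. coord d x \<in> S}
      in q \<in> W \<and> openin N W \<and> subtopology N W = top_of_set W)"

definition immersed_submanifold ::
    "('m::topological_space, 'n::finite) chart set \<Rightarrow> nat \<Rightarrow> 'm topology \<Rightarrow> bool" where
  "immersed_submanifold A k N \<longleftrightarrow> second_countable N \<and>
     (\<forall>q \<in> topspace N. \<exists>d S. adapted_chart A N q d S \<and> dim S = k)"

definition submanifold_tangent ::
    "('m::topological_space, 'n::finite) chart set \<Rightarrow> 'm topology \<Rightarrow> 'm \<Rightarrow> ('m, 'n, real) tvec set" where
  "submanifold_tangent A N q = {v \<in> tangent_space A q.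
     \<exists>d S s. adapted_chart A N q d S \<and> s \<in> S \<and> (\<forall>c\<in>charts_at A q. v c = jacobian d c q *v s)}"

text \<open>Distributions are families of subspaces of the complexified tangent spaces; their integral
  manifolds are real submanifolds.\<close>

type_synonym ('m, 'n) distribution = "'m \<Rightarrow> ('m, 'n, complex) tvec set"

definition integral_manifold ::
    "('m::topological_space, 'n::finite) chart set \<Rightarrow> ('m, 'n) distribution \<Rightarrow> 'm topology \<Rightarrow> bool" where
  "integral_manifold A D N \<longleftrightarrow> (\<exists>k. immersed_submanifold A k N) \<and>
     (\<forall>q \<in> topspace N. complexification (submanifold_tangent A N q) = D q)"

definition integrable_distribution ::
    "('m::topological_space, 'n::finite) chart set \<Rightarrow> ('m, 'n) distribution \<Rightarrow> bool" where
  "integrable_distribution A D \<longleftrightarrow> (\<forall>p. \<exists>N. integral_manifold A D N \<and> p \<in> topspace N)"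


section \<open>F-structures\<close>

text \<open>Powers with respect to matrix multiplication: the library's \<open>^\<close> on \<open>'k^'n^'n\<close> is taken
  entry by entry.  Multiplication by a scalar \<open>a\<close> is written \<open>mat a ** _\<close>.\<close>

primrec matpow :: "'k::semiring_1^'n^'n \<Rightarrow> nat \<Rightarrow> 'k^'n::finite^'n" where
  "matpow B 0 = mat 1"
| "matpow B (Suc k) = B ** matpow B k"

definition F_structure ::
    "('m, 'n::finite) chart set \<Rightarrow> ('m, 'n, real) tensor11 \<Rightarrow> nat \<Rightarrow> nat \<Rightarrow> complex \<Rightarrow> complex \<Rightarrow> bool" where
  "F_structure A F K r \<alpha> \<beta> \<longleftrightarrow> K \<ge> 3 \<and> smooth_tensor11 A F \<and> (\<exists>p c. F p c \<noteq> 0) \<and>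
     (\<forall>p. \<forall>c\<in>charts_at A p. rank (F p c) = r) \<and>
     (\<forall>p. \<forall>c\<in>charts_at A p.
        mat \<alpha> ** matpow (complex_tensor F p c) (K + 1) + mat \<beta> ** matpow (complex_tensor F p c) K
        + complex_tensor F p c = 0)"

definition l_tensor ::
    "('m, 'n::finite, real) tensor11 \<Rightarrow> nat \<Rightarrow> complex \<Rightarrow> complex \<Rightarrow> ('m, 'n, complex) tensor11" where
  "l_tensor F K \<alpha> \<beta> = (\<lambda>p c.
     - (mat \<alpha> ** matpow (complex_tensor F p c) K + mat \<beta> ** matpow (complex_tensor F p c) (K - 1)))"

definition m_tensor ::
    "('m, 'n::finite, real) tensor11 \<Rightarrow> nat \<Rightarrow> complex \<Rightarrow> complex \<Rightarrow> ('m, 'n, complex) tensor11" where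
  "m_tensor F K \<alpha> \<beta> = (\<lambda>p c.
     mat 1 + mat \<alpha> ** matpow (complex_tensor F p c) K + mat \<beta> ** matpow (complex_tensor F p c) (K - 1))"

definition D_m ::
    "('m, 'n::finite) chart set \<Rightarrow> ('m, 'n, real) tensor11 \<Rightarrow> nat \<Rightarrow> complex \<Rightarrow> complex \<Rightarrow>
     ('m, 'n) distribution" where
  "D_m A F K \<alpha> \<beta> = (\<lambda>p. endo_app (m_tensor F K \<alpha> \<beta> p) ` tangent_space A p)"

end

theory Submission
  imports Defs
begin

text \<open>Writing \<open>a\<close>, \<open>b\<close> for the real parts of the coefficients, the real endomorphism
  \<open>P = I + a F\<^sup>K + b F\<^sup>K\<^sup>-\<^sup>1\<close> is the projection onto \<open>ker F\<close> along \<open>im F\<close>, and \<open>m\<close> is its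
  complexification; so \<open>D\<^sub>m\<close> is the complexification of \<open>ker F\<close>. As \<open>F m = 0\<close>, the Nijenhuis
  tensor reduces to \<open>N\<^sub>F(mX, mY) = F\<^sup>2 [mX, mY]\<close>, which \<open>l\<close> fixes and which vanishes iff
  \<open>[mX, mY]\<close> lies in \<open>ker F\<close>. Differentiating \<open>F (mY) = 0\<close> makes this a pointwise condition: in
  every chart, \<open>(D\<^sub>u F) v = (D\<^sub>v F) u\<close> for \<open>u, v\<close> in \<open>ker F\<close>.

  If integral manifolds exist, this follows by differentiating \<open>F (D\<phi> s) = 0\<close> along a slice
  parametrised by \<open>\<phi>\<close>, since second derivatives are symmetric. Conversely, near \<open>x\<^sub>0\<close> the kernel
  is the image of a matrix field \<open>Q\<close> with \<open>P(x\<^sub>0) Q = P(x\<^sub>0)\<close>, and the condition says that the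
  columns of \<open>Q\<close> commute. Then the total differential equation \<open>D\<phi>(y) = Q(\<phi>(y))\<close> has a
  solution: solve it along rays by a contraction; the error
  \<open>e(t) = \<phi>(t(y + d)) - \<phi>(ty) - t Q(\<phi>(ty)) d\<close> satisfies \<open>\<bar>e'\<bar> \<le> \<bar>e\<bar>/2 + C \<bar>d\<bar>\<^sup>2\<close> by the
  symmetry condition, so \<open>\<phi>\<close> has the prescribed derivative. A shear built from \<open>\<phi>\<close> is
  an adapted chart.\<close>


section \<open>Calculus of \<open>C\<^sup>k\<close> maps\<close>

text \<open>For an arbitrary smooth basis of an involutive distribution the brackets are only
  combinations of the basis, which leaves nothing to integrate directly. The normalisation of
  \<open>Q\<close> removes this obstacle: differentiating \<open>P(x0) Q = P(x0)\<close> puts every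
  derivative of \<open>Q\<close> into the kernel of \<open>P(x0)\<close>, involutivity puts the
  antisymmetrised derivative into the kernel of \<open>F\<close>, and near \<open>x0\<close> these
  two kernels meet only in zero.

  Commuting fields are classically integrated by composing flows, which relies on differentiable
  dependence of flows on initial values. Here only the rays are integrated; differentiability in
  \<open>y\<close> is an outcome of the quadratic bound on \<open>e\<close>, and higher smoothness
  is read off from the equation itself. The rate 1/2 in that bound is arranged by a small radius, so
  that a maximum argument replaces exponential estimates.

  The coefficients may be complex because the imaginary part of \<open>m\<close> kills both
  summands: the image of \<open>F\<close> by the imaginary part of the structure equation, the
  kernel of \<open>F\<close> because it is a polynomial in \<open>F\<close> without constant
  term.\<close>

lemma frechet_derivative_eq: "(f has_derivative f') (at x) \<Longrightarrow> frechet_derivative f (at x) = f'"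
  using frechet_derivative_at by metis

lemma differentiable_transform_open:
  assumes "open U" "x \<in> U" "\<And>y. y \<in> U \<Longrightarrow> f y = g y" "f differentiable (at x)"
  shows "g differentiable (at x)" "frechet_derivative g (at x) = frechet_derivative f (at x)"
proof -
  have "(f has_derivative frechet_derivative f (at x)) (at x)"
    using assms(4) frechet_derivative_works by blast
  then have "(g has_derivative frechet_derivative f (at x)) (at x)"
    using has_derivative_transform_within_open assms(1-3) by metis
  then show "g differentiable (at x)" "frechet_derivative g (at x) = frechet_derivative f (at x)"
    using differentiableI frechet_derivative_eq by blast+
qed

lemma Ck_on_cong:
  assumes "open U" "\<And>x. x \<in> U \<Longrightarrow> f x = g x" "Ck_on k U f"
  shows "Ck_on k U g"
  using assms(2,3)
proof (induction k arbitrary: f g)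
  case 0
  then show ?case using continuous_on_cong by (metis Ck_on.simps(1))
next
  case (Suc k)
  have d: "f differentiable (at x)" if "x \<in> U" for x using Suc.prems(2) that by simp
  have e: "frechet_derivative f (at x) = frechet_derivative g (at x)" if "x \<in> U" for x
    using differentiable_transform_open(2)[OF assms(1) that Suc.prems(1) d[OF that]] by simp
  have "Ck_on k U (\<lambda>x. frechet_derivative g (at x) v)" for v
    by (rule Suc.IH[of "\<lambda>x. frechet_derivative f (at x) v"]) (use e Suc.prems in auto)
  moreover have "g differentiable (at x)" if "x \<in> U" for x
    using differentiable_transform_open(1)[OF assms(1) that Suc.prems(1) d[OF that]] by simp
  ultimately show ?case by simp
qed

lemma Ck_on_subset: "Ck_on k U f \<Longrightarrow> V \<subseteq> U \<Longrightarrow> Ck_on k V f"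
  by (induction k arbitrary: f) (auto intro: continuous_on_subset)

lemma Ck_on_local:
  assumes "\<And>x. x \<in> U \<Longrightarrow> \<exists>V. open V \<and> x \<in> V \<and> Ck_on k V f"
  shows "Ck_on k U f"
  using assms
proof (induction k arbitrary: f)
  case 0
  have "isCont f x" if "x \<in> U" for x
    using 0[OF that] continuous_on_eq_continuous_at by auto
  then show ?case by (simp add: continuous_at_imp_continuous_on)
next
  case (Suc k)
  have "Ck_on k U (\<lambda>x. frechet_derivative f (at x) v)" for v
    by (rule Suc.IH) (use Suc.prems in fastforce)
  then show ?case using Suc.prems by fastforce
qed

lemma Ck_on_Suc_lower: "Ck_on (Suc k) U f \<Longrightarrow> Ck_on k U f"
proof (induction k arbitrary: f)
  case 0
  then show ?case
    by (auto simp: continuous_at_imp_continuous_on differentiable_imp_continuous_within)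
next
  case (Suc k)
  have "Ck_on k U (\<lambda>x. frechet_derivative f (at x) v)" for v
    by (rule Suc.IH) (use Suc.prems in auto)
  then show ?case using Suc.prems by simp
qed

text \<open>The working introduction rule: an explicit derivative \<open>f' x\<close> replaces the
  chosen term \<open>frechet_derivative f (at x)\<close>, so the closure properties below can use
  the usual derivative formulas.\<close>

lemma Ck_on_SucI:
  assumes "\<And>x. x \<in> U \<Longrightarrow> (f has_derivative f' x) (at x)" "open U"
    and "\<And>v. Ck_on k U (\<lambda>x. f' x v)"
  shows "Ck_on (Suc k) U f"
proof -
  have "Ck_on k U (\<lambda>x. frechet_derivative f (at x) v)" for v
    by (rule Ck_on_cong[OF assms(2) _ assms(3)[of v]]) (simp add: frechet_derivative_eq[OF assms(1)])
  moreover have "f differentiable (at x)" if "x \<in> U" for x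
    using assms(1)[OF that] differentiableI by blast
  ultimately show ?thesis by simp
qed

lemma Ck_on_SucD:
  assumes "Ck_on (Suc k) U f" "x \<in> U"
  shows "(f has_derivative frechet_derivative f (at x)) (at x)"
  using assms frechet_derivative_works by auto

lemma Ck_on_const: "Ck_on k U (\<lambda>x. c)"
  by (induction k arbitrary: c) (auto simp: frechet_derivative_const)

lemma Ck_on_linear:
  assumes "bounded_linear h" "Ck_on k U f" "open U"
  shows "Ck_on k U (\<lambda>x. h (f x))"
  using assms(2)
proof (induction k arbitrary: f)
  case 0
  then show ?case using bounded_linear.continuous_on[OF assms(1)] by simp
next
  case (Suc k)
  show ?case
    by (rule Ck_on_SucI[OF bounded_linear.has_derivative[OF assms(1) Ck_on_SucD[OF Suc.prems]]])
      (use Suc assms(3) in auto)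
qed

lemma Ck_on_id: "open U \<Longrightarrow> Ck_on k U (\<lambda>x. x)"
proof (cases k)
  case (Suc j)
  assume "open U"
  then show ?thesis unfolding Suc
    by (intro Ck_on_SucI[where f' = "\<lambda>x v. v"]) (auto intro: Ck_on_const)
qed simp

lemma Ck_on_add:
  assumes "open U" "Ck_on k U f" "Ck_on k U g"
  shows "Ck_on k U (\<lambda>x. f x + g x)"
  using assms(2,3)
proof (induction k arbitrary: f g)
  case 0
  then show ?case by (simp add: continuous_on_add)
next
  case (Suc k)
  show ?case
    by (rule Ck_on_SucI[OF has_derivative_add[OF Ck_on_SucD[OF Suc.prems(1)] Ck_on_SucD[OF Suc.prems(2)]]])
      (use Suc assms(1) in auto)
qed

lemma Ck_on_sum:
  assumes "open U" "\<And>i. i \<in> I \<Longrightarrow> Ck_on k U (f i)"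
  shows "Ck_on k U (\<lambda>x. \<Sum>i\<in>I. f i x)"
  using assms(2)
  by (induction I rule: infinite_finite_induct) (auto intro: Ck_on_const Ck_on_add assms(1))

lemma Ck_on_bilinear:
  assumes "bounded_bilinear pr" "open U" "Ck_on k U f" "Ck_on k U g"
  shows "Ck_on k U (\<lambda>x. pr (f x) (g x))"
  using assms(3,4)
proof (induction k arbitrary: f g)
  case 0
  then show ?case using bounded_bilinear.continuous_on[OF assms(1)] by simp
next
  case (Suc k)
  show ?case
    by (rule Ck_on_SucI[OF bounded_bilinear.FDERIV[OF assms(1) Ck_on_SucD[OF Suc.prems(1)] Ck_on_SucD[OF Suc.prems(2)]]])
      (use Suc assms(2) Ck_on_Suc_lower[OF Suc.prems(1)] Ck_on_Suc_lower[OF Suc.prems(2)]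
        in \<open>auto intro!: Ck_on_add\<close>)
qed

lemma Ck_on_minus: "open U \<Longrightarrow> Ck_on k U f \<Longrightarrow> Ck_on k U (\<lambda>x. - f x)"
  using Ck_on_linear[OF bounded_linear_minus[OF bounded_linear_ident]] by blast

lemma Ck_on_diff:
  "open U \<Longrightarrow> Ck_on k U f \<Longrightarrow> Ck_on k U g \<Longrightarrow> Ck_on k U (\<lambda>x. f x - g x)"
  using Ck_on_add[of U k f "\<lambda>x. - g x"] Ck_on_minus[of U k g] by simp

text \<open>\<open>Ck_on\<close> controls derivatives only in a fixed direction, whereas in the
  chain rule the direction fed to the derivative of \<open>g\<close> varies with \<open>x\<close>.
  Expanding that direction in the basis gives a finite sum of products whose factors involve fixed
  directions, and the induction hypothesis applies to these.\<close>

lemma Ck_on_compose: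
  fixes f :: "'a::euclidean_space \<Rightarrow> 'b::euclidean_space" and g :: "'b \<Rightarrow> 'c::real_normed_vector"
  assumes "open U" "open V" "f ` U \<subseteq> V" "Ck_on k U f" "Ck_on k V g"
  shows "Ck_on k U (\<lambda>x. g (f x))"
  using assms(4,5)
proof (induction k arbitrary: g)
  case 0
  then show ?case using continuous_on_compose2[of V g U f] assms(3) by simp
next
  case (Suc k)
  let ?D = "\<lambda>x v. \<Sum>b\<in>Basis. (frechet_derivative f (at x) v \<bullet> b) *\<^sub>R frechet_derivative g (at (f x)) b"
  have d: "((\<lambda>x. g (f x)) has_derivative ?D x) (at x)" if "x \<in> U" for x
  proof -
    have g: "(g has_derivative frechet_derivative g (at (f x))) (at (f x))"
      using Ck_on_SucD[OF Suc.prems(2)] that assms(3) by blast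
    have l: "linear (frechet_derivative g (at (f x)))"
      using g has_derivative_linear by blast
    have "frechet_derivative g (at (f x)) (\<Sum>b\<in>Basis. (w \<bullet> b) *\<^sub>R b) =
        (\<Sum>b\<in>Basis. (w \<bullet> b) *\<^sub>R frechet_derivative g (at (f x)) b)" for w
      by (simp only: linear_sum[OF l] linear_scale[OF l])
    then have e: "(\<Sum>b\<in>Basis. (w \<bullet> b) *\<^sub>R frechet_derivative g (at (f x)) b) =
        frechet_derivative g (at (f x)) w" for w
      unfolding euclidean_representation by (rule sym)
    show ?thesis
      unfolding e by (rule has_derivative_compose[OF Ck_on_SucD[OF Suc.prems(1) that] g])
  qed
  have "Ck_on k U (\<lambda>x. ?D x v)" for v
  proof (rule Ck_on_sum[OF assms(1)], rule Ck_on_bilinear[OF bounded_bilinear_scaleR assms(1)])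
    fix b :: 'b
    show "Ck_on k U (\<lambda>x. frechet_derivative f (at x) v \<bullet> b)"
      by (rule Ck_on_linear[OF bounded_linear_inner_left _ assms(1)]) (use Suc.prems in auto)
    show "Ck_on k U (\<lambda>x. frechet_derivative g (at (f x)) b)"
      using Suc.IH[OF Ck_on_Suc_lower[OF Suc.prems(1)], of "\<lambda>y. frechet_derivative g (at y) b"] Suc.prems(2) by simp
  qed
  then show ?case using Ck_on_SucI[OF d assms(1)] by blast
qed

lemma Ck_on_mult:
  fixes f g :: "_ \<Rightarrow> real"
  shows "open U \<Longrightarrow> Ck_on k U f \<Longrightarrow> Ck_on k U g \<Longrightarrow> Ck_on k U (\<lambda>x. f x * g x)"
  by (rule Ck_on_bilinear[OF bounded_bilinear_mult])

lemma Ck_on_prod: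
  fixes f :: "_ \<Rightarrow> _ \<Rightarrow> real"
  assumes "open U" "\<And>i. i \<in> I \<Longrightarrow> Ck_on k U (f i)"
  shows "Ck_on k U (\<lambda>x. \<Prod>i\<in>I. f i x)"
  using assms(2)
  by (induction I rule: infinite_finite_induct) (auto intro: Ck_on_const Ck_on_mult assms(1))

text \<open>The derivative is a product of copies of the function itself, so the induction
  closes.\<close>

lemma Ck_on_inverse_real: "Ck_on k (- {0}) (inverse :: real \<Rightarrow> real)"
proof (induction k)
  case 0
  then show ?case by (auto intro!: continuous_intros)
next
  case (Suc k)
  show ?case
  proof (rule Ck_on_SucI)
    fix x :: real assume "x \<in> - {0}"
    then show "(inverse has_derivative (\<lambda>v. - (inverse x * v * inverse x))) (at x)"
      by (auto intro: has_derivative_inverse')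
  next
    show "Ck_on k (- {0}) (\<lambda>x. - (inverse x * v * inverse x))" for v :: real
      by (intro Ck_on_minus Ck_on_mult Suc Ck_on_const) auto
  qed auto
qed

lemma Ck_on_inverse:
  fixes f :: "_ \<Rightarrow> real"
  assumes "open U" "Ck_on k U f" "\<And>x. x \<in> U \<Longrightarrow> f x \<noteq> 0"
  shows "Ck_on k U (\<lambda>x. inverse (f x))"
  by (rule Ck_on_compose[OF assms(1) _ _ assms(2) Ck_on_inverse_real]) (use assms(3) in auto)

lemma Ck_on_vec:
  fixes f :: "_ \<Rightarrow> 'b::euclidean_space ^ 'n::finite"
  assumes "open U" "\<And>i. Ck_on k U (\<lambda>x. f x $ i)"
  shows "Ck_on k U f"
proof -
  \<comment> \<open>\<open>?h i\<close> embeds the \<open>i\<close>-th component; a vector is the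
    sum of its embedded components, so only sums and linear maps are involved.\<close>
  let ?h = "\<lambda>i z. (\<chi> j. if j = i then z else 0) :: 'b ^ 'n"
  have h: "bounded_linear (?h i)" for i
    unfolding linear_conv_bounded_linear[symmetric]
    by (rule linearI) (auto simp: vec_eq_iff)
  have "(\<Sum>i\<in>UNIV. ?h i (f x $ i)) = f x" for x
    by (simp add: vec_eq_iff if_distrib if_distribR cong: if_cong)
  moreover have "Ck_on k U (\<lambda>x. \<Sum>i\<in>UNIV. ?h i (f x $ i))"
    by (intro Ck_on_sum Ck_on_linear[OF h] assms)
  ultimately show ?thesis by simp
qed

lemma Ck_on_nth:
  fixes f :: "_ \<Rightarrow> 'b::real_normed_vector ^ 'n::finite"
  shows "open U \<Longrightarrow> Ck_on k U f \<Longrightarrow> Ck_on k U (\<lambda>x. f x $ i)"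
  by (rule Ck_on_linear[OF bounded_linear_vec_nth])


section \<open>Symmetry of second derivatives, matrix inverses and bump functions\<close>

lemma vector_derivative_norm_bound:
  fixes k :: "real \<Rightarrow> 'b::real_normed_vector"
  assumes "a \<le> b" "\<And>u. u \<in> {a..b} \<Longrightarrow> (k has_vector_derivative k' u) (at u within {a..b})"
    and "\<And>u. u \<in> {a..b} \<Longrightarrow> norm (k' u) \<le> B"
  shows "norm (k b - k a) \<le> B * (b - a)"
proof -
  have "norm (k b - k a) \<le> B * norm (b - a)"
  proof (rule differentiable_bound[OF convex_real_interval(5)])
    show "(k has_derivative (\<lambda>v. v *\<^sub>R k' u)) (at u within {a..b})" if "u \<in> {a..b}" for u
      using assms(2)[OF that] by (simp add: has_vector_derivative_def)
    show "onorm (\<lambda>v. v *\<^sub>R k' u) \<le> B" if "u \<in> {a..b}" for u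
      by (rule onorm_le) (use assms(3)[OF that] in \<open>auto simp: mult.commute[of B] intro!: mult_left_mono\<close>)
  qed (use assms(1) in auto)
  then show ?thesis using assms(1) by simp
qed

text \<open>The second difference is the increment over \<open>[0, h]\<close> of
  \<open>f (x + u s + h t) - f (x + u s)\<close> as a function of \<open>u\<close>. Its derivative
  in \<open>u\<close> is a difference of two values of \<open>\<lambda>y. f' y s\<close>, which
  differentiability at \<open>x\<close> approximates by \<open>h G t\<close> up to
  \<open>o(h)\<close>; the mean value inequality contributes the second factor
  \<open>h\<close>.\<close>

lemma second_difference_approx:
  fixes f :: "'a::real_normed_vector \<Rightarrow> 'b::real_normed_vector"
  assumes U: "open U" "x \<in> U" and f': "\<And>y. y \<in> U \<Longrightarrow> (f has_derivative f' y) (at y)"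
    and G: "((\<lambda>y. f' y s) has_derivative G) (at x)" and e: "e > 0"
  shows "\<exists>d>0. \<forall>h. 0 < h \<and> h < d \<longrightarrow>
    norm (f (x + h *\<^sub>R s + h *\<^sub>R t) - f (x + h *\<^sub>R s) - f (x + h *\<^sub>R t) + f x - (h * h) *\<^sub>R G t) \<le> e * (h * h)"
proof -
  \<comment> \<open>Both points at which \<open>f'\<close> is evaluated lie within
    \<open>h * C\<close> of \<open>x\<close>, and their distances to \<open>x\<close> add up to at
    most \<open>h * C\<close>. The summand 1 keeps \<open>C\<close> positive.\<close>
  define C where "C = 2 * norm s + norm t + 1"
  have C: "C > 0" by (simp add: C_def add_nonneg_pos)
  define e' where "e' = e / C"
  have e': "e' > 0" using e C by (simp add: e'_def)
  obtain d1 where d1: "d1 > 0" "\<And>y. norm (y - x) < d1 \<Longrightarrow>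
      norm (f' y s - f' x s - G (y - x)) \<le> e' * norm (y - x)"
    using G[unfolded has_derivative_at_alt] e' by blast
  obtain d2 where d2: "d2 > 0" "ball x d2 \<subseteq> U"
    using U open_contains_ball by blast
  define d where "d = min d1 d2 / C"
  have linG: "linear G" using G has_derivative_linear by blast
  have "norm (f (x + h *\<^sub>R s + h *\<^sub>R t) - f (x + h *\<^sub>R s) - f (x + h *\<^sub>R t) + f x - (h * h) *\<^sub>R G t) \<le> e * (h * h)"
    if h: "0 < h" "h < d" for h
  proof -
    have hC: "h * C < d1" "h * C < d2"
      using h C by (auto simp: d_def field_simps)
    \<comment> \<open>With the linear term subtracted, \<open>k h - k 0\<close> is exactly the
      quantity to be bounded.\<close>
    define k where "k u = f (x + u *\<^sub>R s + h *\<^sub>R t) - f (x + u *\<^sub>R s) - (u * h) *\<^sub>R G t" for u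
    define k' where "k' u = f' (x + u *\<^sub>R s + h *\<^sub>R t) s - f' (x + u *\<^sub>R s) s - h *\<^sub>R G t" for u
    have n1: "norm (u *\<^sub>R s + h *\<^sub>R t) \<le> h * (norm s + norm t)" if "u \<in> {0..h}" for u
    proof -
      have "norm (u *\<^sub>R s + h *\<^sub>R t) \<le> u * norm s + h * norm t"
        using norm_triangle_ineq[of "u *\<^sub>R s" "h *\<^sub>R t"] that h by simp
      also have "\<dots> \<le> h * norm s + h * norm t" using that by (simp add: mult_right_mono)
      finally show ?thesis by (simp add: distrib_left)
    qed
    have n2: "norm (u *\<^sub>R s) \<le> h * norm s" if "u \<in> {0..h}" for u
      using that by (simp add: mult_right_mono)
    have lt: "h * (norm s + norm t) < h * C" "h * norm s < h * C"
      using h by (auto simp: C_def intro!: add_nonneg_pos intro: add_pos_nonneg)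
    have "norm (k h - k 0) \<le> (e * h) * (h - 0)"
    proof (rule vector_derivative_norm_bound)
      fix u assume u: "u \<in> {0..h}"
      have i1: "x + u *\<^sub>R s + h *\<^sub>R t \<in> U"
      proof (rule subsetD[OF d2(2)])
        have "dist x (x + (u *\<^sub>R s + h *\<^sub>R t)) < d2"
          unfolding dist_norm using n1[OF u] lt hC by (metis add_diff_cancel_left' norm_minus_commute order_le_less_trans order_less_trans)
        then show "x + u *\<^sub>R s + h *\<^sub>R t \<in> ball x d2" by (simp add: add.assoc)
      qed
      have i2: "x + u *\<^sub>R s \<in> U"
      proof (rule subsetD[OF d2(2)])
        have "dist x (x + u *\<^sub>R s) < d2"
          unfolding dist_norm using n2[OF u] lt hC by (metis add_diff_cancel_left' norm_minus_commute order_le_less_trans order_less_trans)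
        then show "x + u *\<^sub>R s \<in> ball x d2" by simp
      qed
      have c: "((\<lambda>u. f (a + u *\<^sub>R s)) has_vector_derivative f' (a + u *\<^sub>R s) s) (at u within {0..h})"
        if "a + u *\<^sub>R s \<in> U" for a
      proof -
        have "((\<lambda>u. a + u *\<^sub>R s) has_derivative (\<lambda>v. v *\<^sub>R s)) (at u within {0..h})"
          by (auto intro!: derivative_eq_intros)
        from has_derivative_compose[OF this f'[OF that]] show ?thesis
          using linear_scale[OF has_derivative_linear[OF f'[OF that]]]
          by (simp add: has_vector_derivative_def)
      qed
      have a1: "x + u *\<^sub>R s + h *\<^sub>R t = (x + h *\<^sub>R t) + u *\<^sub>R s" for u by simp
      have lin: "((\<lambda>u. (u * h) *\<^sub>R G t) has_vector_derivative h *\<^sub>R G t) (at u within {0..h})"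
        by (auto intro!: derivative_eq_intros simp: has_vector_derivative_def)
      show "(k has_vector_derivative k' u) (at u within {0..h})"
        unfolding k_def k'_def a1
        by (intro has_vector_derivative_diff c lin i2 i1[unfolded a1])
      have "k' u = (f' (x + u *\<^sub>R s + h *\<^sub>R t) s - f' x s - G (u *\<^sub>R s + h *\<^sub>R t))
            - (f' (x + u *\<^sub>R s) s - f' x s - G (u *\<^sub>R s))"
        by (simp add: k'_def linear_add[OF linG] linear_scale[OF linG])
      also have "norm \<dots> \<le> e' * norm (u *\<^sub>R s + h *\<^sub>R t) + e' * norm (u *\<^sub>R s)"
        using d1(2)[of "x + u *\<^sub>R s + h *\<^sub>R t"] d1(2)[of "x + u *\<^sub>R s"] n1[OF u] n2[OF u] lt hC
        by (intro order_trans[OF norm_triangle_ineq4 add_mono]) (simp_all add: add.assoc)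
      also have "\<dots> \<le> e' * (h * (norm s + norm t)) + e' * (h * norm s)"
        using n1[OF u] n2[OF u] e' by (intro add_mono mult_left_mono) auto
      also have "\<dots> \<le> e' * (h * C)"
        using e' h unfolding C_def by (simp add: algebra_simps)
      also have "\<dots> = e * h" using C by (simp add: e'_def)
      finally show "norm (k' u) \<le> e * h" .
    qed (use h in auto)
    then show ?thesis by (simp add: k_def algebra_simps)
  qed
  moreover have "d > 0" using d1 d2 C by (simp add: d_def)
  ultimately show ?thesis by blast
qed

text \<open>The second difference is symmetric in \<open>s\<close> and \<open>t\<close>, so
  \<open>h\<^sup>2 G t\<close> and \<open>h\<^sup>2 H s\<close> approximate the same vector.
  Allowing each an error of a quarter of \<open>norm (G t - H s)\<close> is contradictory unless the
  two agree.\<close>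

lemma symmetric_second_derivative:
  fixes f :: "'a::real_normed_vector \<Rightarrow> 'b::real_normed_vector"
  assumes U: "open U" "x \<in> U" and f': "\<And>y. y \<in> U \<Longrightarrow> (f has_derivative f' y) (at y)"
    and G: "((\<lambda>y. f' y s) has_derivative G) (at x)"
    and H: "((\<lambda>y. f' y t) has_derivative H) (at x)"
  shows "G t = H s"
proof (rule ccontr)
  assume "G t \<noteq> H s"
  then have p: "norm (G t - H s) / 4 > 0" by simp
  let ?e = "norm (G t - H s) / 4"
  obtain d1 where d1: "d1 > 0" "\<And>h. 0 < h \<Longrightarrow> h < d1 \<Longrightarrow>
      norm (f (x + h *\<^sub>R s + h *\<^sub>R t) - f (x + h *\<^sub>R s) - f (x + h *\<^sub>R t) + f x - (h * h) *\<^sub>R G t) \<le> ?e * (h * h)"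
    using second_difference_approx[OF U f' G p, where t = t] by blast
  obtain d2 where d2: "d2 > 0" "\<And>h. 0 < h \<Longrightarrow> h < d2 \<Longrightarrow>
      norm (f (x + h *\<^sub>R t + h *\<^sub>R s) - f (x + h *\<^sub>R t) - f (x + h *\<^sub>R s) + f x - (h * h) *\<^sub>R H s) \<le> ?e * (h * h)"
    using second_difference_approx[OF U f' H p, where t = s] by blast
  define h where "h = min d1 d2 / 2"
  have h: "0 < h" "h < d1" "h < d2" using d1 d2 by (auto simp: h_def)
  let ?D = "f (x + h *\<^sub>R s + h *\<^sub>R t) - f (x + h *\<^sub>R s) - f (x + h *\<^sub>R t) + f x"
  have eq: "f (x + h *\<^sub>R t + h *\<^sub>R s) - f (x + h *\<^sub>R t) - f (x + h *\<^sub>R s) + f x = ?D"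
    by (simp add: algebra_simps)
  have "norm (?D - (h * h) *\<^sub>R H s) \<le> ?e * (h * h)" using d2(2)[OF h(1,3)] unfolding eq .
  moreover have "norm (?D - (h * h) *\<^sub>R G t) \<le> ?e * (h * h)" using d1(2)[OF h(1,2)] .
  moreover have eq2: "(h * h) *\<^sub>R (G t - H s) = (?D - (h * h) *\<^sub>R H s) - (?D - (h * h) *\<^sub>R G t)"
    by (simp add: algebra_simps)
  ultimately have "norm ((h * h) *\<^sub>R (G t - H s)) \<le> ?e * (h * h) + ?e * (h * h)"
    using norm_triangle_ineq4[of "?D - (h * h) *\<^sub>R H s" "?D - (h * h) *\<^sub>R G t"]
    unfolding eq2 by linarith
  then show False using h p by simp
qed

section \<open>Smoothness of determinants and of matrix inversion\<close>

lemma Ck_on_det: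
  fixes A :: "_ \<Rightarrow> real^'n^'n::finite"
  assumes "open U" "\<And>i j. Ck_on k U (\<lambda>x. A x $ i $ j)"
  shows "Ck_on k U (\<lambda>x. det (A x))"
  unfolding det_def
  by (intro Ck_on_sum Ck_on_mult Ck_on_prod Ck_on_const assms)

lemma matrix_inv_mult:
  fixes A :: "real^'n^'n::finite"
  assumes "det A \<noteq> 0"
  shows "A ** matrix_inv A = mat 1" "matrix_inv A ** A = mat 1"
proof -
  have "\<exists>B. A ** B = mat 1 \<and> B ** A = mat 1"
    using assms invertible_det_nz invertible_def by blast
  from someI_ex[OF this] show "A ** matrix_inv A = mat 1" "matrix_inv A ** A = mat 1"
    by (simp_all add: matrix_inv_def)
qed

text \<open>Column \<open>j\<close> of the inverse solves \<open>A *v y = axis j 1\<close>. Cramer's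
  rule expresses its entries by determinants, in which smooth dependence on \<open>A\<close> is
  visible.\<close>

lemma matrix_inv_entry_cramer:
  fixes A :: "real^'n^'n::finite"
  assumes "det A \<noteq> 0"
  shows "matrix_inv A $ k $ j =
    det (\<chi> i l. if l = k then axis j 1 $ i else A $ i $ l) * inverse (det A)"
proof -
  have "A ** matrix_inv A = mat 1"
    by (rule matrix_inv_mult[OF assms])
  then have "A *v (matrix_inv A *v axis j 1) = axis j 1"
    by (simp add: matrix_vector_mul_assoc)
  then have "matrix_inv A *v axis j 1 =
      (\<chi> k. det (\<chi> i l. if l = k then axis j 1 $ i else A $ i $ l) / det A)"
    using cramer[OF assms] by blast
  then have "(matrix_inv A *v axis j 1) $ k = det (\<chi> i l. if l = k then axis j 1 $ i else A $ i $ l) / det A"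
    by simp
  then show ?thesis by (simp add: matrix_vector_mult_basis column_def divide_inverse)
qed

lemma Ck_on_matrix_inv:
  fixes A :: "_ \<Rightarrow> real^'n^'n::finite"
  assumes U: "open U" and A: "Ck_on k U A" and nz: "\<And>x. x \<in> U \<Longrightarrow> det (A x) \<noteq> 0"
  shows "Ck_on k U (\<lambda>x. matrix_inv (A x))"
proof (intro Ck_on_vec[OF U])
  fix i j :: 'n
  have e: "Ck_on k U (\<lambda>x. A x $ i $ j)" for i j
    by (intro Ck_on_nth U A)
  have "Ck_on k U (\<lambda>x. det (\<chi> i' l. if l = i then axis j 1 $ i' else A x $ i' $ l) * inverse (det (A x)))"
  proof (intro Ck_on_mult U Ck_on_inverse nz Ck_on_det)
    show "Ck_on k U (\<lambda>x. (\<chi> i' l. if l = i then axis j 1 $ i' else A x $ i' $ l) $ i' $ l)" for i' l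
      by (cases "l = i") (auto intro: Ck_on_const e)
  qed (use e in auto)
  then show "Ck_on k U (\<lambda>x. matrix_inv (A x) $ i $ j)"
    by (rule Ck_on_cong[OF U, rotated]) (rule matrix_inv_entry_cramer[OF nz, symmetric])
qed

text \<open>The powers of \<open>inverse t\<close> are included so that the family is closed under
  differentiation up to linear combinations; smoothness of the flat exponential, the case
  \<open>k = 0\<close>, is proved for all members at once.\<close>

definition flat_exp :: "nat \<Rightarrow> real \<Rightarrow> real" where
  "flat_exp k t = (if t \<le> 0 then 0 else exp (- inverse t) * inverse t ^ k)"

lemma flat_exp_tendsto_0: "(flat_exp k \<longlongrightarrow> 0) (at 0)"
proof -
  have "((\<lambda>t. inverse t ^ k / exp (inverse t)) \<longlongrightarrow> 0) (at_right (0::real))"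
    by (rule filterlim_compose[OF tendsto_power_div_exp_0 filterlim_inverse_at_top_right])
  moreover have "\<forall>\<^sub>F t in at_right 0. inverse t ^ k / exp (inverse t) = flat_exp k t"
    by (auto simp: flat_exp_def exp_minus field_simps eventually_at_filter)
  ultimately have "(flat_exp k \<longlongrightarrow> 0) (at_right 0)"
    using tendsto_cong by force
  moreover have "(flat_exp k \<longlongrightarrow> 0) (at_left 0)"
    by (rule tendsto_eventually) (auto simp: flat_exp_def eventually_at_filter)
  ultimately show ?thesis using filterlim_split_at by blast
qed

lemma flat_exp_DERIV:
  "(flat_exp k has_real_derivative flat_exp (k + 2) t - real k * flat_exp (k + 1) t) (at t)"
proof (cases t "0 :: real" rule: linorder_cases)
  case less
  have "((\<lambda>_. 0) has_real_derivative 0) (at t)" by simp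
  then have "(flat_exp k has_real_derivative 0) (at t)"
    by (rule has_field_derivative_transform_within_open[of _ _ _ "{..<0}"])
      (use less in \<open>auto simp: flat_exp_def\<close>)
  then show ?thesis using less by (simp add: flat_exp_def)
next
  case equal
  have "((\<lambda>h. flat_exp (Suc k) h) \<longlongrightarrow> 0) (at 0)" by (rule flat_exp_tendsto_0)
  \<comment> \<open>The difference quotient at 0 is the next member of the family. The identity also
    holds at \<open>h = 0\<close>, where division by zero makes both sides 0.\<close>
  moreover have "flat_exp (Suc k) h = (flat_exp k (0 + h) - flat_exp k 0) / h" for h
    by (auto simp: flat_exp_def field_simps)
  ultimately have "(flat_exp k has_real_derivative 0) (at 0)"
    by (simp add: DERIV_def)
  then show ?thesis using equal by (simp add: flat_exp_def)
next
  case greater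
  let ?i = "inverse t"
  have i: "(inverse has_real_derivative - (?i * ?i)) (at t)"
    using DERIV_inverse[of t UNIV] greater by (simp add: power2_eq_square)
  have "((\<lambda>t. exp (- inverse t) * inverse t ^ k) has_real_derivative
      exp (- ?i) * (real k * (- (?i * ?i) * ?i ^ (k - Suc 0))) + exp (- ?i) * - (- (?i * ?i)) * ?i ^ k) (at t)"
    by (rule DERIV_mult'[OF DERIV_fun_exp[OF DERIV_minus[OF i]] DERIV_power[OF i]])
  also have "exp (- ?i) * (real k * (- (?i * ?i) * ?i ^ (k - Suc 0))) + exp (- ?i) * - (- (?i * ?i)) * ?i ^ k
      = exp (- ?i) * ?i ^ (k + 2) - real k * (exp (- ?i) * ?i ^ (k + 1))"
    by (cases k) (simp_all add: algebra_simps)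
  finally have "((\<lambda>t. exp (- inverse t) * inverse t ^ k) has_real_derivative
      exp (- inverse t) * inverse t ^ (k + 2) - real k * (exp (- inverse t) * inverse t ^ (k + 1))) (at t)" .
  then have "(flat_exp k has_real_derivative
      exp (- inverse t) * inverse t ^ (k + 2) - real k * (exp (- inverse t) * inverse t ^ (k + 1))) (at t)"
    by (rule has_field_derivative_transform_within_open[of _ _ _ "{0<..}"])
      (use greater in \<open>auto simp: flat_exp_def\<close>)
  then show ?thesis using greater by (simp add: flat_exp_def)
qed

lemma Ck_on_flat_exp: "Ck_on j UNIV (flat_exp k)"
proof (induction j arbitrary: k)
  case 0
  have "isCont (flat_exp k) t" for t using flat_exp_DERIV DERIV_isCont by blast
  then show ?case by (simp add: continuous_on_eq_continuous_at)
next
  case (Suc j)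
  show ?case
  proof (rule Ck_on_SucI)
    show "(flat_exp k has_derivative (\<lambda>v. (flat_exp (k + 2) t - real k * flat_exp (k + 1) t) * v)) (at t)" for t
      using flat_exp_DERIV[of k t] by (simp add: has_field_derivative_def)
    show "Ck_on j UNIV (\<lambda>t. (flat_exp (k + 2) t - real k * flat_exp (k + 1) t) * v)" for v
      by (intro Ck_on_mult Ck_on_diff Ck_on_const Suc) auto
  qed simp
qed

text \<open>\<open>?q\<close> is positive exactly inside the ball, and the flat exponential vanishes
  on nonpositive arguments. The value at the centre is all that the extension of a tangent vector to
  a field uses, so there is no plateau.\<close>

lemma smooth_bump_exists:
  fixes a :: "'a::euclidean_space"
  assumes "r > 0"
  obtains \<rho> :: "'a \<Rightarrow> real" where "\<And>k. Ck_on k UNIV \<rho>" "\<rho> a = 1" "\<And>x. x \<notin> cball a r \<Longrightarrow> \<rho> x = 0"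
proof
  let ?q = "\<lambda>x. r * r - (x - a) \<bullet> (x - a)"
  let ?c = "inverse (flat_exp 0 (r * r))"
  let ?\<rho> = "\<lambda>x. ?c * flat_exp 0 (?q x)"
  have q: "Ck_on k UNIV ?q" for k
    by (intro Ck_on_diff Ck_on_const Ck_on_bilinear[OF bounded_bilinear_inner] Ck_on_id) auto
  show "Ck_on k UNIV ?\<rho>" for k
    by (intro Ck_on_mult Ck_on_const Ck_on_compose[OF _ _ _ q Ck_on_flat_exp]) auto
  have "flat_exp 0 (r * r) \<noteq> 0" using assms by (auto simp: flat_exp_def mult_le_0_iff)
  then show "?\<rho> a = 1" by simp
  show "?\<rho> x = 0" if "x \<notin> cball a r" for x
  proof -
    have "r < norm (x - a)" using that by (simp add: dist_norm norm_minus_commute)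
    then have "r * r \<le> norm (x - a) * norm (x - a)" using assms by (intro mult_mono) auto
    then have "?q x \<le> 0" by (simp add: power2_norm_eq_inner[symmetric] power2_eq_square)
    then show ?thesis by (simp add: flat_exp_def)
  qed
qed


section \<open>Total differential equations\<close>

text \<open>At a point \<open>m\<close> where \<open>norm (h m)\<close> is maximal, the mean value
  inequality on an interval of length at most 1 gives
  \<open>norm (h m) \<le> norm (h m) / 2 + b\<close>, and half of the maximum is absorbed on the
  left.\<close>

lemma linear_gronwall_small:
  fixes h :: "real \<Rightarrow> 'b::real_normed_vector"
  assumes h': "\<And>t. t \<in> {0..1} \<Longrightarrow> (h has_vector_derivative h' t) (at t within {0..1})"
    and b: "\<And>t. t \<in> {0..1} \<Longrightarrow> norm (h' t) \<le> norm (h t) / 2 + b" and h0: "h 0 = 0"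
    and t: "t \<in> {0..1}"
  shows "norm (h t) \<le> 2 * b"
proof -
  have "continuous_on {0..1} h"
    using h' has_vector_derivative_continuous continuous_on_eq_continuous_within by blast
  then have "continuous_on {0..1} (\<lambda>t. norm (h t))" by (intro continuous_intros)
  then obtain m where m: "m \<in> {0..1}" "\<And>t. t \<in> {0..1} \<Longrightarrow> norm (h t) \<le> norm (h m)"
    using continuous_attains_sup[of "{0..1 :: real}" "\<lambda>t. norm (h t)"] by auto
  have B: "norm (h' t) \<le> norm (h m) / 2 + b" if "t \<in> {0..1}" for t
    using b[OF that] m(2)[OF that] by linarith
  have "norm (h m - h 0) \<le> (norm (h m) / 2 + b) * (m - 0)"
  proof (rule vector_derivative_norm_bound)
    show "(h has_vector_derivative h' u) (at u within {0..m})" if "u \<in> {0..m}" for u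
      using has_vector_derivative_within_subset[OF h', of u "{0..m}"] that m(1) by auto
  qed (use B m in auto)
  also have "\<dots> \<le> (norm (h m) / 2 + b) * 1"
    using m(1) order_trans[OF norm_ge_zero B[OF m(1)]] by (intro mult_left_mono) auto
  finally have "norm (h m) \<le> 2 * b" using h0 by simp
  then show ?thesis using m(2)[OF t] by linarith
qed

text \<open>Continuity of the derivative is available one direction at a time. Compactness bounds
  the finitely many basis directions, and the sum of these bounds serves for every
  \<open>v\<close>.\<close>

lemma derivative_bound_Ck1:
  fixes f :: "'a::euclidean_space \<Rightarrow> 'b::real_normed_vector"
  assumes f: "Ck_on (Suc 0) U f" and C: "compact C" "C \<subseteq> U"
  shows "\<exists>M\<ge>0. \<forall>x\<in>C. \<forall>v. norm (frechet_derivative f (at x) v) \<le> M * norm v"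
proof -
  have "\<exists>K. \<forall>x\<in>C. norm (frechet_derivative f (at x) b) \<le> K" for b
  proof -
    have "continuous_on C (\<lambda>x. frechet_derivative f (at x) b)"
      by (rule continuous_on_subset[OF _ C(2)]) (use f in auto)
    then have "bounded ((\<lambda>x. frechet_derivative f (at x) b) ` C)"
      using C(1) compact_continuous_image compact_imp_bounded by blast
    then show ?thesis by (auto simp: bounded_iff)
  qed
  then obtain K where K: "\<And>x b. x \<in> C \<Longrightarrow> norm (frechet_derivative f (at x) b) \<le> K b" by metis
  let ?M = "\<Sum>b\<in>Basis. \<bar>K b\<bar>"
  have "norm (frechet_derivative f (at x) v) \<le> ?M * norm v" if x: "x \<in> C" for x v
  proof -
    have l: "linear (frechet_derivative f (at x))"
      using Ck_on_SucD[OF f] x C(2) has_derivative_linear by blast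
    have "frechet_derivative f (at x) (\<Sum>b\<in>Basis. (v \<bullet> b) *\<^sub>R b) =
        (\<Sum>b\<in>Basis. (v \<bullet> b) *\<^sub>R frechet_derivative f (at x) b)"
      by (simp only: linear_sum[OF l] linear_scale[OF l])
    then have "frechet_derivative f (at x) v = (\<Sum>b\<in>Basis. (v \<bullet> b) *\<^sub>R frechet_derivative f (at x) b)"
      unfolding euclidean_representation .
    also have "norm \<dots> \<le> (\<Sum>b\<in>Basis. norm v * \<bar>K b\<bar>)"
      by (rule sum_norm_le) (auto intro!: mult_mono Basis_le_norm order_trans[OF K[OF x]])
    finally show ?thesis by (simp add: sum_distrib_left mult.commute)
  qed
  then show ?thesis by (intro exI[of _ ?M]) (auto intro: sum_nonneg)
qed

lemma Lipschitz_Ck1: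
  fixes f :: "'a::euclidean_space \<Rightarrow> 'b::real_normed_vector"
  assumes f: "Ck_on (Suc 0) U f" and C: "compact C" "convex C" "C \<subseteq> U"
  shows "\<exists>M\<ge>0. \<forall>x\<in>C. \<forall>y\<in>C. norm (f x - f y) \<le> M * norm (x - y)"
proof -
  obtain M where M: "M \<ge> 0" "\<And>x v. x \<in> C \<Longrightarrow> norm (frechet_derivative f (at x) v) \<le> M * norm v"
    using derivative_bound_Ck1[OF f C(1,3)] by blast
  have "norm (f x - f y) \<le> M * norm (x - y)" if "x \<in> C" "y \<in> C" for x y
  proof (rule differentiable_bound[OF C(2) _ _ that])
    show "(f has_derivative frechet_derivative f (at x)) (at x within C)" if "x \<in> C" for x
      using has_derivative_at_withinI[OF Ck_on_SucD[OF f]] that C(3) by blast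
    show "onorm (frechet_derivative f (at x)) \<le> M" if "x \<in> C" for x
      using M(2)[OF that] by (rule onorm_le)
  qed
  then show ?thesis using M(1) by blast
qed

text \<open>The remainder estimate applies the Lipschitz bound for the derivative along the segment
  from \<open>x\<close> to \<open>y\<close>; convexity keeps the segment in \<open>C\<close>. A
  common constant keeps the later error estimates short.\<close>

lemma second_order_bounds_Ck2:
  fixes f :: "'a::euclidean_space \<Rightarrow> 'b::real_normed_vector"
  assumes f: "Ck_on (Suc (Suc 0)) U f" and C: "compact C" "convex C" "C \<subseteq> U"
  obtains M where "M \<ge> 0"
    "\<And>x v. x \<in> C \<Longrightarrow> norm (frechet_derivative f (at x) v) \<le> M * norm v"
    "\<And>x y. x \<in> C \<Longrightarrow> y \<in> C \<Longrightarrow> norm (f x - f y) \<le> M * norm (x - y)"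
    "\<And>x y. x \<in> C \<Longrightarrow> y \<in> C \<Longrightarrow>
      norm (f y - f x - frechet_derivative f (at x) (y - x)) \<le> M * norm (y - x) ^ 2"
proof -
  have f1: "Ck_on (Suc 0) U f" using Ck_on_Suc_lower[OF f] .
  obtain M1 where M1: "M1 \<ge> 0" "\<And>x v. x \<in> C \<Longrightarrow> norm (frechet_derivative f (at x) v) \<le> M1 * norm v"
    using derivative_bound_Ck1[OF f1 C(1,3)] by blast
  obtain M2 where M2: "M2 \<ge> 0" "\<And>x y. x \<in> C \<Longrightarrow> y \<in> C \<Longrightarrow> norm (f x - f y) \<le> M2 * norm (x - y)"
    using Lipschitz_Ck1[OF f1 C] by blast
  have "\<exists>K\<ge>0. \<forall>x\<in>C. \<forall>y\<in>C. norm (frechet_derivative f (at x) b - frechet_derivative f (at y) b) \<le> K * norm (x - y)" for b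
  proof -
    have "Ck_on (Suc 0) U (\<lambda>x. frechet_derivative f (at x) b)" using f by simp
    from Lipschitz_Ck1[OF this C] show ?thesis .
  qed
  then obtain K where K: "\<And>b. K b \<ge> 0" "\<And>x y b. x \<in> C \<Longrightarrow> y \<in> C \<Longrightarrow>
      norm (frechet_derivative f (at x) b - frechet_derivative f (at y) b) \<le> K b * norm (x - y)" by metis
  let ?K = "\<Sum>b\<in>Basis. K b"
  have d: "norm (frechet_derivative f (at x) v - frechet_derivative f (at y) v) \<le> ?K * norm (x - y) * norm v"
    if x: "x \<in> C" and y: "y \<in> C" for x y v
  proof -
    have l: "linear (frechet_derivative f (at z))" if "z \<in> C" for z
      using Ck_on_SucD[OF f] that C(3) has_derivative_linear by blast
    have "frechet_derivative f (at z) (\<Sum>b\<in>Basis. (v \<bullet> b) *\<^sub>R b) =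
        (\<Sum>b\<in>Basis. (v \<bullet> b) *\<^sub>R frechet_derivative f (at z) b)" if "z \<in> C" for z
      by (simp only: linear_sum[OF l[OF that]] linear_scale[OF l[OF that]])
    then have e: "frechet_derivative f (at z) v = (\<Sum>b\<in>Basis. (v \<bullet> b) *\<^sub>R frechet_derivative f (at z) b)"
      if "z \<in> C" for z
      using that unfolding euclidean_representation by blast
    have "frechet_derivative f (at x) v - frechet_derivative f (at y) v =
       (\<Sum>b\<in>Basis. (v \<bullet> b) *\<^sub>R (frechet_derivative f (at x) b - frechet_derivative f (at y) b))"
      unfolding e[OF x] e[OF y] by (simp add: sum_subtractf scaleR_diff_right)
    also have "norm \<dots> \<le> (\<Sum>b\<in>Basis. norm v * (K b * norm (x - y)))"
      by (rule sum_norm_le) (auto intro!: mult_mono Basis_le_norm K x y)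
    also have "\<dots> = ?K * norm (x - y) * norm v"
      by (simp add: sum_distrib_left sum_distrib_right mult_ac)
    finally show ?thesis .
  qed
  have K0: "?K \<ge> 0" by (intro sum_nonneg K)
  have q: "norm (f y - f x - frechet_derivative f (at x) (y - x)) \<le> ?K * norm (y - x) ^ 2"
    if x: "x \<in> C" and y: "y \<in> C" for x y
  proof -
    have seg: "x + t *\<^sub>R (y - x) \<in> C" if "t \<in> {0..1}" for t
      using convexD_alt[OF C(2) x y, of t] that by (simp add: algebra_simps)
    let ?S = "(\<lambda>t. x + t *\<^sub>R (y - x)) ` {0..1}"
    have "norm (f y - f x - frechet_derivative f (at x) (y - x)) \<le> norm (y - x) * (?K * norm (y - x))"
    proof (rule differentiable_bound_linearization[where S = ?S and f' = "\<lambda>z. frechet_derivative f (at z)"])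
      show "(f has_derivative frechet_derivative f (at z)) (at z within ?S)" if "z \<in> ?S" for z
        using has_derivative_at_withinI[OF Ck_on_SucD[OF f]] that seg C(3) by blast
      show "onorm (frechet_derivative f (at z) - frechet_derivative f (at x)) \<le> ?K * norm (y - x)"
        if z: "z \<in> ?S" for z
      proof (rule onorm_le)
        fix v :: 'a
        obtain t where t: "t \<in> {0..1}" "z = x + t *\<^sub>R (y - x)" using z by blast
        have "norm (z - x) \<le> norm (y - x)" using t by (simp add: mult_left_le_one_le)
        then have "?K * norm (z - x) * norm v \<le> ?K * norm (y - x) * norm v"
          using K0 by (intro mult_right_mono mult_left_mono) auto
        then show "norm ((frechet_derivative f (at z) - frechet_derivative f (at x)) v) \<le> ?K * norm (y - x) * norm v"
          using d[of z x v] seg t x by fastforce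
      qed
      show "x \<in> ?S" by (rule image_eqI[of _ _ 0]) auto
    qed auto
    then show ?thesis by (simp add: power2_eq_square mult_ac)
  qed
  let ?M = "max M1 (max M2 ?K)"
  show ?thesis
  proof (rule that[of ?M])
    show "?M \<ge> 0" using M1(1) by simp
    show "norm (frechet_derivative f (at x) v) \<le> ?M * norm v" if "x \<in> C" for x v
      by (rule order_trans[OF M1(2)[OF that] mult_right_mono]) auto
    show "norm (f x - f y) \<le> ?M * norm (x - y)" if "x \<in> C" "y \<in> C" for x y
      by (rule order_trans[OF M2(2)[OF that] mult_right_mono]) auto
    show "norm (f y - f x - frechet_derivative f (at x) (y - x)) \<le> ?M * norm (y - x) ^ 2"
      if "x \<in> C" "y \<in> C" for x y
      by (rule order_trans[OF q[OF that] mult_right_mono]) auto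
  qed
qed

section \<open>Integration along rays and differentiability in the parameter\<close>

lemma bounded_bilinear_matrix_vector:
  "bounded_bilinear (\<lambda>(A :: real^'n^'m) (x :: real^'n). A *v x)"
  unfolding bilinear_conv_bounded_bilinear[symmetric] bilinear_def
  by (auto intro!: linearI simp: matrix_vector_mult_add_rdistrib matrix_vector_right_distrib
      scaleR_matrix_vector_assoc matrix_vector_mult_scaleR)

lemma bounded_bilinear_matrix_matrix:
  "bounded_bilinear (\<lambda>(A :: real^'n^'m) (B :: real^'p^'n). A ** B)"
  unfolding bilinear_conv_bounded_bilinear[symmetric] bilinear_def
  by (auto intro!: linearI simp: vec_eq_iff matrix_matrix_mult_def sum.distrib sum_distrib_left algebra_simps)

text \<open>The integral equation for all rays together is a fixed point equation for one bounded
  continuous function of \<open>y\<close>. Since \<open>M * \<epsilon> \<le> 1 / 2\<close>, the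
  integral operator is a contraction with factor 1/2 in the supremum norm.\<close>

lemma radial_solution_exists:
  fixes Q :: "real^'n::finite \<Rightarrow> real^'n^'n"
  assumes e: "\<epsilon> > 0" "M \<ge> 0" "M * \<epsilon> \<le> 1 / 2"
    and cont: "continuous_on UNIV Q"
    and bnd: "\<And>x u. norm (Q x *v u) \<le> M * norm u"
    and lip: "\<And>x y u. norm (Q x *v u - Q y *v u) \<le> M * norm (x - y) * norm u"
  obtains \<phi> where "\<phi> 0 = x0"
    "\<And>y t. norm y \<le> \<epsilon> \<Longrightarrow> t \<in> {0..1} \<Longrightarrow>
      ((\<lambda>t. \<phi> (t *\<^sub>R y)) has_vector_derivative Q (\<phi> (t *\<^sub>R y)) *v y) (at t within {0..1})"
proof -
  \<comment> \<open>The nearest-point map retracts the whole space onto the ball. Thus the operator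
    acts on functions defined everywhere, as the type of bounded continuous functions demands, and
    is the intended one on the ball.\<close>
  define c where "c = closest_point (cball (0::real^'n) \<epsilon>)"
  have c_le: "norm (c y) \<le> \<epsilon>" for y
    using closest_point_in_set[of "cball 0 \<epsilon>" y] e(1) by (auto simp: c_def)
  have c_id: "c y = y" if "norm y \<le> \<epsilon>" for y
    using that by (simp add: c_def closest_point_self)
  have c_cont: "continuous_on UNIV c"
    unfolding c_def using e(1) by (intro continuous_on_closest_point) auto
  define T where "T f y = x0 + integral {0..1} (\<lambda>t. Q (f (t *\<^sub>R c y)) *v c y)" for f y
  have contQ: "continuous_on S (\<lambda>z. Q (f (g z)) *v k z)"
    if "continuous_on UNIV f" "continuous_on S g" "continuous_on S k"
    for S :: "'z::topological_space set" and f :: "real^'n \<Rightarrow> real^'n" and g k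
  proof (rule bounded_bilinear.continuous_on[OF bounded_bilinear_matrix_vector _ that(3)])
    have "continuous_on S (\<lambda>z. f (g z))"
      by (rule continuous_on_compose2[OF that(1,2)]) auto
    then show "continuous_on S (\<lambda>z. Q (f (g z)))"
      by (rule continuous_on_compose2[OF cont]) auto
  qed
  have T_cont: "continuous_on UNIV (T f)" if f: "continuous_on UNIV f" for f
  proof -
    have "continuous_on (UNIV \<times> cbox 0 1) (\<lambda>z. Q (f (snd z *\<^sub>R c (fst z))) *v c (fst z))"
      by (intro contQ f continuous_intros continuous_on_compose2[OF c_cont]) auto
    then have "continuous_on UNIV (\<lambda>y. integral (cbox 0 1) (\<lambda>t. Q (f (t *\<^sub>R c y)) *v c y))"
      by (intro integral_continuous_on_param) (simp add: case_prod_unfold)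
    then show ?thesis unfolding T_def by (intro continuous_intros) simp
  qed
  have Icont: "continuous_on {0..1} (\<lambda>t. Q (f (t *\<^sub>R c y)) *v c y)" if "continuous_on UNIV f" for f y
    by (intro contQ that continuous_intros)
  have Mc: "M * norm (c y) \<le> 1 / 2" for y
    using mult_left_mono[OF c_le e(2)] e(3) order_trans by blast
  have T_bound: "norm (T f y) \<le> norm x0 + 1 / 2" if f: "continuous_on UNIV f" for f y
  proof -
    have "norm (integral {0..1} (\<lambda>t. Q (f (t *\<^sub>R c y)) *v c y)) \<le> 1 / 2 * (1 - 0)"
      by (rule integral_bound) (use Icont[OF f] order_trans[OF bnd Mc] in auto)
    then show ?thesis unfolding T_def by (intro order_trans[OF norm_triangle_ineq]) simp
  qed
  have T_bc: "T f \<in> bcontfun" if "continuous_on UNIV f" for f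
    using T_cont[OF that] T_bound[OF that] by (rule bcontfun_normI)
  \<comment> \<open>A fixed point of \<open>T\<close> satisfies the integral equation along each ray of the ball.\<close>
  define TT where "TT f = Bcontfun (T (apply_bcontfun f))" for f
  have TT: "apply_bcontfun (TT f) = T (apply_bcontfun f)" for f
    unfolding TT_def by (rule Bcontfun_inverse[OF T_bc]) simp
  have "dist (TT f) (TT g) \<le> 1 / 2 * dist f g" for f g
  proof (rule dist_bound)
    fix y
    have cf: "continuous_on UNIV (apply_bcontfun f)" "continuous_on UNIV (apply_bcontfun g)" by simp_all
    have "TT f y - TT g y = integral {0..1} (\<lambda>t. Q (f (t *\<^sub>R c y)) *v c y) -
        integral {0..1} (\<lambda>t. Q (g (t *\<^sub>R c y)) *v c y)"
      by (simp add: TT T_def)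
    also have "\<dots> = integral {0..1} (\<lambda>t. Q (f (t *\<^sub>R c y)) *v c y - Q (g (t *\<^sub>R c y)) *v c y)"
      by (rule Henstock_Kurzweil_Integration.integral_diff[symmetric])
        (intro integrable_continuous_real Icont cf)+
    also have "norm \<dots> \<le> 1 / 2 * dist f g * (1 - 0)"
    proof (rule integral_bound)
      show "continuous_on {0..1} (\<lambda>t. Q (f (t *\<^sub>R c y)) *v c y - Q (g (t *\<^sub>R c y)) *v c y)"
        by (intro continuous_on_diff Icont cf)
      fix t :: real
      have "norm (Q (f (t *\<^sub>R c y)) *v c y - Q (g (t *\<^sub>R c y)) *v c y)
          \<le> M * norm (f (t *\<^sub>R c y) - g (t *\<^sub>R c y)) * norm (c y)" by (rule lip)
      also have "\<dots> = (M * norm (c y)) * dist (f (t *\<^sub>R c y)) (g (t *\<^sub>R c y))"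
        by (simp add: dist_norm)
      also have "\<dots> \<le> 1 / 2 * dist f g"
        using Mc e(2) by (intro mult_mono dist_bounded) auto
      finally show "norm (Q (f (t *\<^sub>R c y)) *v c y - Q (g (t *\<^sub>R c y)) *v c y) \<le> 1 / 2 * dist f g" .
    qed simp
    finally show "dist (TT f y) (TT g y) \<le> 1 / 2 * dist f g" by (simp add: dist_norm)
  qed
  then obtain F where F: "TT F = F"
    using banach_fix_type[of "1 / 2" TT] by auto
  define \<phi> where "\<phi> = apply_bcontfun F"
  have \<phi>c: "continuous_on UNIV \<phi>" by (simp add: \<phi>_def)
  have fp: "\<phi> y = x0 + integral {0..1} (\<lambda>t. Q (\<phi> (t *\<^sub>R y)) *v y)" if "norm y \<le> \<epsilon>" for y
  proof -
    have "\<phi> y = T \<phi> y" using fun_cong[OF TT[of F], of y] F by (simp add: \<phi>_def)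
    then show ?thesis unfolding T_def c_id[OF that] .
  qed
  show ?thesis
  proof
    show "\<phi> 0 = x0" using fp[of 0] e(1) by simp
    fix y :: "real^'n" and t :: real
    assume y: "norm y \<le> \<epsilon>" and t: "t \<in> {0..1}"
    define f where "f t = Q (\<phi> (t *\<^sub>R y)) *v y" for t :: real
    have fc: "continuous_on {0..1} f"
      unfolding f_def by (intro contQ \<phi>c continuous_intros)
    define H where "H s = integral {0..s} f" for s
    have H: "(H has_vector_derivative f s) (at s within {0..1})" if "s \<in> {0..1}" for s
      unfolding H_def by (rule integral_has_vector_derivative[OF fc that])
    \<comment> \<open>The fixed point equation at \<open>s y\<close> integrates over
      \<open>[0, 1]\<close> along a shorter ray. The substitution \<open>t\<close> to
      \<open>s t\<close> turns this into an integral over \<open>[0, s]\<close> along the ray of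
      \<open>y\<close>; applying the fundamental theorem to \<open>H (s * t)\<close> covers
      \<open>s = 0\<close> as well.\<close>
    have eq: "\<phi> (s *\<^sub>R y) = x0 + H s" if s: "s \<in> {0..1}" for s
    proof -
      have "((\<lambda>t. s *\<^sub>R f (s * t)) has_integral H (s * 1) - H (s * 0)) {0..1}"
      proof (rule fundamental_theorem_of_calculus)
        fix t :: real assume t: "t \<in> {0..1}"
        have st: "s * t \<in> {0..1}" using s t by (auto simp: mult_le_one)
        have "(\<lambda>t. s * t) ` {0..1} \<subseteq> {0..1}" using s by (auto simp: mult_le_one)
        then have Hs: "(H has_vector_derivative f (s * t)) (at (s * t) within (\<lambda>t. s * t) ` {0..1})"
          using has_vector_derivative_within_subset[OF H[OF st]] by blast
        have "((\<lambda>t. s * t) has_vector_derivative s) (at t within {0..1})"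
          by (auto intro!: derivative_eq_intros)
        from vector_diff_chain_within[OF this Hs]
        show "((\<lambda>t. H (s * t)) has_vector_derivative s *\<^sub>R f (s * t)) (at t within {0..1})"
          by (simp add: o_def)
      qed simp
      moreover have "H 0 = 0" by (simp add: H_def)
      ultimately have "((\<lambda>t. s *\<^sub>R f (s * t)) has_integral H s) {0..1}" by simp
      then have "integral {0..1} (\<lambda>t. s *\<^sub>R f (s * t)) = H s" by (rule integral_unique)
      moreover have "norm (s *\<^sub>R y) \<le> \<epsilon>"
        using s y by (simp add: order_trans[OF mult_left_le_one_le])
      ultimately show ?thesis
        by (simp add: fp f_def matrix_vector_mult_scaleR mult.commute)
    qed
    have "((\<lambda>s. x0 + H s) has_vector_derivative f t) (at t within {0..1})"
      using H[OF t] by (auto intro!: derivative_eq_intros)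
    then have "((\<lambda>t. \<phi> (t *\<^sub>R y)) has_vector_derivative f t) (at t within {0..1})"
      by (rule has_vector_derivative_transform[OF t, rotated]) (use eq in auto)
    then show "((\<lambda>t. \<phi> (t *\<^sub>R y)) has_vector_derivative Q (\<phi> (t *\<^sub>R y)) *v y) (at t within {0..1})"
      by (simp add: f_def)
  qed
qed

text \<open>For fixed \<open>u\<close> and \<open>v\<close>, \<open>sym\<close> says that the vector
  fields \<open>Q u\<close> and \<open>Q v\<close> commute. It is the integrability condition
  obtained by equating the mixed second derivatives of a solution.\<close>

theorem total_differential_equation:
  fixes Q :: "real^'n::finite \<Rightarrow> real^'n^'n"
  assumes U: "open U" "x0 \<in> U" and Q: "Ck_on (Suc (Suc 0)) U Q"
    and sym: "\<And>x u v. x \<in> U \<Longrightarrow>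
      frechet_derivative Q (at x) (Q x *v u) *v v = frechet_derivative Q (at x) (Q x *v v) *v u"
  obtains \<epsilon> \<phi> where "\<epsilon> > 0" "\<phi> 0 = x0" "\<And>y. y \<in> ball 0 \<epsilon> \<Longrightarrow> \<phi> y \<in> U"
    "\<And>y. y \<in> ball 0 \<epsilon> \<Longrightarrow> (\<phi> has_derivative (\<lambda>u. Q (\<phi> y) *v u)) (at y)"
proof -
  let ?DQ = "\<lambda>x. frechet_derivative Q (at x)"
  obtain R where R: "R > 0" "cball x0 R \<subseteq> U"
    using U open_contains_cball by blast
  let ?C = "cball x0 R"
  obtain M0 where M0: "M0 \<ge> 0"
    "\<And>x v. x \<in> ?C \<Longrightarrow> norm (?DQ x v) \<le> M0 * norm v"
    "\<And>x y. x \<in> ?C \<Longrightarrow> y \<in> ?C \<Longrightarrow> norm (Q x - Q y) \<le> M0 * norm (x - y)"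
    "\<And>x y. x \<in> ?C \<Longrightarrow> y \<in> ?C \<Longrightarrow> norm (Q y - Q x - ?DQ x (y - x)) \<le> M0 * norm (y - x) ^ 2"
    using second_order_bounds_Ck2[OF Q compact_cball convex_cball R(2)] by metis
  have Qcont: "continuous_on ?C Q"
    by (rule continuous_on_subset[OF _ R(2)])
      (metis Ck_on.simps(1) Ck_on_Suc_lower Q)
  have "bounded (Q ` ?C)"
    by (rule compact_imp_bounded[OF compact_continuous_image[OF Qcont compact_cball]])
  then obtain B where B: "\<forall>x\<in>?C. norm (Q x) \<le> B"
    unfolding bounded_iff by blast
  obtain L where L: "L > 0" "\<And>(A :: real^'n^'n) x. norm (A *v x) \<le> norm A * norm x * L"
    using bounded_bilinear.pos_bounded[OF bounded_bilinear_matrix_vector] by blast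
  \<comment> \<open>\<open>M0\<close> bounds the derivative and the increments of \<open>Q\<close>,
    \<open>B\<close> bounds \<open>Q\<close> itself, and \<open>L\<close> is the cost of applying a
    matrix to a vector. The summand 1 makes division by \<open>M\<close> legitimate.\<close>
  define M where "M = (M0 + \<bar>B\<bar>) * L + 1"
  have M: "M > 0" using L M0 by (simp add: M_def add_nonneg_pos)
  have mv: "norm (A *v u) \<le> M * b * norm u" if "norm A \<le> M0 * b" "b \<ge> 0" for A :: "real^'n^'n" and u b
  proof -
    have "norm (A *v u) \<le> norm A * norm u * L" by (rule L)
    also have "\<dots> \<le> (M0 * b) * norm u * L"
      using that L(1) by (intro mult_right_mono) auto
    also have "\<dots> = (M0 * L) * (b * norm u)" by simp
    also have "\<dots> \<le> M * (b * norm u)"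
      using that L(1) M0(1) by (intro mult_right_mono) (auto simp: M_def algebra_simps)
    finally show ?thesis by (simp add: mult.assoc)
  qed
  have b1: "norm (Q x *v u) \<le> M * norm u" if "x \<in> ?C" for x u
  proof -
    have "norm (Q x *v u) \<le> norm (Q x) * norm u * L" by (rule L)
    also have "\<dots> \<le> \<bar>B\<bar> * norm u * L"
      using bspec[OF B that] L(1) by (intro mult_right_mono) auto
    also have "\<dots> = (\<bar>B\<bar> * L) * norm u" by simp
    also have "\<dots> \<le> M * norm u"
      using L(1) M0(1) by (intro mult_right_mono) (auto simp: M_def algebra_simps)
    finally show ?thesis .
  qed
  have b2: "norm (Q x *v u - Q y *v u) \<le> M * norm (x - y) * norm u" if "x \<in> ?C" "y \<in> ?C" for x y u
    using mv[OF M0(3)[OF that]] by (simp add: matrix_vector_mult_diff_rdistrib)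
  have b3: "norm (?DQ x w *v u) \<le> M * norm w * norm u" if "x \<in> ?C" for x w u
    using mv[OF M0(2)[OF that]] by simp
  have b4: "norm ((Q y - Q x - ?DQ x (y - x)) *v u) \<le> M * norm (y - x) ^ 2 * norm u"
    if "x \<in> ?C" "y \<in> ?C" for x y u
    using mv[OF M0(4)[OF that]] by simp
  \<comment> \<open>\<open>M * \<epsilon> \<le> 1 / 2\<close> serves both the contraction and the
    two maximum arguments; \<open>M * \<epsilon> \<le> R / 2\<close> keeps the curves inside
    \<open>?C\<close>.\<close>
  define \<epsilon> where "\<epsilon> = min 1 R / (2 * M)"
  have \<epsilon>: "\<epsilon> > 0" "M * \<epsilon> \<le> 1 / 2" "M * \<epsilon> \<le> R / 2"
    using R(1) M by (auto simp: \<epsilon>_def)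
  \<comment> \<open>The bounds on \<open>Q\<close> hold only on \<open>?C\<close>. Composition with
    the nearest-point map, which has Lipschitz constant 1, extends them to the whole space; since
    the solution stays in \<open>?C\<close>, the truncation disappears again.\<close>
  let ?c = "closest_point ?C"
  have cC: "?c x \<in> ?C" for x using closest_point_in_set[of ?C x] R(1) by auto
  have c_cont: "continuous_on UNIV ?c"
    using R(1) by (intro continuous_on_closest_point) auto
  obtain \<phi> where \<phi>0: "\<phi> 0 = x0" and \<phi>c:
    "\<And>y t. norm y \<le> \<epsilon> \<Longrightarrow> t \<in> {0..1} \<Longrightarrow>
      ((\<lambda>t. \<phi> (t *\<^sub>R y)) has_vector_derivative Q (?c (\<phi> (t *\<^sub>R y))) *v y) (at t within {0..1})"
  proof (rule radial_solution_exists[of \<epsilon> M "\<lambda>x. Q (?c x)" x0])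
    show "continuous_on UNIV (\<lambda>x. Q (?c x))"
      by (rule continuous_on_compose2[OF Qcont c_cont]) (use cC in auto)
    show "norm (Q (?c x) *v u - Q (?c y) *v u) \<le> M * norm (x - y) * norm u" for x y u
    proof (rule order_trans[OF b2[OF cC cC]])
      have "norm (?c x - ?c y) \<le> norm (x - y)"
        using closest_point_lipschitz[of ?C x y] R(1) by (auto simp: dist_norm)
      then show "M * norm (?c x - ?c y) * norm u \<le> M * norm (x - y) * norm u"
        using M by (intro mult_right_mono mult_left_mono) auto
    qed
  qed (use \<epsilon> M b1[OF cC] in auto)
  have \<phi>C: "\<phi> y \<in> ?C" if y: "norm y \<le> \<epsilon>" for y
  proof -
    have "norm (\<phi> (1 *\<^sub>R y) - \<phi> (0 *\<^sub>R y)) \<le> (M * norm y) * (1 - 0)"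
      by (rule vector_derivative_norm_bound[OF _ \<phi>c[OF y]]) (use b1[OF cC] in auto)
    moreover have "M * norm y \<le> M * \<epsilon>" using M y by simp
    ultimately show ?thesis
      using \<epsilon>(3) \<phi>0 R(1) by (simp add: dist_norm norm_minus_commute)
  qed
  have ty: "norm (t *\<^sub>R y) \<le> \<epsilon>" if "norm y \<le> \<epsilon>" "t \<in> {0..1}" for t and y :: "real^'n"
    using that by (simp add: order_trans[OF mult_left_le_one_le])
  have \<phi>': "((\<lambda>t. \<phi> (t *\<^sub>R y)) has_vector_derivative Q (\<phi> (t *\<^sub>R y)) *v y) (at t within {0..1})"
    if "norm y \<le> \<epsilon>" "t \<in> {0..1}" for y t
    using \<phi>c[OF that] closest_point_self[OF \<phi>C[OF ty[OF that]]] by simp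
  have key: "norm (\<phi> (y + d) - \<phi> y - Q (\<phi> y) *v d) \<le> 8 * M ^ 2 * norm d ^ 2"
    if y: "norm y \<le> \<epsilon>" and yd: "norm (y + d) \<le> \<epsilon>" for y d
  proof -
    define X where "X t = \<phi> (t *\<^sub>R y)" for t :: real
    define X' where "X' t = \<phi> (t *\<^sub>R (y + d))" for t :: real
    define h where "h t = X' t - X t" for t
    have XC: "X t \<in> ?C" "X' t \<in> ?C" if "t \<in> {0..1}" for t
      using \<phi>C[OF ty[OF y that]] \<phi>C[OF ty[OF yd that]] by (auto simp: X_def X'_def)
    have dX: "(X has_vector_derivative Q (X t) *v y) (at t within {0..1})"
      and dX': "(X' has_vector_derivative Q (X' t) *v (y + d)) (at t within {0..1})" if "t \<in> {0..1}" for t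
      using \<phi>'[OF y that] \<phi>'[OF yd that] by (simp_all add: X_def[abs_def] X'_def[abs_def])
    define h' where "h' t = Q (X' t) *v (y + d) - Q (X t) *v y" for t
    have dh: "(h has_vector_derivative h' t) (at t within {0..1})" if "t \<in> {0..1}" for t
      unfolding h_def h'_def by (intro has_vector_derivative_diff dX dX' that)
    have half: "M * a * norm z \<le> a / 2" if "a \<ge> 0" "norm z \<le> \<epsilon>" for a and z :: "real^'n"
    proof -
      have "M * norm z \<le> 1 / 2" using \<epsilon>(2) that M by (meson mult_left_mono less_imp_le order_trans)
      then have "(M * norm z) * a \<le> 1 / 2 * a" using that(1) by (rule mult_right_mono)
      then show ?thesis by (simp add: mult_ac)
    qed
    have hb: "norm (h t) \<le> 2 * (M * norm d)" if t: "t \<in> {0..1}" for t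
    proof (rule linear_gronwall_small[OF dh _ _ t])
      fix t :: real assume t: "t \<in> {0..1}"
      have "h' t = (Q (X' t) *v (y + d) - Q (X t) *v (y + d)) + Q (X t) *v d"
        by (simp add: h'_def matrix_vector_right_distrib)
      also have "norm \<dots> \<le> M * norm (h t) * norm (y + d) + M * norm d"
        unfolding h_def using XC[OF t] by (intro order_trans[OF norm_triangle_ineq add_mono] b1 b2) auto
      also have "\<dots> \<le> norm (h t) / 2 + M * norm d" using half[OF _ yd] by simp
      finally show "norm (h' t) \<le> norm (h t) / 2 + M * norm d" .
    qed (auto simp: h_def X_def X'_def)
    define e where "e t = h t - t *\<^sub>R (Q (X t) *v d)" for t
    define e' where "e' t = h' t - (Q (X t) *v d + t *\<^sub>R (?DQ (X t) (Q (X t) *v y) *v d))" for t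
    have de: "(e has_vector_derivative e' t) (at t within {0..1})" if t: "t \<in> {0..1}" for t
    proof -
      have "(Q has_derivative ?DQ (X t)) (at (X t))"
        using Ck_on_SucD[OF Q] XC(1)[OF t] R(2) by blast
      from bounded_linear.has_derivative[OF bounded_bilinear.bounded_linear_left[OF bounded_bilinear_matrix_vector] this]
      have "((\<lambda>x. Q x *v d) has_derivative (\<lambda>w. ?DQ (X t) w *v d)) (at (X t))" .
      from vector_derivative_diff_chain_within[OF dX[OF t] has_derivative_at_withinI[OF this]]
      have "((\<lambda>t. Q (X t) *v d) has_vector_derivative ?DQ (X t) (Q (X t) *v y) *v d) (at t within {0..1})"
        by (simp add: o_def)
      from bounded_bilinear.has_vector_derivative[OF bounded_bilinear_scaleR _ this, of "\<lambda>t. t" 1]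
      have "((\<lambda>t. t *\<^sub>R (Q (X t) *v d)) has_vector_derivative
          (Q (X t) *v d + t *\<^sub>R (?DQ (X t) (Q (X t) *v y) *v d))) (at t within {0..1})"
        by (auto simp: has_vector_derivative_def add.commute intro!: derivative_eq_intros)
      then show ?thesis unfolding e_def e'_def by (intro has_vector_derivative_diff dh t)
    qed
    have "norm (e 1) \<le> 2 * (4 * M ^ 2 * norm d ^ 2)"
    proof (rule linear_gronwall_small[OF de])
      fix t :: real assume t: "t \<in> {0..1}"
      have l: "linear (?DQ (X t))"
        using Ck_on_SucD[OF Q] XC(1)[OF t] R(2) has_derivative_linear by blast
      \<comment> \<open>Here the integrability condition enters: after substituting
        \<open>h = e + t Q(X) d\<close>, it exchanges \<open>y\<close> and \<open>d\<close>, and the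
        term linear in \<open>d\<close> cancels against the one in \<open>e'\<close>. What is left
        is a multiple of \<open>e\<close> of rate at most 1/2 and terms quadratic in
        \<open>d\<close>.\<close>
      have "?DQ (X t) (h t) = ?DQ (X t) (e t) + t *\<^sub>R ?DQ (X t) (Q (X t) *v d)"
        by (simp add: e_def linear_diff[OF l] linear_scale[OF l])
      then have "?DQ (X t) (h t) *v y = ?DQ (X t) (e t) *v y + t *\<^sub>R (?DQ (X t) (Q (X t) *v y) *v d)"
        using sym[of "X t" d y] XC(1)[OF t] R(2)
        by (simp add: matrix_vector_mult_add_rdistrib scaleR_matrix_vector_assoc[symmetric] subset_iff)
      then have "e' t = (Q (X' t) - Q (X t) - ?DQ (X t) (X' t - X t)) *v (y + d) + ?DQ (X t) (e t) *v y
          + ?DQ (X t) (h t) *v d"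
        by (simp add: e'_def h'_def matrix_vector_mult_diff_rdistrib matrix_vector_right_distrib
            h_def[symmetric])
      also have "norm \<dots> \<le> M * norm (h t) ^ 2 * norm (y + d) + M * norm (e t) * norm y + M * norm (h t) * norm d"
        unfolding h_def using XC[OF t] by (intro order_trans[OF norm_triangle_ineq add_mono] b3 b4) auto
      also have "\<dots> \<le> norm (h t) ^ 2 / 2 + norm (e t) / 2 + M * norm (h t) * norm d"
        using half[OF _ yd, of "norm (h t) ^ 2"] half[OF _ y, of "norm (e t)"] by simp
      also have "\<dots> \<le> (2 * (M * norm d)) ^ 2 / 2 + norm (e t) / 2 + M * (2 * (M * norm d)) * norm d"
        using hb[OF t] M by (intro add_mono divide_right_mono power_mono mult_right_mono mult_left_mono) auto
      also have "\<dots> = norm (e t) / 2 + 4 * M ^ 2 * norm d ^ 2"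
        by (simp add: power2_eq_square algebra_simps)
      finally show "norm (e' t) \<le> norm (e t) / 2 + 4 * M ^ 2 * norm d ^ 2" .
    qed (auto simp: e_def h_def X_def X'_def)
    then show ?thesis by (simp add: e_def h_def X_def X'_def)
  qed
  show ?thesis
  proof (rule that[of \<epsilon> \<phi>])
    show "\<epsilon> > 0" "\<phi> 0 = x0" by (rule \<epsilon>(1) \<phi>0)+
  next
    fix y :: "real^'n" assume y: "y \<in> ball 0 \<epsilon>"
    then have ny: "norm y < \<epsilon>" by simp
    show "\<phi> y \<in> U" using \<phi>C[of y] ny R(2) by auto
    show "(\<phi> has_derivative (\<lambda>u. Q (\<phi> y) *v u)) (at y)"
      unfolding has_derivative_at_alt
    proof (intro conjI allI impI)
      show "bounded_linear (\<lambda>u. Q (\<phi> y) *v u)"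
        by (rule bounded_bilinear.bounded_linear_right[OF bounded_bilinear_matrix_vector])
      fix e :: real assume e: "e > 0"
      \<comment> \<open>The first entry of the minimum keeps \<open>z\<close> in the ball where
        \<open>key\<close> applies, the second makes \<open>8 * M\<^sup>2 * norm (z - y)\<close> at
        most \<open>e\<close>.\<close>
      show "\<exists>d>0. \<forall>z. norm (z - y) < d \<longrightarrow> norm (\<phi> z - \<phi> y - Q (\<phi> y) *v (z - y)) \<le> e * norm (z - y)"
      proof (intro exI[of _ "min (\<epsilon> - norm y) (e / (8 * M ^ 2))"] conjI allI impI)
        show "0 < min (\<epsilon> - norm y) (e / (8 * M ^ 2))" using e M ny by simp
        fix z assume z: "norm (z - y) < min (\<epsilon> - norm y) (e / (8 * M ^ 2))"
        have "norm (y + (z - y)) \<le> \<epsilon>"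
          using norm_triangle_ineq[of y "z - y"] z by linarith
        from key[OF less_imp_le[OF ny] this]
        have "norm (\<phi> z - \<phi> y - Q (\<phi> y) *v (z - y)) \<le> (8 * M ^ 2 * norm (z - y)) * norm (z - y)"
          by (simp add: power2_eq_square mult_ac)
        also have "\<dots> \<le> e * norm (z - y)"
          using z M by (intro mult_right_mono) (auto simp: field_simps)
        finally show "norm (\<phi> z - \<phi> y - Q (\<phi> y) *v (z - y)) \<le> e * norm (z - y)" .
      qed
    qed
  qed
qed


section \<open>The Frobenius theorem for the kernel of a matrix field\<close>

lemma matrix_add_rdistrib: "((A :: 'a::semiring_1^'n^'m) + B) ** C = A ** C + B ** C"
  by (vector matrix_matrix_mult_def sum.distrib[symmetric] algebra_simps)

lemma matrix_diff_ldistrib: "(A :: 'a::ring_1^'n^'m) ** (B - C) = A ** B - A ** C"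
  by (vector matrix_matrix_mult_def sum_subtractf[symmetric] algebra_simps)

lemma matrix_diff_rdistrib: "((A :: 'a::ring_1^'n^'m) - B) ** C = A ** C - B ** C"
  by (vector matrix_matrix_mult_def sum_subtractf[symmetric] algebra_simps)

lemma matrix_vector_has_derivative:
  fixes A :: "_ \<Rightarrow> real^'n^'m" and u :: "_ \<Rightarrow> real^'n"
  assumes "(A has_derivative A') (at x within S)" "(u has_derivative u') (at x within S)"
  shows "((\<lambda>y. A y *v u y) has_derivative (\<lambda>h. A x *v u' h + A' h *v u x)) (at x within S)"
  using bounded_bilinear.FDERIV[OF bounded_bilinear_matrix_vector assms] .

lemma matrix_matrix_has_derivative:
  fixes A :: "_ \<Rightarrow> real^'n^'m" and B :: "_ \<Rightarrow> real^'p^'n"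
  assumes "(A has_derivative A') (at x within S)" "(B has_derivative B') (at x within S)"
  shows "((\<lambda>y. A y ** B y) has_derivative (\<lambda>h. A x ** B' h + A' h ** B x)) (at x within S)"
  using bounded_bilinear.FDERIV[OF bounded_bilinear_matrix_matrix assms] .

lemma has_derivative_locally_const:
  assumes "open U" "x \<in> U" "\<And>y. y \<in> U \<Longrightarrow> f y = c" "(f has_derivative f') (at x)"
  shows "f' h = 0"
proof -
  have "((\<lambda>_. c) has_derivative f') (at x)"
    by (rule has_derivative_transform_within_open[OF assms(4,1,2,3)])
  then have "f' = (\<lambda>_. 0)" using has_derivative_unique has_derivative_const by blast
  then show ?thesis by simp
qed

text \<open>Besides the parametrisation, the conclusion records what a chart is built from: the
  \<open>P x0\<close> component of \<open>\<phi>\<close> is known explicitly, and the last two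
  clauses say that the derivative of \<open>\<phi>\<close> maps into the kernel of \<open>F\<close>
  and reaches all of it.\<close>

theorem frobenius_projection:
  fixes F P :: "real^'n::finite \<Rightarrow> real^'n^'n"
  assumes U: "open U" "x0 \<in> U" and F: "\<And>k. Ck_on k U F" and P: "\<And>k. Ck_on k U P"
    and PP: "\<And>x. x \<in> U \<Longrightarrow> P x ** P x = P x"
    and FP: "\<And>x. x \<in> U \<Longrightarrow> F x ** P x = 0"
    and kerP: "\<And>x w. x \<in> U \<Longrightarrow> F x *v w = 0 \<Longrightarrow> P x *v w = w"
    and invol: "\<And>x u v. x \<in> U \<Longrightarrow> F x *v u = 0 \<Longrightarrow> F x *v v = 0 \<Longrightarrow>
      frechet_derivative F (at x) u *v v = frechet_derivative F (at x) v *v u"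
  obtains \<epsilon> \<phi> Q where "\<epsilon> > 0" "\<phi> 0 = x0" "\<And>k. Ck_on k (ball 0 \<epsilon>) \<phi>"
    "\<And>y. y \<in> ball 0 \<epsilon> \<Longrightarrow> \<phi> y \<in> U"
    "\<And>y. y \<in> ball 0 \<epsilon> \<Longrightarrow> (\<phi> has_derivative (\<lambda>u. Q y *v u)) (at y)"
    "\<And>y. y \<in> ball 0 \<epsilon> \<Longrightarrow> P x0 *v \<phi> y = P x0 *v x0 + P x0 *v y"
    "\<And>y. y \<in> ball 0 \<epsilon> \<Longrightarrow> F (\<phi> y) ** Q y = 0"
    "\<And>y w. y \<in> ball 0 \<epsilon> \<Longrightarrow> F (\<phi> y) *v w = 0 \<Longrightarrow> Q y *v (P x0 *v w) = w"
proof -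
  define P0 where "P0 = P x0"
  have P0: "P0 ** P0 = P0" using PP U(2) by (simp add: P0_def)
  \<comment> \<open>\<open>A x\<close> is the identity at \<open>x0\<close> and intertwines the projections \<open>P x\<close> and \<open>P0\<close>.\<close>
  define A where "A x = P0 ** P x + (mat 1 - P0) ** (mat 1 - P x)" for x
  have A: "Ck_on k U A" for k
    unfolding A_def
    by (intro Ck_on_add Ck_on_bilinear[OF bounded_bilinear_matrix_matrix] Ck_on_const Ck_on_diff P U)
  define V where "V = {x \<in> U. det (A x) \<noteq> 0}"
  have "continuous_on U (\<lambda>x. det (A x))"
    using Ck_on_det[OF U(1) Ck_on_nth[OF U(1) Ck_on_nth[OF U(1) A]], of 0] by simp
  then have "open (U \<inter> (\<lambda>x. det (A x)) -` (- {0}))"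
    using continuous_open_preimage U(1) by blast
  moreover have "U \<inter> (\<lambda>x. det (A x)) -` (- {0}) = V" by (auto simp: V_def)
  ultimately have oV: "open V" by simp
  have VU: "V \<subseteq> U" by (auto simp: V_def)
  have "A x0 = mat 1"
    unfolding A_def P0_def[symmetric]
    by (simp add: matrix_diff_ldistrib matrix_diff_rdistrib P0)
  then have x0V: "x0 \<in> V" using U(2) by (simp add: V_def)
  define B where "B x = matrix_inv (A x)" for x
  have AB: "A x ** B x = mat 1" "B x ** A x = mat 1" if "x \<in> V" for x
    using matrix_inv_mult[of "A x"] that by (auto simp: V_def B_def)
  have B: "Ck_on k V B" for k
    unfolding B_def by (rule Ck_on_matrix_inv[OF oV Ck_on_subset[OF A VU]]) (simp add: V_def)
  \<comment> \<open>Since \<open>A\<close> intertwines the two projections, \<open>B x ** P0\<close>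
    equals \<open>P x ** B x\<close>. The first form shows that \<open>Q\<close> depends only on the
    \<open>P0\<close> component of its argument, the second that its columns lie in the kernel of
    \<open>F\<close>.\<close>
  define Q where "Q x = B x ** P0" for x
  have Q: "Ck_on k V Q" for k
    unfolding Q_def by (intro Ck_on_bilinear[OF bounded_bilinear_matrix_matrix] oV B Ck_on_const)
  have AP: "A x ** P x = P0 ** P x" "P0 ** A x = P0 ** P x" if "x \<in> V" for x
  proof -
    have x: "x \<in> U" using that VU by blast
    have "(mat 1 - P x) ** P x = 0" "P0 ** (mat 1 - P0) = 0"
      using PP[OF x] P0 by (simp_all add: matrix_diff_ldistrib matrix_diff_rdistrib)
    moreover have "A x ** P x = P0 ** (P x ** P x) + (mat 1 - P0) ** ((mat 1 - P x) ** P x)"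
      "P0 ** A x = (P0 ** P0) ** P x + (P0 ** (mat 1 - P0)) ** (mat 1 - P x)"
      by (simp_all only: A_def matrix_add_rdistrib matrix_add_ldistrib matrix_mul_assoc)
    ultimately show "A x ** P x = P0 ** P x" "P0 ** A x = P0 ** P x"
      using PP[OF x] P0 by simp_all
  qed
  have PB: "P x ** B x = Q x" if x: "x \<in> V" for x
  proof -
    have "P x ** B x = (B x ** A x) ** (P x ** B x)" using AB[OF x] by simp
    also have "\<dots> = B x ** (A x ** P x) ** B x" by (simp add: matrix_mul_assoc)
    also have "\<dots> = B x ** (P0 ** A x) ** B x" using AP[OF x] by simp
    also have "\<dots> = B x ** P0 ** (A x ** B x)" by (simp add: matrix_mul_assoc)
    finally show ?thesis using AB[OF x] by (simp add: Q_def)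
  qed
  have FQ: "F x ** Q x = 0" if x: "x \<in> V" for x
  proof -
    have "F x ** Q x = (F x ** P x) ** B x" using PB[OF x] by (simp add: matrix_mul_assoc[symmetric])
    then show ?thesis using FP[of x] x VU by (auto simp: matrix_matrix_mult_def vec_eq_iff)
  qed
  have PQ: "P0 ** Q x = P0" if x: "x \<in> V" for x
  proof -
    have "P0 ** Q x = (P0 ** P x) ** B x" using PB[OF x] by (simp add: matrix_mul_assoc[symmetric])
    also have "\<dots> = P0 ** (A x ** B x)" using AP[OF x] by (simp add: matrix_mul_assoc)
    finally show ?thesis using AB[OF x] by simp
  qed
  have Qker: "Q x *v (P0 *v w) = w" if x: "x \<in> V" and w: "F x *v w = 0" for x w
  proof -
    have Pw: "P x *v w = w" using kerP w x VU by blast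
    have "Q x *v (P0 *v w) = (B x ** P0) *v w"
      by (simp add: Q_def matrix_vector_mul_assoc matrix_mul_assoc[symmetric] P0)
    also have "\<dots> = B x *v (P0 *v (P x *v w))" by (simp add: Pw matrix_vector_mul_assoc)
    also have "\<dots> = B x *v ((A x ** P x) *v w)"
      using AP[OF x] by (simp add: matrix_vector_mul_assoc matrix_mul_assoc)
    also have "\<dots> = (B x ** A x) *v (P x *v w)" by (simp add: matrix_vector_mul_assoc matrix_mul_assoc)
    finally show ?thesis using AB[OF x] Pw by simp
  qed
  have sym: "frechet_derivative Q (at x) (Q x *v u) *v v = frechet_derivative Q (at x) (Q x *v v) *v u"
    if x: "x \<in> V" for x u v
  proof -
    let ?DQ = "frechet_derivative Q (at x)" and ?DF = "frechet_derivative F (at x)"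
    have dQ: "(Q has_derivative ?DQ) (at x)" using Ck_on_SucD[OF Q x] .
    have dF: "(F has_derivative ?DF) (at x)" using Ck_on_SucD[OF F] x VU by blast
    have 1: "F x ** ?DQ h + ?DF h ** Q x = 0" for h
      by (rule has_derivative_locally_const[OF oV x FQ matrix_matrix_has_derivative[OF dF dQ]])
    have 2: "P0 ** ?DQ h = 0" for h
      using has_derivative_locally_const[OF oV x PQ matrix_matrix_has_derivative[OF has_derivative_const dQ], of h]
      by simp
    \<comment> \<open>Fact \<open>1\<close> and \<open>invol\<close> give
      \<open>F x *v z = 0\<close>, fact \<open>2\<close> gives \<open>P0 *v z = 0\<close>; a kernel
      vector is recovered from its \<open>P0\<close> image by \<open>Qker\<close>.\<close>
    define z where "z = ?DQ (Q x *v u) *v v - ?DQ (Q x *v v) *v u"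
    have "F x *v (?DQ h *v w) = - (?DF h *v (Q x *v w))" for h w
      using arg_cong[OF 1[of h], of "\<lambda>M. M *v w"]
      by (simp add: matrix_vector_mult_add_rdistrib matrix_vector_mul_assoc eq_neg_iff_add_eq_0)
    moreover have "F x *v (Q x *v w) = 0" for w
      using FQ[OF x] by (simp add: matrix_vector_mul_assoc)
    ultimately have "F x *v z = 0"
      using invol[of x "Q x *v u" "Q x *v v"] x VU
      by (auto simp: z_def matrix_vector_mult_diff_distrib)
    then have "z = Q x *v (P0 *v z)" using Qker[OF x] by simp
    also have "P0 *v z = 0"
      using 2 by (simp add: z_def matrix_vector_mult_diff_distrib matrix_vector_mul_assoc)
    finally show ?thesis by (simp add: z_def)
  qed
  obtain \<epsilon> \<phi> where e: "\<epsilon> > 0" "\<phi> 0 = x0" "\<And>y. y \<in> ball 0 \<epsilon> \<Longrightarrow> \<phi> y \<in> V"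
    "\<And>y. y \<in> ball 0 \<epsilon> \<Longrightarrow> (\<phi> has_derivative (\<lambda>u. Q (\<phi> y) *v u)) (at y)"
    using total_differential_equation[OF oV x0V Q sym] by metis
  \<comment> \<open>Bootstrapping: \<open>Q \<circ> \<phi>\<close> is as smooth as
    \<open>\<phi>\<close>, and it is the derivative of \<open>\<phi>\<close>.\<close>
  have smooth: "Ck_on k (ball 0 \<epsilon>) \<phi>" for k
  proof (induction k)
    case 0
    have "isCont \<phi> y" if "y \<in> ball 0 \<epsilon>" for y
      using has_derivative_continuous[OF e(4)[OF that]] .
    then show ?case by (simp add: continuous_at_imp_continuous_on)
  next
    case (Suc k)
    have "Ck_on k (ball 0 \<epsilon>) (\<lambda>y. Q (\<phi> y))"
      by (rule Ck_on_compose[OF open_ball oV _ Suc Q]) (use e(3) in auto)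
    then show ?case
      by (intro Ck_on_SucI[OF e(4)] Ck_on_bilinear[OF bounded_bilinear_matrix_vector] Ck_on_const) auto
  qed
  \<comment> \<open>Because \<open>P0 ** Q x = P0\<close>, the map \<open>P0 (\<phi> y - y)\<close>
    has derivative zero on the ball, hence is constant.\<close>
  have proj: "P0 *v \<phi> y = P0 *v x0 + P0 *v y" if y: "y \<in> ball 0 \<epsilon>" for y
  proof -
    have d: "((\<lambda>y. P0 *v \<phi> y - P0 *v y) has_derivative (\<lambda>_. 0)) (at z within ball 0 \<epsilon>)"
      if z: "z \<in> ball 0 \<epsilon>" for z
    proof -
      have l: "bounded_linear ((*v) P0)"
        by (rule bounded_bilinear.bounded_linear_right[OF bounded_bilinear_matrix_vector])
      have "((\<lambda>y. P0 *v \<phi> y - P0 *v y) has_derivative (\<lambda>u. P0 *v (Q (\<phi> z) *v u) - P0 *v u)) (at z)"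
        by (intro has_derivative_diff bounded_linear.has_derivative[OF l] e(4) z has_derivative_ident)
      then show ?thesis
        using PQ[OF e(3)[OF z]] has_derivative_at_withinI by (fastforce simp: matrix_vector_mul_assoc)
    qed
    have "P0 *v \<phi> y - P0 *v y = P0 *v \<phi> 0 - P0 *v 0"
      using has_derivative_zero_unique[OF convex_ball d y, of 0] e(1) by simp
    then show ?thesis using e(2) by (simp add: algebra_simps)
  qed
  show ?thesis
    by (rule that[of \<epsilon> \<phi> "\<lambda>y. Q (\<phi> y)"])
      (use e smooth proj FQ Qker VU in \<open>auto simp: P0_def[symmetric]\<close>)
qed


section \<open>Charts, tangent vectors and submanifolds\<close>

abbreviation chart_image :: "('m, 'n::finite) chart \<Rightarrow> (real^'n) set" where
  "chart_image c \<equiv> coord c ` dom_chart c"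

lemma is_chartD:
  assumes "is_chart c"
  shows "open (dom_chart c)" "open (chart_image c)" "continuous_on (dom_chart c) (coord c)"
    "continuous_on (chart_image c) (coord_inv c)" "inj_on (coord c) (dom_chart c)"
    "p \<in> dom_chart c \<Longrightarrow> coord_inv c (coord c p) = p"
    "x \<in> chart_image c \<Longrightarrow> coord c (coord_inv c x) = x"
    "x \<in> chart_image c \<Longrightarrow> coord_inv c x \<in> dom_chart c"
  using assms unfolding is_chart_def homeomorphism_def by (auto intro: inj_on_inverseI)

lemma chart_image_open:
  assumes "is_chart c" "open V"
  shows "open (coord c ` (dom_chart c \<inter> V))"
proof -
  have "coord c ` (dom_chart c \<inter> V) = chart_image c \<inter> coord_inv c -` V"
    using is_chartD(6-8)[OF assms(1)] by (force simp: image_iff)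
  then show ?thesis
    using continuous_open_preimage[OF is_chartD(4,2)[OF assms(1)] assms(2)] by simp
qed

lemma smooth_onD: "smooth_on U f \<Longrightarrow> Ck_on k U f"
  by (simp add: smooth_on_def)

lemma jacobian_mult:
  assumes "(transition c d has_derivative T) (at (coord c p))"
  shows "jacobian c d p *v s = T s"
  unfolding jacobian_def frechet_derivative_eq[OF assms]
  using matrix_works[of T s] has_derivative_linear[OF assms]
  by (simp add: linear_matrix_vector_mul_eq)

lemma transition_eq: "is_chart c \<Longrightarrow> p \<in> dom_chart c \<Longrightarrow> transition c d (coord c p) = coord d p"
  by (simp add: transition_def is_chartD)

lemma transition_has_derivative:
  fixes c d :: "('m::topological_space, 'n::finite) chart"
  assumes c: "is_chart c" and d: "is_chart d" and cd: "compatible c d"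
    and p: "p \<in> dom_chart c" "p \<in> dom_chart d"
  shows "(transition c d has_derivative (\<lambda>s. jacobian c d p *v s)) (at (coord c p))"
proof -
  have "Ck_on (Suc 0) (coord c ` (dom_chart c \<inter> dom_chart d)) (transition c d)"
    using cd smooth_onD compatible_def by blast
  from Ck_on_SucD[OF this, of "coord c p"] p
  have t: "(transition c d has_derivative frechet_derivative (transition c d) (at (coord c p))) (at (coord c p))"
    by blast
  have "(\<lambda>s. jacobian c d p *v s) = frechet_derivative (transition c d) (at (coord c p))"
    using jacobian_mult[OF t] by auto
  then show ?thesis using t by simp
qed

lemma jacobian_compose:
  fixes c d e :: "('m::topological_space, 'n::finite) chart"
  assumes c: "is_chart c" and d: "is_chart d" and e: "is_chart e"
    and cd: "compatible c d" and de: "compatible d e"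
    and p: "p \<in> dom_chart c" "p \<in> dom_chart d" "p \<in> dom_chart e"
  shows "jacobian c e p = jacobian d e p ** jacobian c d p"
proof -
  have "(transition d e has_derivative (\<lambda>s. jacobian d e p *v s)) (at (transition c d (coord c p)))"
    unfolding transition_eq[OF c p(1)] by (rule transition_has_derivative[OF d e de p(2,3)])
  from has_derivative_compose[OF transition_has_derivative[OF c d cd p(1,2)] this]
  have "((\<lambda>x. transition d e (transition c d x)) has_derivative
      (\<lambda>s. jacobian d e p *v (jacobian c d p *v s))) (at (coord c p))" .
  then have "(transition c e has_derivative (\<lambda>s. jacobian d e p *v (jacobian c d p *v s))) (at (coord c p))"
  proof (rule has_derivative_transform_within_open)
    show "open (coord c ` (dom_chart c \<inter> dom_chart d))"
      by (rule chart_image_open[OF c is_chartD(1)[OF d]])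
    show "coord c p \<in> coord c ` (dom_chart c \<inter> dom_chart d)" using p by blast
    show "transition d e (transition c d x) = transition c e x"
      if "x \<in> coord c ` (dom_chart c \<inter> dom_chart d)" for x
      using that by (auto simp: transition_def is_chartD[OF c] is_chartD[OF d])
  qed
  from jacobian_mult[OF this] show ?thesis
    by (simp add: matrix_eq matrix_vector_mul_assoc)
qed

lemma jacobian_self:
  fixes c :: "('m::topological_space, 'n::finite) chart"
  assumes c: "is_chart c" and p: "p \<in> dom_chart c"
  shows "jacobian c c p = mat 1"
proof -
  have "((\<lambda>x. x) has_derivative (\<lambda>x. x)) (at (coord c p))" by (rule has_derivative_ident)
  then have "(transition c c has_derivative (\<lambda>x. x)) (at (coord c p))"
    by (rule has_derivative_transform_within_open[OF _ is_chartD(2)[OF c]])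
      (use p in \<open>auto simp: transition_def is_chartD[OF c]\<close>)
  from jacobian_mult[OF this] show ?thesis by (simp add: matrix_eq)
qed

text \<open>Difference quotients in direction \<open>s\<close> lie in \<open>S\<close>, and so does
  their limit. Values are controlled only along one line, which is all that is known about a map on
  a slice; the choice \<open>S = {0}\<close> handles functions vanishing on a slice.\<close>

lemma derivative_in_subspace:
  assumes g: "(g has_derivative g') (at y)" and V: "open V" "y \<in> V"
    and S: "subspace S" "closed S" and gS: "\<And>t. y + t *\<^sub>R s \<in> V \<Longrightarrow> g (y + t *\<^sub>R s) \<in> S"
  shows "g' s \<in> S"
proof -
  have "\<exists>z\<in>S. dist z (g' s) < e" if e: "e > 0" for e
  proof -
    define e' where "e' = e / (norm s + 1)"
    have s1: "norm s + 1 > 0" by (simp add: add_nonneg_pos)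
    have e': "e' > 0" using e s1 by (simp add: e'_def)
    obtain d1 where d1: "d1 > 0" "\<And>z. norm (z - y) < d1 \<Longrightarrow> norm (g z - g y - g' (z - y)) \<le> e' * norm (z - y)"
      using g[unfolded has_derivative_at_alt] e' by blast
    obtain d2 where d2: "d2 > 0" "ball y d2 \<subseteq> V" using V open_contains_ball by blast
    define t where "t = min d1 d2 / (norm s + 1)"
    have t: "t > 0" using d1 d2 s1 by (simp add: t_def)
    have "t * norm s < t * (norm s + 1)" using t by simp
    also have "\<dots> = min d1 d2" using s1 by (simp add: t_def)
    finally have ts: "t * norm s < d1" "t * norm s < d2" by auto
    have "y + t *\<^sub>R s \<in> ball y d2" using ts t by (simp add: dist_norm)
    then have "g (y + t *\<^sub>R s) \<in> S" "g y \<in> S" using gS[of t] gS[of 0] V(2) d2(2) by auto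
    then have "(g (y + t *\<^sub>R s) - g y) /\<^sub>R t \<in> S" using S(1) by (simp add: subspace_diff subspace_scale)
    moreover have "dist ((g (y + t *\<^sub>R s) - g y) /\<^sub>R t) (g' s) < e"
    proof -
      have "(g (y + t *\<^sub>R s) - g y) /\<^sub>R t - g' s = (g (y + t *\<^sub>R s) - g y - g' (t *\<^sub>R s)) /\<^sub>R t"
        using t linear_scale[OF has_derivative_linear[OF g], of t s] by (simp add: algebra_simps)
      also have "norm \<dots> = norm (g (y + t *\<^sub>R s) - g y - g' (t *\<^sub>R s)) / t"
        using t by (simp add: divide_inverse)
      also have "\<dots> \<le> e' * norm (t *\<^sub>R s) / t"
        using d1(2)[of "y + t *\<^sub>R s"] ts t by (intro divide_right_mono) auto
      also have "\<dots> = e' * norm s" using t by simp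
      also have "\<dots> < e' * (norm s + 1)" using e' by simp
      also have "\<dots> = e" using s1 by (simp add: e'_def)
      finally show ?thesis by (simp add: dist_norm)
    qed
    ultimately show ?thesis by blast
  qed
  then show ?thesis using closed_approachable[OF S(2)] by blast
qed

text \<open>Over the reals \<open>of_real\<close> simplifies to \<open>id\<close>; this rule then
  removes the scalar conversion from the transformation laws.\<close>

lemma map_matrix_id [simp]: "map_matrix id A = A"
  by (simp add: map_matrix_def)

section \<open>Tangent vectors, extension of fields and slices on a manifold\<close>

locale manifold =
  fixes A :: "('m::{t2_space, second_countable_topology}, 'n::finite) chart set"
  assumes smooth_manifold: "smooth_manifold A"
begin

lemma chart: "c \<in> A \<Longrightarrow> is_chart c"
  using smooth_manifold by (simp add: smooth_manifold_def)

lemma compat: "c \<in> A \<Longrightarrow> d \<in> A \<Longrightarrow> compatible c d"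
  using smooth_manifold by (simp add: smooth_manifold_def)

lemma ex_chart_at: "\<exists>c. c \<in> charts_at A p"
proof -
  have "p \<in> (\<Union>c\<in>A. dom_chart c)" using smooth_manifold by (simp add: smooth_manifold_def)
  then show ?thesis by (auto simp: charts_at_def)
qed

lemma chart_at:
  assumes "c \<in> charts_at A p"
  shows "c \<in> A" "p \<in> dom_chart c" "is_chart c" "coord_inv c (coord c p) = p" "coord c p \<in> chart_image c"
proof -
  show c: "c \<in> A" and p: "p \<in> dom_chart c" using assms by (auto simp: charts_at_def)
  then show "is_chart c" "coord_inv c (coord c p) = p" "coord c p \<in> chart_image c"
    using chart is_chartD(6)[OF chart[OF c] p] by auto
qed

lemma atlas_subset_maximal: "A \<subseteq> maximal_atlas A"
  using chart compat by (auto simp: maximal_atlas_def)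

lemma maximal: "d \<in> maximal_atlas A \<Longrightarrow> is_chart d"
  "d \<in> maximal_atlas A \<Longrightarrow> c \<in> A \<Longrightarrow> compatible c d"
  "d \<in> maximal_atlas A \<Longrightarrow> c \<in> A \<Longrightarrow> compatible d c"
  by (auto simp: maximal_atlas_def)

lemma jacobian_chain:
  assumes d: "d \<in> maximal_atlas A" and c: "c \<in> charts_at A p" and e: "e \<in> charts_at A p"
    and p: "p \<in> dom_chart d"
  shows "jacobian d e p *v s = jacobian c e p *v (jacobian d c p *v s)"
  using jacobian_compose[OF maximal(1)[OF d] chart_at(3)[OF c] chart_at(3)[OF e]
      maximal(3)[OF d chart_at(1)[OF c]] compat[OF chart_at(1)[OF c] chart_at(1)[OF e]] p
      chart_at(2)[OF c] chart_at(2)[OF e]]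
  by (simp add: matrix_vector_mul_assoc)

lemma jacobian_cancel:
  assumes d: "d \<in> maximal_atlas A" and c: "c \<in> charts_at A p" and p: "p \<in> dom_chart d"
  shows "jacobian d c p *v (jacobian c d p *v s) = s"
proof -
  have "jacobian d c p ** jacobian c d p = mat 1"
    using jacobian_compose[OF chart_at(3)[OF c] maximal(1)[OF d] chart_at(3)[OF c]
      maximal(2)[OF d chart_at(1)[OF c]] maximal(3)[OF d chart_at(1)[OF c]]
      chart_at(2)[OF c] p chart_at(2)[OF c]] jacobian_self[OF chart_at(3)[OF c] chart_at(2)[OF c]]
    by simp
  then show ?thesis by (simp add: matrix_vector_mul_assoc)
qed

text \<open>Adapted charts come from the maximal atlas, while tangent vectors are indexed by charts
  of \<open>A\<close>. This is the tangent vector whose coordinates in the chart \<open>d\<close>,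
  possibly outside \<open>A\<close>, are \<open>s\<close>.\<close>

definition pushforward :: "('m, 'n) chart \<Rightarrow> 'm \<Rightarrow> real^'n \<Rightarrow> ('m, 'n, real) tvec" where
  "pushforward d p s = (\<lambda>c. if c \<in> charts_at A p then jacobian d c p *v s else 0)"

lemma pushforward_tangent:
  assumes "d \<in> maximal_atlas A" "p \<in> dom_chart d"
  shows "pushforward d p s \<in> tangent_space A p"
  unfolding tangent_space_def
proof (intro CollectI conjI ballI allI impI)
  fix c e assume ce: "c \<in> charts_at A p" "e \<in> charts_at A p"
  then show "pushforward d p s e = map_matrix of_real (jacobian c e p) *v pushforward d p s c"
    using jacobian_chain[OF assms(1) ce assms(2), of s] by (simp add: pushforward_def)
qed (simp add: pushforward_def)

lemma tangent_real:
  fixes v :: "('m, 'n, real) tvec"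
  assumes "v \<in> tangent_space A p" "c \<in> charts_at A p"
  shows "v = pushforward c p (v c)"
proof
  fix e
  have "v e = map_matrix of_real (jacobian c e p) *v v c" if "e \<in> charts_at A p"
    using assms that unfolding tangent_space_def by blast
  moreover have "v e = 0" if "e \<notin> charts_at A p"
    using assms that unfolding tangent_space_def by blast
  ultimately show "v e = pushforward c p (v c) e" by (cases "e \<in> charts_at A p") (simp_all add: pushforward_def)
qed

lemma pushforward_at:
  assumes "c \<in> charts_at A p"
  shows "pushforward c p u c = u"
  using assms jacobian_self[OF chart_at(3)[OF assms] chart_at(2)[OF assms]] by (simp add: pushforward_def)

text \<open>A field constant in the chart \<open>c\<close> is cut off by a bump. This is what allows
  pointwise information to be extracted from a condition on global fields.\<close>

lemma smooth_vector_field_extension: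
  assumes c: "c \<in> charts_at A p"
  obtains X :: "('m, 'n, real) vfield" where "smooth_vector_field A X" "X p c = u"
proof -
  note ch = is_chartD[OF chart_at(3)[OF c]]
  have cM: "c \<in> maximal_atlas A" using atlas_subset_maximal chart_at(1)[OF c] by blast
  obtain r where r: "r > 0" "cball (coord c p) r \<subseteq> chart_image c"
    using ch(2) chart_at(5)[OF c] open_contains_cball by blast
  obtain \<rho> :: "real^'n \<Rightarrow> real" where \<rho>: "\<And>k. Ck_on k UNIV \<rho>" "\<rho> (coord c p) = 1"
    "\<And>x. x \<notin> cball (coord c p) r \<Longrightarrow> \<rho> x = 0"
    using smooth_bump_exists[OF r(1)] by metis
  \<comment> \<open>\<open>K\<close> is compact, hence closed in the Hausdorff space. The chart
    domain and the complement of \<open>K\<close> are therefore an open cover; on the first the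
    field is given by the chart formula, on the second it is zero.\<close>
  define K where "K = coord_inv c ` cball (coord c p) r"
  have "compact K"
    unfolding K_def by (intro compact_continuous_image continuous_on_subset[OF ch(4) r(2)] compact_cball)
  then have K: "closed K" by (rule compact_imp_closed)
  have Kdom: "K \<subseteq> dom_chart c" using ch(8) r(2) by (auto simp: K_def)
  have \<rho>0: "\<rho> (coord c q) = 0" if "q \<in> dom_chart c" "q \<notin> K" for q
  proof (rule \<rho>(3))
    show "coord c q \<notin> cball (coord c p) r"
      using that ch(6) unfolding K_def by (metis image_eqI)
  qed
  define X where "X q = (if q \<in> dom_chart c then pushforward c q (\<rho> (coord c q) *\<^sub>R u) else (\<lambda>_. 0))" for q
  have "X p c = u"
    using pushforward_at[OF c] chart_at(2)[OF c] \<rho>(2) by (simp add: X_def)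
  moreover have "(\<lambda>_. 0 :: real^'n) \<in> tangent_space A q" for q
    by (simp add: tangent_space_def)
  then have "X q \<in> tangent_space A q" for q
    using pushforward_tangent[OF cM] by (simp add: X_def)
  moreover have "smooth_on (chart_image d) (\<lambda>y. X (coord_inv d y) d)" if d: "d \<in> A" for d
    unfolding smooth_on_def
  proof (intro allI Ck_on_local)
    fix k y assume y: "y \<in> chart_image d"
    note dh = is_chartD[OF chart[OF d]]
    show "\<exists>V. open V \<and> y \<in> V \<and> Ck_on k V (\<lambda>y. X (coord_inv d y) d)"
    proof (cases "coord_inv d y \<in> K")
      case True
      let ?V = "coord d ` (dom_chart d \<inter> dom_chart c)"
      let ?W = "coord c ` (dom_chart c \<inter> dom_chart d)"
      have oV: "open ?V" "open ?W" 
        by (rule chart_image_open[OF chart[OF d] ch(1)] chart_image_open[OF chart_at(3)[OF c] dh(1)])+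
      have "y \<in> ?V" 
        using True Kdom dh(7)[OF y] dh(8)[OF y] by (auto intro!: image_eqI[of _ _ "coord_inv d y"])
      have t: "Ck_on j ?V (transition d c)" "Ck_on j ?W (transition c d)" for j
        using compat[OF d chart_at(1)[OF c]] compat[OF chart_at(1)[OF c] d]
        by (auto simp: compatible_def smooth_on_def)
      have t2: "transition d c ` ?V \<subseteq> ?W" using dh(6) by (auto simp: transition_def)
      let ?f = "\<lambda>y. \<rho> (transition d c y) *\<^sub>R frechet_derivative (transition c d) (at (transition d c y)) u"
      have "Ck_on k ?W (\<lambda>x. frechet_derivative (transition c d) (at x) u)"
        using t(2)[of "Suc k"] by simp
      from Ck_on_compose[OF oV t2 t(1) this] Ck_on_compose[OF oV(1) open_UNIV _ t(1) \<rho>(1)]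
      have sf: "Ck_on k ?V ?f"
        by (intro Ck_on_bilinear[OF bounded_bilinear_scaleR oV(1)]) auto
      have "?f y = X (coord_inv d y) d" if "y \<in> ?V" for y
      proof -
        obtain q where q: "q \<in> dom_chart d" "q \<in> dom_chart c" "y = coord d q" using \<open>y \<in> ?V\<close> by blast
        have "frechet_derivative (transition c d) (at (coord c q)) = (\<lambda>s. jacobian c d q *v s)"
          by (intro frechet_derivative_eq transition_has_derivative chart d compat chart_at[OF c] q)
        then show ?thesis
          using q dh(6)[OF q(1)] d
          by (simp add: X_def pushforward_def charts_at_def transition_def matrix_vector_mult_scaleR)
      qed
      then have "Ck_on k ?V (\<lambda>y. X (coord_inv d y) d)"
        by (rule Ck_on_cong[OF oV(1) _ sf])
      then show ?thesis using oV(1) \<open>y \<in> ?V\<close> by blast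
    next
      case False
      let ?V = "coord d ` (dom_chart d \<inter> - K)"
      have oV: "open ?V" using chart_image_open[OF chart[OF d]] K by blast
      have "y \<in> ?V" 
        using False dh(7)[OF y] dh(8)[OF y] by (auto intro!: image_eqI[of _ _ "coord_inv d y"])
      have "0 = X (coord_inv d y) d" if "y \<in> ?V" for y
        using that dh(6) \<rho>0 by (auto simp: X_def pushforward_def)
      then have "Ck_on k ?V (\<lambda>y. X (coord_inv d y) d)"
        by (rule Ck_on_cong[OF oV _ Ck_on_const])
      then show ?thesis using oV \<open>y \<in> ?V\<close> by blast
    qed
  qed
  ultimately show ?thesis using that[of X] by (simp add: smooth_vector_field_def)
qed

text \<open>Two slices around \<open>q\<close> are both \<open>N\<close>-open, so near \<open>q\<close> the first is contained in the second; hence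
  the change of charts maps \<open>S\<close> into \<open>S'\<close> near \<open>q\<close>, and so does its derivative.\<close>

lemma transition_curve_slice:
  assumes a: "adapted_chart A N q d S" "adapted_chart A N q d' S'"
    and c: "c \<in> charts_at A q" and s: "s \<in> S"
  shows "jacobian c d' q *v (jacobian d c q *v s) \<in> S'"
proof -
  define W where "W = {x \<in> dom_chart d. coord d x \<in> S}"
  define W' where "W' = {x \<in> dom_chart d'. coord d' x \<in> S'}"
  have a1: "d \<in> maximal_atlas A" "subspace S" "q \<in> W" "openin N W" "subtopology N W = top_of_set W"
    and a2: "d' \<in> maximal_atlas A" "subspace S'" "q \<in> W'" "openin N W'"
    using a by (auto simp: adapted_chart_def W_def W'_def Let_def)
  have q: "q \<in> dom_chart d" "q \<in> dom_chart d'" "coord d q \<in> S" "coord d' q \<in> S'"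
    using a1(3) a2(3) by (auto simp: W_def W'_def)
  note dh = is_chartD[OF maximal(1)[OF a1(1)]] and ch = is_chartD[OF chart_at(3)[OF c]]
  have "openin (subtopology N W) (W \<inter> W')"
    using a2(4) by (simp add: openin_subtopology) blast
  \<comment> \<open>\<open>N\<close> induces the subspace topology on \<open>W\<close>, so the
    \<open>N\<close>-open set \<open>W \<inter> W'\<close> is cut out of \<open>W\<close> by an open
    set of the manifold.\<close>
  then obtain G where G: "open G" "W \<inter> W' = W \<inter> G"
    unfolding a1(5) by (auto simp: openin_open)
  let ?V = "coord d ` (dom_chart d \<inter> (dom_chart c \<inter> G))"
  have oV: "open ?V"
    by (rule chart_image_open[OF maximal(1)[OF a1(1)]]) (use ch(1) G(1) in blast)
  have "q \<in> G" using a1(3) a2(3) G(2) by blast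
  then have yV: "coord d q \<in> ?V" using q chart_at(2)[OF c] by blast
  define g where "g y = transition c d' (transition d c y)" for y
  have t1: "(transition d c has_derivative (\<lambda>s. jacobian d c q *v s)) (at (coord d q))"
    by (rule transition_has_derivative[OF maximal(1)[OF a1(1)] chart_at(3)[OF c] maximal(3)[OF a1(1) chart_at(1)[OF c]] q(1) chart_at(2)[OF c]])
  have t2: "(transition c d' has_derivative (\<lambda>s. jacobian c d' q *v s)) (at (transition d c (coord d q)))"
    unfolding transition_eq[OF maximal(1)[OF a1(1)] q(1)]
    by (rule transition_has_derivative[OF chart_at(3)[OF c] maximal(1)[OF a2(1)] maximal(2)[OF a2(1) chart_at(1)[OF c]] chart_at(2)[OF c] q(2)])
  have g': "(g has_derivative (\<lambda>s. jacobian c d' q *v (jacobian d c q *v s))) (at (coord d q))"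
    unfolding g_def by (rule has_derivative_compose[OF t1 t2])
  have gS: "g y \<in> S'" if y: "y \<in> ?V" "y \<in> S" for y
  proof -
    obtain x where x: "x \<in> dom_chart d" "x \<in> dom_chart c" "x \<in> G" "y = coord d x" using y(1) by blast
    have "x \<in> W'" using G(2) x y(2) by (auto simp: W_def)
    moreover have "g y = coord d' x"
      using x by (simp add: g_def transition_def dh(6) ch(6))
    ultimately show ?thesis by (simp add: W'_def)
  qed
  show ?thesis
  proof (rule derivative_in_subspace[OF g' oV yV a2(2) closed_subspace[OF a2(2)]])
    fix t assume "coord d q + t *\<^sub>R s \<in> ?V"
    then show "g (coord d q + t *\<^sub>R s) \<in> S'"
      by (rule gS) (use a1(2) q(3) s in \<open>auto simp: subspace_add subspace_scale\<close>)
  qed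
qed

text \<open>The definition admits vectors from every adapted chart at \<open>q\<close>. By the slice
  lemma all of them yield the same space, so it can be computed in one chart.\<close>

lemma submanifold_tangent_eq:
  assumes a: "adapted_chart A N q d S"
  shows "submanifold_tangent A N q = pushforward d q ` S"
proof
  have d: "d \<in> maximal_atlas A" "q \<in> dom_chart d" using a by (auto simp: adapted_chart_def Let_def)
  show "pushforward d q ` S \<subseteq> submanifold_tangent A N q"
  proof
    fix v assume "v \<in> pushforward d q ` S"
    then obtain s where s: "s \<in> S" "v = pushforward d q s" by blast
    show "v \<in> submanifold_tangent A N q"
      unfolding submanifold_tangent_def
    proof (intro CollectI conjI exI)
      show "v \<in> tangent_space A q" using pushforward_tangent[OF d] s by simp
      show "adapted_chart A N q d S" "s \<in> S" by fact+
      show "\<forall>c\<in>charts_at A q. v c = jacobian d c q *v s" by (simp add: s pushforward_def)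
    qed
  qed
  show "submanifold_tangent A N q \<subseteq> pushforward d q ` S"
  proof
    fix v assume "v \<in> submanifold_tangent A N q"
    then obtain d' S' s' where v: "v \<in> tangent_space A q" and a': "adapted_chart A N q d' S'" and s': "s' \<in> S'"
      and eq: "\<forall>c\<in>charts_at A q. v c = jacobian d' c q *v s'"
      unfolding submanifold_tangent_def by blast
    obtain c where c: "c \<in> charts_at A q" using ex_chart_at by blast
    let ?s = "jacobian c d q *v (jacobian d' c q *v s')"
    have "?s \<in> S" by (rule transition_curve_slice[OF a' a c s'])
    moreover have "v = pushforward d q ?s"
    proof -
      have "pushforward d q ?s = pushforward c q (pushforward d q ?s c)"
        by (rule tangent_real[OF pushforward_tangent[OF d] c])
      also have "pushforward d q ?s c = v c"
        using jacobian_cancel[OF d(1) c d(2)] c eq by (simp add: pushforward_def)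
      also have "pushforward c q (v c) = v" using tangent_real[OF v c] by simp
      finally show ?thesis by simp
    qed
    ultimately show "v \<in> pushforward d q ` S" by blast
  qed
qed

end


section \<open>The projection onto the kernel of an F-structure\<close>

text \<open>Pairs of real vectors are used because a complexified real matrix acts on the two parts
  separately.\<close>

definition cplx_vec :: "real^'n \<Rightarrow> real^'n \<Rightarrow> complex^'n" where
  "cplx_vec x y = (\<chi> i. Complex (x $ i) (y $ i))"

lemma cplx_vec_eq_iff: "cplx_vec x y = cplx_vec x' y' \<longleftrightarrow> x = x' \<and> y = y'"
  by (auto simp: cplx_vec_def vec_eq_iff)

lemma cplx_vec_cases: obtains x y where "w = cplx_vec x y"
  by (rule that[of "\<chi> i. Re (w $ i)" "\<chi> i. Im (w $ i)"]) (simp add: cplx_vec_def vec_eq_iff complex_eq_iff)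

lemma cplx_vec_0: "cplx_vec 0 0 = 0"
  by (simp add: cplx_vec_def vec_eq_iff complex_eq_iff)

lemma of_real_matrix_cplx_vec:
  "map_matrix complex_of_real M *v cplx_vec x y = cplx_vec (M *v x) (M *v y)"
  by (simp add: cplx_vec_def vec_eq_iff matrix_vector_mult_def complex_eq_iff)

lemma of_real_matrix_mult:
  "map_matrix complex_of_real (A ** B) = map_matrix of_real A ** map_matrix of_real B"
  by (simp add: vec_eq_iff matrix_matrix_mult_def)

lemma of_real_matpow: "map_matrix complex_of_real (matpow B k) = matpow (map_matrix of_real B) k"
  by (induction k) (simp_all add: of_real_matrix_mult, simp add: vec_eq_iff mat_def)

lemma mat_mult_nth: "(mat k ** (M :: 'a::comm_semiring_1^'n^'n)) $ i $ j = k * M $ i $ j"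
  by (simp add: matrix_matrix_mult_def mat_def if_distrib[of "\<lambda>x. x * _"] cong: if_cong)

lemma mat_mult_real: "mat k ** (M :: real^'n^'n) = k *\<^sub>R M"
  by (simp add: vec_eq_iff mat_mult_nth)

lemma matpow_Suc2: "matpow (B :: real^'n^'n) (Suc k) = matpow B k ** B"
  by (induction k) (simp_all add: matrix_mul_assoc)

lemma matrix_scaleR_mult: "(k *\<^sub>R (M :: real^'n^'m)) ** N = k *\<^sub>R (M ** N)" "M ** (k *\<^sub>R N) = k *\<^sub>R (M ** N)"
  by (simp_all add: vec_eq_iff matrix_matrix_mult_def sum_distrib_left mult_ac)

lemma matrix_mult_zero: "(M :: real^'n^'m) ** 0 = 0" "0 ** (N :: real^'p^'n) = 0"
  by (simp_all add: vec_eq_iff matrix_matrix_mult_def)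

lemma real_imag_combination:
  fixes X Y Z :: "real^'n::finite^'n"
  assumes "mat \<alpha> ** map_matrix complex_of_real X + mat \<beta> ** map_matrix of_real Y + map_matrix of_real Z = 0"
  shows "Re \<alpha> *\<^sub>R X + Re \<beta> *\<^sub>R Y + Z = 0" "Im \<alpha> *\<^sub>R X + Im \<beta> *\<^sub>R Y = 0"
proof -
  have e: "\<alpha> * of_real (X $ i $ j) + \<beta> * of_real (Y $ i $ j) + of_real (Z $ i $ j) = 0" for i j
    using arg_cong[OF assms, of "\<lambda>M. M $ i $ j"] by (simp add: mat_mult_nth)
  show "Re \<alpha> *\<^sub>R X + Re \<beta> *\<^sub>R Y + Z = 0" "Im \<alpha> *\<^sub>R X + Im \<beta> *\<^sub>R Y = 0"
    using arg_cong[OF e, of Re] arg_cong[OF e, of Im] by (simp_all add: vec_eq_iff)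
qed

text \<open>The real part of the equation gives \<open>B ** P = 0\<close>. As
  \<open>K - 1 \<ge> 2\<close>, only positive powers of \<open>B\<close> occur in
  \<open>P - I\<close>, so these kill \<open>P\<close> and \<open>P\<close> is idempotent. For the
  imaginary part \<open>G\<close> of \<open>m\<close>, a factor \<open>B\<close> on the right gives
  \<open>G ** P = 0\<close>, while \<open>G ** B = 0\<close> gives \<open>G ** P = G\<close>; hence
  \<open>m\<close> is real.\<close>

lemma F_matrix_projection:
  fixes B :: "real^'n::finite^'n"
  assumes K: "K \<ge> 3"
    and eq: "mat \<alpha> ** matpow (map_matrix complex_of_real B) (K + 1) +
      mat \<beta> ** matpow (map_matrix of_real B) K + map_matrix of_real B = 0"
  defines "P \<equiv> mat 1 + mat (Re \<alpha>) ** matpow B K + mat (Re \<beta>) ** matpow B (K - 1)"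
  shows "map_matrix complex_of_real P = mat 1 + mat \<alpha> ** matpow (map_matrix of_real B) K +
      mat \<beta> ** matpow (map_matrix of_real B) (K - 1)"
    and "B ** P = 0" "P ** B = 0" "P ** P = P" "B *v w = 0 \<Longrightarrow> P *v w = w"
proof -
  obtain k where k: "K = Suc (Suc (Suc k))"
    using K by (intro that[of "K - 3"]) simp
  have R: "Re \<alpha> *\<^sub>R matpow B (K + 1) + Re \<beta> *\<^sub>R matpow B K + B = 0"
    and I: "Im \<alpha> *\<^sub>R matpow B (K + 1) + Im \<beta> *\<^sub>R matpow B K = 0"
    by (rule real_imag_combination[OF eq[folded of_real_matpow]])+
  have P: "P = mat 1 + (Re \<alpha> *\<^sub>R matpow B K + Re \<beta> *\<^sub>R matpow B (K - 1))"
    by (simp add: P_def mat_mult_real)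
  have [simp]: "K - Suc 0 = Suc (Suc k)" using k by simp
  show BP: "B ** P = 0"
    using R unfolding P
    by (simp add: k matrix_add_ldistrib matrix_scaleR_mult add_ac)
  have "P ** B = B + (Re \<alpha> *\<^sub>R matpow B (Suc K) + Re \<beta> *\<^sub>R matpow B (Suc (Suc (Suc k))))"
    unfolding matpow_Suc2 P
    by (simp add: matrix_add_rdistrib matrix_scaleR_mult matpow_Suc2 del: matpow.simps)
  then show PB: "P ** B = 0" using R by (simp add: k add_ac del: matpow.simps)
  have "P ** P = P + (Re \<alpha> *\<^sub>R matpow B K + Re \<beta> *\<^sub>R matpow B (K - 1)) ** P"
    by (subst (1) P) (simp add: matrix_add_rdistrib)
  moreover have "matpow B (Suc j) ** P = 0" for j
    unfolding matpow_Suc2 by (simp add: matrix_mul_assoc[symmetric] BP matrix_mult_zero)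
  ultimately show "P ** P = P"
    by (simp add: matrix_add_rdistrib matrix_scaleR_mult k del: matpow.simps)
  have pw: "matpow B (Suc j) *v w = 0" if "B *v w = 0" for j w
    unfolding matpow_Suc2 by (simp add: matrix_vector_mul_assoc[symmetric] that)
  show "P *v w = w" if "B *v w = 0"
    unfolding P
    by (simp add: matrix_vector_mult_add_rdistrib scaleR_matrix_vector_assoc[symmetric] k pw[OF that] del: matpow.simps)
  \<comment> \<open>\<open>G\<close> is the imaginary part of \<open>m\<close>.\<close>
  define G where "G = Im \<alpha> *\<^sub>R matpow B K + Im \<beta> *\<^sub>R matpow B (K - 1)"
  have GB: "G ** B = 0"
    using I unfolding G_def k
    by (simp add: matrix_add_rdistrib matrix_scaleR_mult matpow_Suc2[symmetric] del: matpow.simps)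
  have "G = (Im \<alpha> *\<^sub>R matpow B (K - 1) + Im \<beta> *\<^sub>R matpow B (Suc k)) ** B"
    unfolding G_def k by (simp add: matrix_add_rdistrib matrix_scaleR_mult matpow_Suc2[symmetric] del: matpow.simps)
  then have "G ** P = 0"
    by (simp add: matrix_mul_assoc[symmetric] BP matrix_mult_zero)
  moreover have "G ** matpow B (Suc j) = 0" for j
    by (simp add: matrix_mul_assoc GB matrix_mult_zero)
  then have "G ** P = G"
    unfolding P by (simp add: matrix_add_ldistrib matrix_scaleR_mult k del: matpow.simps)
  ultimately have G0: "G = 0" by simp
  show "map_matrix complex_of_real P = mat 1 + mat \<alpha> ** matpow (map_matrix of_real B) K +
      mat \<beta> ** matpow (map_matrix of_real B) (K - 1)"
  proof -
    have "Im \<alpha> * matpow B K $ i $ j + Im \<beta> * matpow B (K - 1) $ i $ j = 0" for i j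
      using arg_cong[OF G0, of "\<lambda>M. M $ i $ j"] by (simp add: G_def del: matpow.simps)
    then show ?thesis
      unfolding P of_real_matpow[symmetric]
      by (simp add: vec_eq_iff mat_mult_nth complex_eq_iff del: matpow.simps) (simp add: mat_def)
  qed
qed

lemma Ck_on_matpow:
  assumes "open U" "Ck_on k U f"
  shows "Ck_on k U (\<lambda>x. matpow (f x :: real^'n^'n) j)"
  by (induction j) (auto intro: Ck_on_const Ck_on_bilinear[OF bounded_bilinear_matrix_matrix] assms)

lemma matpow_intertwine:
  assumes "(M :: real^'n^'n) ** J = J ** N"
  shows "matpow M k ** J = J ** matpow N k"
proof (induction k)
  case (Suc k)
  have "M ** matpow M k ** J = M ** (J ** matpow N k)"
    using Suc by (simp add: matrix_mul_assoc[symmetric])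
  also have "\<dots> = J ** (N ** matpow N k)"
    using assms by (simp add: matrix_mul_assoc)
  finally show ?case by simp
qed simp

lemma complexification_cplx_vec: "complexification V = {\<lambda>c. cplx_vec (u c) (w c) | u w. u \<in> V \<and> w \<in> V}"
  by (simp add: complexification_def cplx_vec_def)

text \<open>\<open>V\<close> is an arbitrary set, possibly without 0, so a vector \<open>u\<close>
  is tested through \<open>u + i u\<close>.\<close>

lemma complexification_subset_iff: "complexification V \<subseteq> complexification V' \<longleftrightarrow> V \<subseteq> V'"
proof
  assume sub: "complexification V \<subseteq> complexification V'"
  show "V \<subseteq> V'"
  proof
    fix u assume "u \<in> V"
    then have "(\<lambda>c. cplx_vec (u c) (u c)) \<in> complexification V'"
      using sub unfolding complexification_cplx_vec by blast
    then obtain u' w' where "(\<lambda>c. cplx_vec (u c) (u c)) = (\<lambda>c. cplx_vec (u' c) (w' c))" "u' \<in> V'"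
      unfolding complexification_cplx_vec by blast
    moreover from this have "u = u'" by (auto simp: fun_eq_iff cplx_vec_eq_iff)
    ultimately show "u \<in> V'" by simp
  qed
qed (auto simp: complexification_cplx_vec)

lemma complexification_eq_iff: "complexification V = complexification V' \<longleftrightarrow> V = V'"
  by (metis complexification_subset_iff subset_antisym order_refl)

section \<open>The kernel distribution of an F-structure\<close>

locale F_manifold = manifold A
  for A :: "('m::{t2_space, second_countable_topology}, 'n::finite) chart set" +
  fixes F :: "('m, 'n, real) tensor11" and K r :: nat and \<alpha> \<beta> :: complex
  assumes F_structure: "F_structure A F K r \<alpha> \<beta>"
begin

text \<open>At a chart not around \<open>p\<close> the value is the identity matrix, since
  \<open>F\<close> is zero there; tangent vectors are zero there too, so their images stay
  zero.\<close>

definition proj :: "('m, 'n, real) tensor11" where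
  "proj p c = mat 1 + mat (Re \<alpha>) ** matpow (F p c) K + mat (Re \<beta>) ** matpow (F p c) (K - 1)"

definition Fc :: "('m, 'n) chart \<Rightarrow> real^'n \<Rightarrow> real^'n^'n" where
  "Fc c x = F (coord_inv c x) c"

definition Pc :: "('m, 'n) chart \<Rightarrow> real^'n \<Rightarrow> real^'n^'n" where
  "Pc c x = proj (coord_inv c x) c"

lemma K_ge: "K \<ge> 3"
  using F_structure by (simp add: F_structure_def)

lemma F_tensor:
  assumes "c \<in> charts_at A p" "d \<in> charts_at A p"
  shows "F p d ** jacobian c d p = jacobian c d p ** F p c"
  using F_structure assms by (simp add: F_structure_def smooth_tensor11_def)

lemma F_outside: "c \<notin> charts_at A p \<Longrightarrow> F p c = 0"
  using F_structure unfolding F_structure_def smooth_tensor11_def by blast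

lemma Fc_smooth: "c \<in> A \<Longrightarrow> Ck_on k (chart_image c) (Fc c)"
  using F_structure by (simp add: F_structure_def smooth_tensor11_def smooth_on_def Fc_def[abs_def])

lemma Pc_smooth: "c \<in> A \<Longrightarrow> Ck_on k (chart_image c) (Pc c)"
  unfolding Pc_def[abs_def] proj_def Fc_def[symmetric]
  by (intro Ck_on_add Ck_on_const Ck_on_bilinear[OF bounded_bilinear_matrix_matrix] Ck_on_matpow Fc_smooth
      is_chartD(2) chart)

lemma F_equation:
  assumes "c \<in> charts_at A p"
  shows "mat \<alpha> ** matpow (map_matrix complex_of_real (F p c)) (K + 1) +
      mat \<beta> ** matpow (map_matrix of_real (F p c)) K + map_matrix of_real (F p c) = 0"
  using F_structure assms unfolding F_structure_def complex_tensor_def by blast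

lemma proj:
  assumes "c \<in> charts_at A p"
  shows "m_tensor F K \<alpha> \<beta> p c = map_matrix of_real (proj p c)"
    and "F p c ** proj p c = 0" "proj p c ** F p c = 0" "proj p c ** proj p c = proj p c"
    and "F p c *v w = 0 \<Longrightarrow> proj p c *v w = w"
  using F_matrix_projection[OF K_ge F_equation[OF assms]]
  unfolding proj_def[symmetric] m_tensor_def complex_tensor_def by auto

lemma proj_tensor:
  assumes "c \<in> charts_at A p" "d \<in> charts_at A p"
  shows "proj p d ** jacobian c d p = jacobian c d p ** proj p c"
  by (simp add: proj_def mat_mult_real matrix_add_rdistrib matrix_add_ldistrib matrix_scaleR_mult
      matpow_intertwine[OF F_tensor[OF assms]])

text \<open>The projection fixes the kernel of \<open>F\<close> and kills its image, so the two meet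
  only in zero.\<close>

lemma F_ker_im:
  assumes "c \<in> charts_at A p" "F p c *v (F p c *v w) = 0"
  shows "F p c *v w = 0"
  using proj(5)[OF assms] proj(3)[OF assms(1)] by (simp add: matrix_vector_mul_assoc)

definition ker_F :: "'m \<Rightarrow> ('m, 'n, real) tvec set" where
  "ker_F p = {v \<in> tangent_space A p. \<forall>c\<in>charts_at A p. F p c *v v c = 0}"

lemma ker_F_iff:
  assumes v: "v \<in> tangent_space A p" and c: "c \<in> charts_at A p"
  shows "v \<in> ker_F p \<longleftrightarrow> F p c *v v c = 0"
proof -
  have "F p d *v v d = 0" if "F p c *v v c = 0" "d \<in> charts_at A p" for d
  proof -
    have "v d = jacobian c d p *v v c"
      using tangent_real[OF v c] that(2) by (metis pushforward_def)
    then have "F p d *v v d = (F p d ** jacobian c d p) *v v c"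
      by (simp add: matrix_vector_mul_assoc)
    also have "\<dots> = jacobian c d p *v (F p c *v v c)"
      using F_tensor[OF c that(2)] by (simp add: matrix_vector_mul_assoc)
    finally show ?thesis using that(1) by simp
  qed
  then show ?thesis using v c by (auto simp: ker_F_def)
qed

text \<open>The Jacobians are real, so a complex tangent vector splits into two real ones, on each
  of which \<open>m\<close> acts as \<open>proj\<close>. Conversely \<open>proj\<close> fixes kernel
  vectors, which makes an element of the complexified kernel its own preimage.\<close>

lemma D_m_eq: "D_m A F K \<alpha> \<beta> p = complexification (ker_F p)"
proof
  show "D_m A F K \<alpha> \<beta> p \<subseteq> complexification (ker_F p)"
  proof
    fix w assume "w \<in> D_m A F K \<alpha> \<beta> p"
    then obtain z :: "('m, 'n, complex) tvec" where z: "z \<in> tangent_space A p"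
      and w: "w = (\<lambda>c. m_tensor F K \<alpha> \<beta> p c *v z c)"
      by (auto simp: D_m_def endo_app_def)
    have "\<exists>x y. z c = cplx_vec x y" for c using cplx_vec_cases by metis
    then obtain x y where xy: "\<And>c. z c = cplx_vec (x c) (y c)" by metis
    have out: "x c = 0" "y c = 0" if "c \<notin> charts_at A p" for c
    proof -
      have "cplx_vec (x c) (y c) = cplx_vec 0 0"
        using z that unfolding xy[symmetric] cplx_vec_0 tangent_space_def by blast
      then show "x c = 0" "y c = 0" by (auto simp: cplx_vec_eq_iff)
    qed
    have trans: "x d = jacobian c d p *v x c \<and> y d = jacobian c d p *v y c"
      if "c \<in> charts_at A p" "d \<in> charts_at A p" for c d
    proof -
      have "z d = map_matrix of_real (jacobian c d p) *v z c"
        using z that unfolding tangent_space_def by blast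
      then show ?thesis by (simp add: xy of_real_matrix_cplx_vec cplx_vec_eq_iff)
    qed
    have ker: "(\<lambda>c. proj p c *v x c) \<in> ker_F p"
      if out: "\<And>c. c \<notin> charts_at A p \<Longrightarrow> x c = 0"
        and trans: "\<And>c d. c \<in> charts_at A p \<Longrightarrow> d \<in> charts_at A p \<Longrightarrow> x d = jacobian c d p *v x c"
      for x :: "('m, 'n, real) tvec"
    proof -
      have tr: "proj p d *v x d = jacobian c d p *v (proj p c *v x c)"
        if cd: "c \<in> charts_at A p" "d \<in> charts_at A p" for c d
      proof -
        have "proj p d *v x d = (proj p d ** jacobian c d p) *v x c"
          unfolding trans[OF cd] by (simp add: matrix_vector_mul_assoc)
        then show ?thesis by (simp add: proj_tensor[OF cd] matrix_vector_mul_assoc)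
      qed
      show ?thesis
        unfolding ker_F_def tangent_space_def
      proof (intro CollectI conjI ballI allI impI)
        fix c assume c: "c \<in> charts_at A p"
        show "F p c *v (proj p c *v x c) = 0"
          using proj(2)[OF c] by (simp add: matrix_vector_mul_assoc)
        fix d assume d: "d \<in> charts_at A p"
        show "proj p d *v x d = map_matrix of_real (jacobian c d p) *v (proj p c *v x c)"
          using tr[OF c d] by simp
      qed (simp add: out)
    qed
    have "w = (\<lambda>c. cplx_vec (proj p c *v x c) (proj p c *v y c))"
    proof
      fix c
      show "w c = cplx_vec (proj p c *v x c) (proj p c *v y c)"
        by (cases "c \<in> charts_at A p")
          (simp_all add: w xy proj(1) of_real_matrix_cplx_vec out cplx_vec_0)
    qed
    moreover have "(\<lambda>c. proj p c *v x c) \<in> ker_F p" "(\<lambda>c. proj p c *v y c) \<in> ker_F p"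
      using out trans by (intro ker; blast)+
    ultimately show "w \<in> complexification (ker_F p)"
      unfolding complexification_cplx_vec by (intro CollectI exI conjI)
  qed
  show "complexification (ker_F p) \<subseteq> D_m A F K \<alpha> \<beta> p"
  proof
    fix w assume "w \<in> complexification (ker_F p)"
    then obtain x y where w: "w = (\<lambda>c. cplx_vec (x c) (y c))" and xy: "x \<in> ker_F p" "y \<in> ker_F p"
      unfolding complexification_cplx_vec by blast
    have tr: "v d = jacobian c d p *v v c" if "v \<in> ker_F p" "c \<in> charts_at A p" "d \<in> charts_at A p" for v c d
    proof -
      have "v = pushforward c p (v c)"
        using that tangent_real[of v p c] unfolding ker_F_def by blast
      then have "v d = pushforward c p (v c) d" by (rule fun_cong)
      then show ?thesis using that(3) by (simp add: pushforward_def)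
    qed
    have out: "v c = 0" if "v \<in> ker_F p" "c \<notin> charts_at A p" for v c
      using that unfolding ker_F_def tangent_space_def by blast
    have "w \<in> tangent_space A p"
      unfolding tangent_space_def
    proof (intro CollectI conjI ballI allI impI)
      fix c d assume cd: "c \<in> charts_at A p" "d \<in> charts_at A p"
      show "w d = map_matrix of_real (jacobian c d p) *v w c"
        unfolding w of_real_matrix_cplx_vec cplx_vec_eq_iff using tr[OF _ cd] xy by blast
    qed (simp add: w out xy cplx_vec_0)
    moreover have "w = endo_app (m_tensor F K \<alpha> \<beta> p) w"
    proof
      fix c
      show "w c = endo_app (m_tensor F K \<alpha> \<beta> p) w c"
      proof (cases "c \<in> charts_at A p")
        case True
        then have "proj p c *v x c = x c" "proj p c *v y c = y c"
          using xy by (auto simp: ker_F_def proj(5))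
        then show ?thesis using True by (simp add: endo_app_def w proj(1) of_real_matrix_cplx_vec)
      qed (simp add: endo_app_def w out xy cplx_vec_0)
    qed
    ultimately show "w \<in> D_m A F K \<alpha> \<beta> p" unfolding D_m_def by blast
  qed
qed

lemma integral_manifold_iff:
  "integral_manifold A (D_m A F K \<alpha> \<beta>) N \<longleftrightarrow>
    (\<exists>k. immersed_submanifold A k N) \<and> (\<forall>q\<in>topspace N. submanifold_tangent A N q = ker_F q)"
  by (simp add: integral_manifold_def D_m_eq complexification_eq_iff)

end


section \<open>The Nijenhuis tensor on the kernel\<close>

lemma cplx_vec_of_real: "cplx_vec u 0 = (\<chi> i. complex_of_real (u $ i))"
  by (simp add: cplx_vec_def vec_eq_iff complex_eq_iff)

lemma complex_field_cplx_vec: "complex_field X p c = cplx_vec (X p c) 0"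
  by (simp add: complex_field_def cplx_vec_of_real)

lemma bounded_linear_cplx_vec: "bounded_linear (\<lambda>u. cplx_vec u 0)"
  unfolding linear_conv_bounded_linear[symmetric] cplx_vec_of_real
  by (auto intro!: linearI simp: vec_eq_iff scaleR_conv_of_real[where 'a = complex])

lemma linear_axis_expansion:
  fixes T :: "real^'n \<Rightarrow> real^'n::finite"
  assumes "linear T"
  shows "T x $ j = (\<Sum>i\<in>UNIV. x $ i * T (axis i 1) $ j)"
proof -
  have "T x = T (\<Sum>i\<in>UNIV. x $ i *\<^sub>R axis i 1)"
    by (simp add: basis_expansion scalar_mult_eq_scaleR[symmetric])
  also have "\<dots> = (\<Sum>i\<in>UNIV. x $ i *\<^sub>R T (axis i 1))"
    by (simp only: linear_sum[OF assms] linear_scale[OF assms])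
  finally show ?thesis by simp
qed

lemma coord_deriv_complex_field:
  assumes "((\<lambda>x. W (coord_inv c x) c) has_derivative W') (at (coord c p))"
  shows "coord_deriv c p i (complex_field W) = cplx_vec (W' (axis i 1)) 0"
proof -
  have "((\<lambda>x. cplx_vec (W (coord_inv c x) c) 0) has_derivative (\<lambda>h. cplx_vec (W' h) 0)) (at (coord c p))"
    by (rule bounded_linear.has_derivative[OF bounded_linear_cplx_vec assms])
  from frechet_derivative_eq[OF this] show ?thesis
    by (simp add: coord_deriv_def complex_field_cplx_vec)
qed

text \<open>Summation over the axis directions reassembles the derivatives of the fields in each
  other's direction, so the bracket can be handled without coordinates.\<close>

lemma lie_bracket_complex_field:
  assumes c: "c \<in> charts_at A p"
    and Z: "((\<lambda>x. Z (coord_inv c x) c) has_derivative Z') (at (coord c p))"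
    and W: "((\<lambda>x. W (coord_inv c x) c) has_derivative W') (at (coord c p))"
  shows "lie_bracket A (complex_field Z) (complex_field W) p c = cplx_vec (W' (Z p c) - Z' (W p c)) 0"
  unfolding cplx_vec_of_real
proof (subst vec_eq_iff, intro allI)
  fix j
  have l: "linear Z'" "linear W'" using Z W has_derivative_linear by blast+
  have "lie_bracket A (complex_field Z) (complex_field W) p c $ j =
     (\<Sum>i\<in>UNIV. of_real (Z p c $ i) * of_real (W' (axis i 1) $ j) - of_real (W p c $ i) * of_real (Z' (axis i 1) $ j))"
    using c by (simp add: lie_bracket_def coord_deriv_complex_field[where W = Z, OF Z] coord_deriv_complex_field[where W = W, OF W]
        complex_field_cplx_vec cplx_vec_of_real)
  also have "\<dots> = of_real ((W' (Z p c) - Z' (W p c)) $ j)"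
    by (simp add: linear_axis_expansion[OF l(1), of "W p c"] linear_axis_expansion[OF l(2), of "Z p c"] sum_subtractf)
  finally show "lie_bracket A (complex_field Z) (complex_field W) p c $ j =
      (\<chi> i. complex_of_real ((W' (Z p c) - Z' (W p c)) $ i)) $ j" by simp
qed

lemma lie_bracket_zero_field:
  "lie_bracket A (\<lambda>p c. 0) W = (\<lambda>p c. 0)" "lie_bracket A W (\<lambda>p c. 0) = (\<lambda>p c. 0)"
  by (auto simp: lie_bracket_def coord_deriv_def frechet_derivative_const fun_eq_iff)

lemma tensor_app_zero_field: "tensor_app T (\<lambda>p c. 0) = (\<lambda>p c. 0)"
  by (simp add: tensor_app_def endo_app_def fun_eq_iff)

context F_manifold
begin

definition involutive_kernel :: bool where
  "involutive_kernel \<longleftrightarrow> (\<forall>c\<in>A. \<forall>x\<in>chart_image c. \<forall>u v. Fc c x *v u = 0 \<longrightarrow> Fc c x *v v = 0 \<longrightarrow>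
     frechet_derivative (Fc c) (at x) u *v v = frechet_derivative (Fc c) (at x) v *v u)"

lemma chart_value:
  assumes "c \<in> charts_at A p"
  shows "Fc c (coord c p) = F p c" "Pc c (coord c p) = proj p c"
  using chart_at(4)[OF assms] by (simp_all add: Fc_def Pc_def)

lemma charts_at_coord_inv: "c \<in> A \<Longrightarrow> x \<in> chart_image c \<Longrightarrow> c \<in> charts_at A (coord_inv c x)"
  using is_chartD(8)[OF chart] by (simp add: charts_at_def)

lemma Fc_Pc: "c \<in> A \<Longrightarrow> x \<in> chart_image c \<Longrightarrow> Fc c x ** Pc c x = 0"
  unfolding Fc_def Pc_def by (rule proj(2)[OF charts_at_coord_inv])

lemma m_field:
  assumes "smooth_vector_field A X"
  shows "tensor_app (m_tensor F K \<alpha> \<beta>) (complex_field X) = complex_field (tensor_app proj X)"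
proof (intro ext)
  fix p c
  show "tensor_app (m_tensor F K \<alpha> \<beta>) (complex_field X) p c = complex_field (tensor_app proj X) p c"
  proof (cases "c \<in> charts_at A p")
    case True
    then show ?thesis
      by (simp add: tensor_app_def endo_app_def complex_field_cplx_vec proj(1) of_real_matrix_cplx_vec)
  next
    case False
    then have "X p c = 0" using assms unfolding smooth_vector_field_def tangent_space_def by blast
    then show ?thesis by (simp add: tensor_app_def endo_app_def complex_field_cplx_vec cplx_vec_0)
  qed
qed

text \<open>The second property is the derivative of \<open>F (proj X) = 0\<close>. The derivative
  \<open>Z'\<close> itself stays anonymous: the Nijenhuis tensor sees it only through
  \<open>F\<close>.\<close>

lemma proj_field_derivative:
  assumes X: "smooth_vector_field A X" and c: "c \<in> charts_at A p"
  obtains Z' where "((\<lambda>x. tensor_app proj X (coord_inv c x) c) has_derivative Z') (at (coord c p))"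
    "\<And>h. F p c *v Z' h = - (frechet_derivative (Fc c) (at (coord c p)) h *v tensor_app proj X p c)"
proof -
  note cA = chart_at(1)[OF c] and x = chart_at(5)[OF c]
  have oU: "open (chart_image c)" by (rule is_chartD(2)[OF chart_at(3)[OF c]])
  have sX: "Ck_on (Suc 0) (chart_image c) (\<lambda>x. X (coord_inv c x) c)"
    using X cA by (simp add: smooth_vector_field_def smooth_on_def del: Ck_on.simps)
  have "((\<lambda>x. Pc c x *v X (coord_inv c x) c) has_derivative
      (\<lambda>h. Pc c (coord c p) *v frechet_derivative (\<lambda>x. X (coord_inv c x) c) (at (coord c p)) h
        + frechet_derivative (Pc c) (at (coord c p)) h *v X (coord_inv c (coord c p)) c)) (at (coord c p))"
    by (rule matrix_vector_has_derivative[OF Ck_on_SucD[OF Pc_smooth[OF cA] x] Ck_on_SucD[OF sX x]])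
  moreover have "(\<lambda>x. tensor_app proj X (coord_inv c x) c) = (\<lambda>x. Pc c x *v X (coord_inv c x) c)"
    by (simp add: tensor_app_def endo_app_def Pc_def)
  ultimately obtain Z' where Z': "((\<lambda>x. tensor_app proj X (coord_inv c x) c) has_derivative Z') (at (coord c p))"
    by auto
  have "Fc c y *v tensor_app proj X (coord_inv c y) c = 0" if "y \<in> chart_image c" for y
    using Fc_Pc[OF cA that] by (simp add: tensor_app_def endo_app_def Pc_def matrix_vector_mul_assoc)
  from has_derivative_locally_const[OF oU x this matrix_vector_has_derivative[OF Ck_on_SucD[OF Fc_smooth[OF cA] x] Z']]
  have "F p c *v Z' h + frechet_derivative (Fc c) (at (coord c p)) h *v tensor_app proj X p c = 0" for h
    by (simp add: chart_value[OF c] chart_at(4)[OF c])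
  then show ?thesis using that[OF Z'] by (simp add: eq_neg_iff_add_eq_0)
qed

lemma F_complex_proj_field:
  "tensor_app (complex_tensor F) (complex_field (tensor_app proj X)) = (\<lambda>p c. 0)"
proof (intro ext)
  fix p c
  have "F p c *v (proj p c *v X p c) = 0"
    by (cases "c \<in> charts_at A p") (simp_all add: matrix_vector_mul_assoc proj(2) F_outside)
  then show "tensor_app (complex_tensor F) (complex_field (tensor_app proj X)) p c = 0"
    by (simp add: tensor_app_def endo_app_def complex_field_cplx_vec complex_tensor_def
        of_real_matrix_cplx_vec cplx_vec_0)
qed

lemma nijenhuis_m_field:
  assumes X: "smooth_vector_field A X" and Y: "smooth_vector_field A Y"
  defines "Z \<equiv> tensor_app proj X" and "W \<equiv> tensor_app proj Y"
  defines "N \<equiv> nijenhuis A (complex_tensor F) (tensor_app (m_tensor F K \<alpha> \<beta>) (complex_field X))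
    (tensor_app (m_tensor F K \<alpha> \<beta>) (complex_field Y))"
  shows "c \<notin> charts_at A p \<Longrightarrow> N p c = 0"
    and "c \<in> charts_at A p \<Longrightarrow> N p c = 0 \<longleftrightarrow>
      frechet_derivative (Fc c) (at (coord c p)) (W p c) *v Z p c =
      frechet_derivative (Fc c) (at (coord c p)) (Z p c) *v W p c"
    and "tensor_app (l_tensor F K \<alpha> \<beta>) N = N"
proof -
  have N: "N = tensor_app (complex_tensor F) (tensor_app (complex_tensor F) (lie_bracket A (complex_field Z) (complex_field W)))"
    unfolding N_def nijenhuis_def m_field[OF X] m_field[OF Y] Z_def[symmetric] W_def[symmetric]
    unfolding Z_def W_def F_complex_proj_field
    by (simp add: lie_bracket_zero_field tensor_app_zero_field)
  show out: "N p c = 0" if "c \<notin> charts_at A p" for p c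
    using that by (simp add: N tensor_app_def endo_app_def lie_bracket_def)
  \<comment> \<open>The witness \<open>b\<close> is the chart value of the real bracket of
    \<open>Z\<close> and \<open>W\<close>.\<close>
  have val: "\<exists>b. N p c = cplx_vec (F p c *v (F p c *v b)) 0 \<and>
      F p c *v b = frechet_derivative (Fc c) (at (coord c p)) (W p c) *v Z p c -
      frechet_derivative (Fc c) (at (coord c p)) (Z p c) *v W p c"
    if c: "c \<in> charts_at A p" for p c
  proof -
    obtain Z' where Z': "((\<lambda>x. Z (coord_inv c x) c) has_derivative Z') (at (coord c p))"
      "\<And>h. F p c *v Z' h = - (frechet_derivative (Fc c) (at (coord c p)) h *v Z p c)"
      by (rule proj_field_derivative[OF X c, folded Z_def]) (rule that)
    obtain W' where W': "((\<lambda>x. W (coord_inv c x) c) has_derivative W') (at (coord c p))"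
      "\<And>h. F p c *v W' h = - (frechet_derivative (Fc c) (at (coord c p)) h *v W p c)"
      by (rule proj_field_derivative[OF Y c, folded W_def]) (rule that)
    show ?thesis
    proof (intro exI conjI)
      show "N p c = cplx_vec (F p c *v (F p c *v (W' (Z p c) - Z' (W p c)))) 0"
        by (simp add: N tensor_app_def endo_app_def lie_bracket_complex_field[where Z = Z and W = W, OF c Z'(1) W'(1)]
            complex_tensor_def of_real_matrix_cplx_vec)
      show "F p c *v (W' (Z p c) - Z' (W p c)) =
          frechet_derivative (Fc c) (at (coord c p)) (W p c) *v Z p c -
          frechet_derivative (Fc c) (at (coord c p)) (Z p c) *v W p c"
        by (simp add: matrix_vector_mult_diff_distrib Z'(2) W'(2))
    qed
  qed
  show "N p c = 0 \<longleftrightarrow> frechet_derivative (Fc c) (at (coord c p)) (W p c) *v Z p c =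
      frechet_derivative (Fc c) (at (coord c p)) (Z p c) *v W p c" if c: "c \<in> charts_at A p"
  proof -
    obtain b where b: "N p c = cplx_vec (F p c *v (F p c *v b)) 0"
      "F p c *v b = frechet_derivative (Fc c) (at (coord c p)) (W p c) *v Z p c -
      frechet_derivative (Fc c) (at (coord c p)) (Z p c) *v W p c"
      using val[OF c] by blast
    have "N p c = 0 \<longleftrightarrow> F p c *v (F p c *v b) = 0"
      unfolding b(1) cplx_vec_0[symmetric] cplx_vec_eq_iff by simp
    also have "\<dots> \<longleftrightarrow> F p c *v b = 0" using F_ker_im[OF c] by auto
    finally show ?thesis unfolding b(2) by simp
  qed
  show "tensor_app (l_tensor F K \<alpha> \<beta>) N = N"
  proof (intro ext)
    fix p c
    show "tensor_app (l_tensor F K \<alpha> \<beta>) N p c = N p c"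
    proof (cases "c \<in> charts_at A p")
      case True
      then obtain b where b: "N p c = cplx_vec (F p c *v (F p c *v b)) 0" using val by blast
      have l: "l_tensor F K \<alpha> \<beta> p c = mat 1 - m_tensor F K \<alpha> \<beta> p c"
        by (simp add: l_tensor_def m_tensor_def)
      have "proj p c *v (F p c *v v) = 0" for v
        using proj(3)[OF True] by (simp add: matrix_vector_mul_assoc)
      then have "m_tensor F K \<alpha> \<beta> p c *v N p c = 0"
        unfolding b proj(1)[OF True] of_real_matrix_cplx_vec by (simp add: cplx_vec_0)
      then show ?thesis by (simp add: tensor_app_def endo_app_def l matrix_vector_mult_diff_rdistrib)
    qed (simp add: tensor_app_def endo_app_def out)
  qed
qed

lemma nijenhuis_zero_iff_involutive:
  "(\<forall>X Y :: ('m, 'n, real) vfield. smooth_vector_field A X \<longrightarrow> smooth_vector_field A Y \<longrightarrow>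
      nijenhuis A (complex_tensor F) (tensor_app (m_tensor F K \<alpha> \<beta>) (complex_field X))
        (tensor_app (m_tensor F K \<alpha> \<beta>) (complex_field Y)) = (\<lambda>p c. 0)) \<longleftrightarrow> involutive_kernel"
  (is "?N \<longleftrightarrow> _")
proof
  assume N: ?N
  show involutive_kernel
    unfolding involutive_kernel_def
  proof (intro ballI allI impI)
    fix c x u v assume c: "c \<in> A" and x: "x \<in> chart_image c" and uv: "Fc c x *v u = 0" "Fc c x *v v = 0"
    define p where "p = coord_inv c x"
    have cp: "c \<in> charts_at A p" using charts_at_coord_inv[OF c x] by (simp add: p_def)
    have xp: "coord c p = x" using is_chartD(7)[OF chart[OF c] x] by (simp add: p_def)
    \<comment> \<open>The prescribed values lie in the kernel, so \<open>proj\<close> leaves them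
      unchanged at \<open>p\<close>. \<open>X\<close> carries \<open>v\<close> and \<open>Y\<close>
      carries \<open>u\<close>, matching the order in the criterion.\<close>
    obtain X :: "('m, 'n, real) vfield" where X: "smooth_vector_field A X" "X p c = v"
      by (rule smooth_vector_field_extension[OF cp]) (rule that)
    obtain Y :: "('m, 'n, real) vfield" where Y: "smooth_vector_field A Y" "Y p c = u"
      by (rule smooth_vector_field_extension[OF cp]) (rule that)
    have "tensor_app proj X p c = v" "tensor_app proj Y p c = u"
      using uv X(2) Y(2) proj(5)[OF cp] chart_value(1)[OF cp] by (simp_all add: tensor_app_def endo_app_def xp)
    moreover have "nijenhuis A (complex_tensor F) (tensor_app (m_tensor F K \<alpha> \<beta>) (complex_field X))
        (tensor_app (m_tensor F K \<alpha> \<beta>) (complex_field Y)) p c = 0"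
      using N X(1) Y(1) by metis
    ultimately show "frechet_derivative (Fc c) (at x) u *v v = frechet_derivative (Fc c) (at x) v *v u"
      using nijenhuis_m_field(2)[OF X(1) Y(1) cp] by (simp add: xp)
  qed
next
  assume inv: involutive_kernel
  show ?N
  proof (intro allI impI ext)
    fix X Y :: "('m, 'n, real) vfield" and p c
    assume XY: "smooth_vector_field A X" "smooth_vector_field A Y"
    show "nijenhuis A (complex_tensor F) (tensor_app (m_tensor F K \<alpha> \<beta>) (complex_field X))
        (tensor_app (m_tensor F K \<alpha> \<beta>) (complex_field Y)) p c = 0"
    proof (cases "c \<in> charts_at A p")
      case True
      have "Fc c (coord c p) *v tensor_app proj V p c = 0" for V
        using proj(2)[OF True] by (simp add: chart_value[OF True] tensor_app_def endo_app_def matrix_vector_mul_assoc)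
      then show ?thesis
        using nijenhuis_m_field(2)[OF XY True] inv chart_at(1,5)[OF True]
        unfolding involutive_kernel_def by blast
    qed (rule nijenhuis_m_field(1)[OF XY])
  qed
qed

end


section \<open>Integrability\<close>

lemma second_countable_euclidean:
  "second_countable (euclidean :: 'a::second_countable_topology topology)"
proof -
  obtain B :: "'a set set" where B: "countable B" "\<And>C. C \<in> B \<Longrightarrow> open C"
    "\<And>S. open S \<Longrightarrow> \<exists>U. U \<subseteq> B \<and> S = \<Union>U"
    using univ_second_countable by metis
  have "\<exists>V\<in>B. x \<in> V \<and> V \<subseteq> S" if "open S" "x \<in> S" for S x
    using B(3)[OF that(1)] that(2) by blast
  then show ?thesis
    unfolding second_countable_def using B(1,2) by (intro exI[of _ B]) auto
qed

text \<open>The inverse \<open>h'\<close> is supplied explicitly, so the inverse of the new chart is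
  known in closed form and compatibility reduces to that of \<open>c\<close> with the charts of
  \<open>A\<close> and the smoothness of \<open>h\<close> and \<open>h'\<close>.\<close>

lemma (in manifold) maximal_atlas_compose:
  fixes h h' :: "real^'n \<Rightarrow> real^'n"
  assumes c: "c \<in> A" and V: "open V" "V \<subseteq> chart_image c" and V': "open V'"
    and h: "\<And>x. x \<in> V \<Longrightarrow> h x \<in> V'" "\<And>x. x \<in> V \<Longrightarrow> h' (h x) = x" "\<And>k. Ck_on k V h"
    and h': "\<And>z. z \<in> V' \<Longrightarrow> h' z \<in> V" "\<And>z. z \<in> V' \<Longrightarrow> h (h' z) = z" "\<And>k. Ck_on k V' h'"
  defines "d \<equiv> (dom_chart c \<inter> coord c -` V, h \<circ> coord c)"
  shows "d \<in> maximal_atlas A" "chart_image d = V'" "z \<in> V' \<Longrightarrow> coord_inv d z = coord_inv c (h' z)"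
proof -
  note ch = is_chartD[OF chart[OF c]]
  have dom: "dom_chart d = dom_chart c \<inter> coord c -` V" and co: "coord d = h \<circ> coord c"
    by (simp_all add: d_def)
  have inv_V: "coord_inv c x \<in> dom_chart d" "coord c (coord_inv c x) = x" if "x \<in> V" for x
    using ch(7,8)[of x] that V(2) by (auto simp: dom)
  show im: "chart_image d = V'"
  proof
    show "chart_image d \<subseteq> V'" using h(1) by (auto simp: dom co)
    show "V' \<subseteq> chart_image d"
    proof
      fix z assume z: "z \<in> V'"
      have "z = coord d (coord_inv c (h' z))" using inv_V(2)[OF h'(1)[OF z]] h'(2)[OF z] by (simp add: co)
      then show "z \<in> chart_image d" using inv_V(1)[OF h'(1)[OF z]] by blast
    qed
  qed
  have left: "coord_inv c (h' (coord d q)) = q" if "q \<in> dom_chart d" for q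
    using that h(2) ch(6) by (auto simp: dom co)
  have inj: "inj_on (coord d) (dom_chart d)" 
    by (rule inj_on_inverseI[where g = "\<lambda>z. coord_inv c (h' z)"]) (rule left)
  have inv: "coord_inv d z = coord_inv c (h' z)" if z: "z \<in> V'" for z
    unfolding coord_inv_def[of d]
    by (rule inv_into_f_eq[OF inj inv_V(1)[OF h'(1)[OF z]]])
      (use inv_V(2)[OF h'(1)[OF z]] h'(2)[OF z] in \<open>simp add: co\<close>)
  then show "z \<in> V' \<Longrightarrow> coord_inv d z = coord_inv c (h' z)" .
  have contC: "continuous_on S f" if "\<And>k. Ck_on k S f" for S and f :: "real^'n \<Rightarrow> real^'n"
    using that[of 0] by simp
  have left_inv: "coord_inv d (coord d q) = q" if q: "q \<in> dom_chart d" for q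
  proof -
    have "coord d q \<in> V'" using im q by blast
    then show ?thesis using inv left[OF q] by simp
  qed
  have isd: "is_chart d"
    unfolding is_chart_def homeomorphism_def
  proof (intro conjI ballI)
    show "open (dom_chart d)"
      unfolding dom by (rule continuous_open_preimage[OF ch(3,1) V(1)])
    show "open (chart_image d)" using im V' by simp
    show "coord_inv d (coord d q) = q" if "q \<in> dom_chart d" for q
      by (rule left_inv[OF that])
    show "coord_inv d ` chart_image d = dom_chart d"
    proof
      show "coord_inv d ` chart_image d \<subseteq> dom_chart d" unfolding im using inv inv_V h'(1) by auto
      show "dom_chart d \<subseteq> coord_inv d ` chart_image d"
      proof
        fix q assume q: "q \<in> dom_chart d"
        then have "coord_inv d (coord d q) \<in> coord_inv d ` chart_image d" by (intro imageI)
        then show "q \<in> coord_inv d ` chart_image d" unfolding left_inv[OF q] .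
      qed
    qed
    show "coord d (coord_inv d y) = y" if "y \<in> chart_image d" for y
      using that inv inv_V h' unfolding im by (simp add: co)
    show "continuous_on (dom_chart d) (coord d)"
      unfolding co
    proof (rule continuous_on_compose)
      show "continuous_on (dom_chart d) (coord c)" by (rule continuous_on_subset[OF ch(3)]) (auto simp: dom)
      show "continuous_on (coord c ` dom_chart d) h"
        by (rule continuous_on_subset[OF contC[OF h(3)]]) (auto simp: dom)
    qed
    have "continuous_on V' (\<lambda>z. coord_inv c (h' z))"
      by (rule continuous_on_compose2[OF ch(4) contC[OF h'(3)]]) (use h'(1) V(2) in blast)
    then show "continuous_on (chart_image d) (coord_inv d)"
      unfolding im using inv by (simp cong: continuous_on_cong)
  qed auto
  have "compatible e d \<and> compatible d e" if e: "e \<in> A" for e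
    unfolding compatible_def smooth_on_def
  proof (intro conjI allI)
    fix k
    note eh = is_chartD[OF chart[OF e]]
    let ?U = "coord e ` (dom_chart e \<inter> dom_chart d)"
    have oU: "open ?U" by (rule chart_image_open[OF chart[OF e] is_chartD(1)[OF isd]])
    have "Ck_on k (coord e ` (dom_chart e \<inter> dom_chart c)) (transition e c)"
      using compat[OF e c] by (simp add: compatible_def smooth_on_def)
    then have t: "Ck_on k ?U (transition e c)"
      by (rule Ck_on_subset) (auto simp: dom)
    have "transition e c ` ?U \<subseteq> V" using eh(6) by (auto simp: transition_def dom)
    from Ck_on_compose[OF oU V(1) this t h(3)]
    show "Ck_on k ?U (transition e d)" by (simp add: transition_def co o_def)
    let ?T = "coord d ` (dom_chart d \<inter> dom_chart e)"
    let ?T' = "coord c ` (dom_chart c \<inter> dom_chart e)"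
    have oT: "open ?T" "open ?T'" using chart_image_open[OF isd eh(1)] chart_image_open[OF chart[OF c] eh(1)] .
    have TV: "?T \<subseteq> V'" using im by blast
    have "h' ` ?T \<subseteq> ?T'" using h(2) by (auto simp: dom co)
    moreover have "Ck_on k ?T' (transition c e)"
      using compat[OF c e] by (simp add: compatible_def smooth_on_def)
    ultimately have *: "Ck_on k ?T (\<lambda>z. transition c e (h' z))"
      by (rule Ck_on_compose[OF oT _ Ck_on_subset[OF h'(3) TV]])
    show "Ck_on k ?T (transition d e)"
      by (rule Ck_on_cong[OF oT(1) _ *]) (use inv TV in \<open>auto simp: transition_def\<close>)
  qed
  then show "d \<in> maximal_atlas A" using isd by (simp add: maximal_atlas_def)
qed

context F_manifold
begin

lemma integrable_imp_involutive:
  assumes "integrable_distribution A (D_m A F K \<alpha> \<beta>)"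
  shows involutive_kernel
  unfolding involutive_kernel_def
proof (intro ballI allI impI)
  fix c x u v assume c: "c \<in> A" and x: "x \<in> chart_image c" and uv: "Fc c x *v u = 0" "Fc c x *v v = 0"
  define p where "p = coord_inv c x"
  have cp: "c \<in> charts_at A p" using charts_at_coord_inv[OF c x] by (simp add: p_def)
  have xp: "coord c p = x" using is_chartD(7)[OF chart[OF c] x] by (simp add: p_def)
  obtain N where N: "p \<in> topspace N" "\<exists>k. immersed_submanifold A k N"
    "\<And>q. q \<in> topspace N \<Longrightarrow> submanifold_tangent A N q = ker_F q"
    using assms unfolding integrable_distribution_def integral_manifold_iff by metis
  obtain d S where a: "adapted_chart A N p d S"
    using N(1,2) unfolding immersed_submanifold_def by blast
  define W where "W = {q \<in> dom_chart d. coord d q \<in> S}"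
  have dM: "d \<in> maximal_atlas A" and S: "subspace S" and pW: "p \<in> W" and oW: "openin N W"
    using a by (auto simp: adapted_chart_def Let_def W_def)
  \<comment> \<open>The same chart and subspace are adapted at every point of the slice, which makes
    the kernel condition available along the whole slice and hence differentiable there.\<close>
  have aW: "adapted_chart A N q d S" "q \<in> topspace N" if "q \<in> W" for q
    using a that openin_subset[OF oW] by (auto simp: adapted_chart_def Let_def W_def)
  note dh = is_chartD[OF maximal(1)[OF dM]] and ch = is_chartD[OF chart[OF c]]
  let ?O = "coord d ` (dom_chart d \<inter> dom_chart c)"
  let ?\<phi> = "transition d c"
  let ?D = "\<lambda>y. frechet_derivative ?\<phi> (at y)"
  let ?DF = "frechet_derivative (Fc c) (at x)"
  let ?y = "coord d p"
  have oO: "open ?O" by (rule chart_image_open[OF maximal(1)[OF dM] ch(1)])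
  have \<phi>: "Ck_on k ?O ?\<phi>" for k
    using maximal(3)[OF dM c] by (simp add: compatible_def smooth_on_def)
  have pd: "p \<in> dom_chart d" "?y \<in> S" using pW by (auto simp: W_def)
  have yO: "?y \<in> ?O" using pd chart_at(2)[OF cp] by blast
  have \<phi>y: "?\<phi> ?y = x" using dh(6)[OF pd(1)] xp by (simp add: transition_def)
  have D: "?D (coord d q) s = jacobian d c q *v s" if "q \<in> dom_chart d" "q \<in> dom_chart c" for q s
    using frechet_derivative_eq[OF transition_has_derivative[OF maximal(1)[OF dM] chart[OF c] maximal(3)[OF dM c] that]]
    by simp
  have ker: "Fc c (?\<phi> y) *v ?D y s = 0" if y: "y \<in> ?O" "y \<in> S" and s: "s \<in> S" for y s
  proof -
    obtain q where q: "q \<in> dom_chart d" "q \<in> dom_chart c" "y = coord d q" using y(1) by blast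
    have qW: "q \<in> W" using q y(2) by (simp add: W_def)
    have cq: "c \<in> charts_at A q" using q c by (simp add: charts_at_def)
    have "pushforward d q s \<in> ker_F q"
      using submanifold_tangent_eq[OF aW(1)[OF qW]] N(3)[OF aW(2)[OF qW]] s by blast
    then have "F q c *v pushforward d q s c = 0" using cq by (simp add: ker_F_def)
    then show ?thesis
      using chart_value(1)[OF cq] cq
      by (simp add: q(3) D[OF q(1,2)] pushforward_def transition_eq[OF maximal(1)[OF dM] q(1)])
  qed
  \<comment> \<open>The tangent space of the integral manifold is all of the kernel, so
    \<open>u\<close> and \<open>v\<close> are both images of slice directions.\<close>
  have ex: "\<exists>s\<in>S. w = ?D ?y s" if "Fc c x *v w = 0" for w
  proof -
    have cM: "c \<in> maximal_atlas A" using atlas_subset_maximal c by blast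
    have "F p c *v pushforward c p w c = 0"
      using that chart_value(1)[OF cp] by (simp add: pushforward_at[OF cp] xp)
    then have "pushforward c p w \<in> ker_F p"
      using ker_F_iff[OF pushforward_tangent[OF cM chart_at(2)[OF cp]] cp] by blast
    then obtain s where s: "s \<in> S" "pushforward c p w = pushforward d p s"
      using submanifold_tangent_eq[OF a] N(3)[OF N(1)] by blast
    have "w = pushforward d p s c" using pushforward_at[OF cp, of w] s(2) by simp
    then show ?thesis using s(1) cp D[OF pd(1) chart_at(2)[OF cp]] by (auto simp: pushforward_def)
  qed
  obtain s t where st: "s \<in> S" "u = ?D ?y s" "t \<in> S" "v = ?D ?y t" using ex uv by metis
  have dF: "(Fc c has_derivative ?DF) (at (?\<phi> ?y))"
    unfolding \<phi>y by (rule Ck_on_SucD[OF Fc_smooth[OF c] x])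
  have dF\<phi>: "((\<lambda>y. Fc c (?\<phi> y)) has_derivative (\<lambda>h. ?DF (?D ?y h))) (at ?y)"
    by (rule has_derivative_compose[OF Ck_on_SucD[OF \<phi> yO] dF])
  define G where "G s = frechet_derivative (\<lambda>y. ?D y s) (at ?y)" for s
  have G: "((\<lambda>y. ?D y s) has_derivative G s) (at ?y)" for s
  proof -
    have "Ck_on (Suc 0) ?O (\<lambda>y. ?D y s)" using \<phi>[of "Suc (Suc 0)"] by simp
    from Ck_on_SucD[OF this yO] show ?thesis by (simp add: G_def)
  qed
  have eq: "Fc c x *v G s t + ?DF (?D ?y t) *v ?D ?y s = 0" if st: "s \<in> S" "t \<in> S" for s t
  proof -
    \<comment> \<open>The product vanishes only on the slice, not on an open set; therefore it is
      differentiated along the line in direction \<open>t\<close>, which stays in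
      \<open>S\<close>.\<close>
    have "Fc c (?\<phi> ?y) *v G s t + ?DF (?D ?y t) *v ?D ?y s \<in> {0}"
    proof (rule derivative_in_subspace[OF matrix_vector_has_derivative[OF dF\<phi> G] oO yO])
      fix \<tau> assume "?y + \<tau> *\<^sub>R t \<in> ?O"
      moreover have "?y + \<tau> *\<^sub>R t \<in> S" using S pd(2) st(2) by (simp add: subspace_add subspace_scale)
      ultimately show "Fc c (?\<phi> (?y + \<tau> *\<^sub>R t)) *v ?D (?y + \<tau> *\<^sub>R t) s \<in> {0}"
        using ker st(1) by simp
    qed (auto simp: subspace_def)
    then show ?thesis by (simp add: \<phi>y)
  qed
  have "G s t = G t s"
    by (rule symmetric_second_derivative[OF oO yO Ck_on_SucD[OF \<phi>] G G])
  then show "?DF u *v v = ?DF v *v u"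
    using eq[OF st(1,3)] eq[OF st(3,1)] unfolding st(2,4) by (metis add_left_cancel)
qed

lemma involutive_imp_integrable:
  assumes inv: involutive_kernel
  shows "integrable_distribution A (D_m A F K \<alpha> \<beta>)"
  unfolding integrable_distribution_def
proof
  fix p
  obtain c where cp: "c \<in> charts_at A p" using ex_chart_at by blast
  note c = chart_at(1)[OF cp] and ch = is_chartD[OF chart_at(3)[OF cp]]
  define x0 where "x0 = coord c p"
  have x0: "x0 \<in> chart_image c" using chart_at(5)[OF cp] by (simp add: x0_def)
  define P0 where "P0 = Pc c x0"
  have P0: "P0 *v (P0 *v w) = P0 *v w" for w
    using proj(4)[OF cp] chart_value(2)[OF cp] by (simp add: P0_def x0_def matrix_vector_mul_assoc)
  obtain \<epsilon> \<phi> Q where e: "\<epsilon> > 0" and \<phi>0: "\<phi> 0 = x0" and \<phi>: "\<And>k. Ck_on k (ball 0 \<epsilon>) \<phi>"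
    and \<phi>U: "\<And>y. y \<in> ball 0 \<epsilon> \<Longrightarrow> \<phi> y \<in> chart_image c"
    and \<phi>': "\<And>y. y \<in> ball 0 \<epsilon> \<Longrightarrow> (\<phi> has_derivative (\<lambda>u. Q y *v u)) (at y)"
    and P\<phi>: "\<And>y. y \<in> ball 0 \<epsilon> \<Longrightarrow> P0 *v \<phi> y = P0 *v x0 + P0 *v y"
    and FQ: "\<And>y. y \<in> ball 0 \<epsilon> \<Longrightarrow> Fc c (\<phi> y) ** Q y = 0"
    and Qker: "\<And>y w. y \<in> ball 0 \<epsilon> \<Longrightarrow> Fc c (\<phi> y) *v w = 0 \<Longrightarrow> Q y *v (P0 *v w) = w"
  proof (rule frobenius_projection[OF ch(2) x0 Fc_smooth[OF c] Pc_smooth[OF c], folded P0_def])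
    show "Pc c x ** Pc c x = Pc c x" if "x \<in> chart_image c" for x
      unfolding Pc_def by (rule proj(4)[OF charts_at_coord_inv[OF c that]])
    show "Fc c x ** Pc c x = 0" if "x \<in> chart_image c" for x by (rule Fc_Pc[OF c that])
    show "Pc c x *v w = w" if "x \<in> chart_image c" "Fc c x *v w = 0" for x w
      using proj(5)[OF charts_at_coord_inv[OF c that(1)]] that(2) by (simp add: Pc_def Fc_def)
    show "frechet_derivative (Fc c) (at x) u *v v = frechet_derivative (Fc c) (at x) v *v u"
      if "x \<in> chart_image c" "Fc c x *v u = 0" "Fc c x *v v = 0" for x u v
      using inv that c unfolding involutive_kernel_def by blast
  qed (rule that)
  have lin: "bounded_linear ((*v) P0)"
    by (rule bounded_bilinear.bounded_linear_right[OF bounded_bilinear_matrix_vector])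
  have sm: "Ck_on k U (\<lambda>x. P0 *v f x)" if "open U" "Ck_on k U f" for k U and f :: "real^'n \<Rightarrow> real^'n"
    by (rule Ck_on_linear[OF lin that(2,1)])
  define V where "V = chart_image c \<inter> (\<lambda>x. P0 *v (x - x0)) -` ball 0 \<epsilon>"
  define V1 where "V1 = (\<lambda>z. P0 *v z) -` ball 0 \<epsilon>"
  \<comment> \<open>The shear \<open>h'\<close> carries the range of \<open>P0\<close> to the graph of \<open>\<phi>\<close>; \<open>h\<close> is its inverse.\<close>
  define h where "h x = P0 *v (x - x0) + x - \<phi> (P0 *v (x - x0))" for x
  define h' where "h' z = \<phi> (P0 *v z) + z - P0 *v z" for z
  \<comment> \<open>Away from the range of \<open>P0\<close> the shear may leave the chart image, so
    \<open>V1\<close> is cut down.\<close>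
  define V' where "V' = V1 \<inter> h' -` chart_image c"
  have oV: "open V"
    unfolding V_def
    by (rule continuous_open_preimage[OF _ ch(2) open_ball])
      (intro continuous_intros bounded_linear.continuous_on[OF lin])
  have oV1: "open V1"
    unfolding V1_def
    by (rule open_vimage[OF open_ball]) (intro continuous_intros bounded_linear.continuous_on[OF lin])
  have h'C: "Ck_on k V1 h'" for k
    unfolding h'_def
    by (intro Ck_on_diff Ck_on_add Ck_on_compose[OF oV1 open_ball _ _ \<phi>] sm oV1 Ck_on_id) (auto simp: V1_def)
  have oV': "open V'"
    unfolding V'_def by (rule continuous_open_preimage[OF _ oV1 ch(2)]) (use h'C[of 0] in simp)
  have hC: "Ck_on k V h" for k
    unfolding h_def
    by (intro Ck_on_diff Ck_on_add Ck_on_compose[OF oV open_ball _ _ \<phi>] sm oV Ck_on_id Ck_on_const)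
      (auto simp: V_def)
  \<comment> \<open>The explicit \<open>P0\<close> component of \<open>\<phi>\<close> shows that
    \<open>h'\<close> preserves the \<open>P0\<close> component up to the translation by
    \<open>x0\<close>. Hence the argument of \<open>\<phi>\<close> can be recovered from
    \<open>h' z\<close>, and the shear is inverted by a formula.\<close>
  have Ph': "P0 *v (h' z - x0) = P0 *v z" if "z \<in> V1" for z
    using P\<phi>[of "P0 *v z"] that
    by (simp add: h'_def V1_def matrix_vector_right_distrib matrix_vector_mult_diff_distrib P0)
  have Ph: "P0 *v h x = P0 *v (x - x0)" if "x \<in> V" for x
    using P\<phi>[of "P0 *v (x - x0)"] that
    by (simp add: h_def V_def matrix_vector_right_distrib matrix_vector_mult_diff_distrib P0)
  have h'h: "h' (h x) = x" if "x \<in> V" for x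
    unfolding h'_def Ph[OF that] by (simp add: h_def)
  have hh': "h (h' z) = z" if "z \<in> V1" for z
    unfolding h_def Ph'[OF that] by (simp add: h'_def)
  have hV: "h x \<in> V'" if "x \<in> V" for x
    using that h'h[OF that] Ph[OF that] by (auto simp: V'_def V1_def V_def)
  have h'V: "h' z \<in> V" if "z \<in> V'" for z
    using that Ph'[of z] by (auto simp: V'_def V1_def V_def)
  have V'1: "V' \<subseteq> V1" by (auto simp: V'_def)
  define d where "d = (dom_chart c \<inter> coord c -` V, h \<circ> coord c)"
  note d = maximal_atlas_compose[of c V V' h h', OF c oV _ oV' hV h'h hC h'V _ Ck_on_subset[OF h'C V'1], folded d_def]
  have VU: "V \<subseteq> chart_image c" by (auto simp: V_def)
  have dM: "d \<in> maximal_atlas A" and dinv: "\<And>z. z \<in> V' \<Longrightarrow> coord_inv d z = coord_inv c (h' z)"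
    and dim: "chart_image d = V'"
    using d VU hh' V'1 by blast+
  \<comment> \<open>The range of the projection \<open>P0\<close>, described by its fixed points; on
    it the shear \<open>h'\<close> coincides with \<open>\<phi>\<close>.\<close>
  define S where "S = {z. P0 *v z = z}"
  have S: "subspace S"
    by (auto simp: S_def subspace_def matrix_vector_right_distrib matrix_vector_mult_scaleR)
  define W where "W = {q \<in> dom_chart d. coord d q \<in> S}"
  \<comment> \<open>With the subspace topology \<open>W\<close> itself is the required slice at each
    of its points, so the single chart \<open>d\<close> serves for the whole integral
    manifold.\<close>
  define N where "N = top_of_set W"
  have adapted: "adapted_chart A N q d S" if "q \<in> W" for q
    using dM S that by (simp add: adapted_chart_def Let_def N_def subtopology_subtopology flip: W_def)
  have tangent: "submanifold_tangent A N q = ker_F q" if qW: "q \<in> W" for q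
  proof -
    have qd: "q \<in> dom_chart d" and zS: "coord d q \<in> S" using qW by (auto simp: W_def)
    define z where "z = coord d q"
    have zV: "z \<in> V'" using dim qd by (auto simp: z_def)
    have Pz: "P0 *v z = z" using zS by (simp add: S_def z_def)
    have zb: "z \<in> ball 0 \<epsilon>" using zV Pz by (auto simp: V'_def V1_def)
    have qc: "q \<in> dom_chart c" using qd by (simp add: d_def)
    have cq: "c \<in> charts_at A q" using qc c by (simp add: charts_at_def)
    have "coord c q = h' z"
      using qd h'h by (simp add: z_def d_def)
    then have xq: "coord c q = \<phi> z" by (simp add: h'_def Pz)
    have Fq: "F q c = Fc c (\<phi> z)" using chart_value(1)[OF cq] xq by simp
    have "(\<phi> has_derivative (\<lambda>u. Q (P0 *v z) *v u)) (at (P0 *v z))"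
      by (rule \<phi>') (use zb in \<open>simp add: Pz\<close>)
    from has_derivative_compose[OF bounded_linear.has_derivative[OF lin has_derivative_ident] this]
    have "(h' has_derivative (\<lambda>u. Q (P0 *v z) *v (P0 *v u) + u - P0 *v u)) (at z)"
      unfolding h'_def
      by (intro has_derivative_add has_derivative_diff has_derivative_ident bounded_linear.has_derivative[OF lin])
    then have "(transition d c has_derivative (\<lambda>u. Q (P0 *v z) *v (P0 *v u) + u - P0 *v u)) (at z)"
    proof (rule has_derivative_transform_within_open[OF _ oV' zV])
      show "h' y = transition d c y" if "y \<in> V'" for y
        using h'V[OF that] VU ch(7) dinv[OF that] by (auto simp: transition_def)
    qed
    from jacobian_mult[OF this[unfolded z_def]]
    \<comment> \<open>For \<open>s\<close> in \<open>S\<close> the terms \<open>u - P0 u\<close> of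
      the derivative cancel, leaving the derivative of \<open>\<phi>\<close>.\<close>
    have J: "jacobian d c q *v s = Q z *v s" if "s \<in> S" for s
      using that Pz by (simp add: S_def z_def)
    have push: "pushforward d q s c = Q z *v s" if "s \<in> S" for s
      using cq J[OF that] by (simp add: pushforward_def)
    have "pushforward d q ` S = ker_F q"
    proof
      show "pushforward d q ` S \<subseteq> ker_F q"
      proof
        fix v assume "v \<in> pushforward d q ` S"
        then obtain s where s: "s \<in> S" "v = pushforward d q s" by blast
        have "F q c *v v c = 0"
          using FQ[OF zb] s by (simp add: push Fq matrix_vector_mul_assoc)
        then show "v \<in> ker_F q"
          using ker_F_iff[OF pushforward_tangent[OF dM qd] cq] s(2) by blast
      qed
      show "ker_F q \<subseteq> pushforward d q ` S"
      proof
        fix v assume v: "v \<in> ker_F q"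
        then have vt: "v \<in> tangent_space A q" and "F q c *v v c = 0"
          using cq by (auto simp: ker_F_def)
        then have w: "Q z *v (P0 *v v c) = v c" using Qker[OF zb] by (simp add: Fq)
        have s: "P0 *v v c \<in> S" by (simp add: S_def P0)
        have "pushforward d q (P0 *v v c) = pushforward c q (pushforward d q (P0 *v v c) c)"
          by (rule tangent_real[OF pushforward_tangent[OF dM qd] cq])
        also have "\<dots> = pushforward c q (v c)" by (simp add: push[OF s] w)
        also have "\<dots> = v" using tangent_real[OF vt cq] by simp
        finally show "v \<in> pushforward d q ` S" using s by force
      qed
    qed
    then show ?thesis using submanifold_tangent_eq[OF adapted[OF qW]] by simp
  qed
  have "p \<in> W"
  proof -
    have "x0 \<in> V" using x0 e by (simp add: V_def)
    moreover have "h x0 \<in> S" by (simp add: h_def \<phi>0 S_def)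
    ultimately show ?thesis using chart_at(2)[OF cp] by (simp add: W_def d_def x0_def)
  qed
  moreover have "second_countable N"
    unfolding N_def by (intro second_countable_subtopology second_countable_euclidean)
  moreover have topN: "topspace N = W" by (simp add: N_def)
  ultimately have "p \<in> topspace N" "immersed_submanifold A (dim S) N"
    unfolding immersed_submanifold_def using adapted by blast+
  then show "\<exists>N. integral_manifold A (D_m A F K \<alpha> \<beta>) N \<and> p \<in> topspace N"
    unfolding integral_manifold_iff using tangent topN by blast
qed

end

theorem theorem5p6:
  fixes A :: "('m::{t2_space, second_countable_topology}, 'n::finite) chart set"
    and F :: "('m, 'n, real) tensor11"
    and K r :: nat
    and \<alpha> \<beta> :: complex
  assumes "smooth_manifold A"
    and "F_structure A F K r \<alpha> \<beta>"
  shows "(integrable_distribution A (D_m A F K \<alpha> \<beta>) \<longleftrightarrow>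
           (\<forall>X Y :: ('m, 'n, real) vfield.
              smooth_vector_field A X \<longrightarrow> smooth_vector_field A Y \<longrightarrow>
              nijenhuis A (complex_tensor F)
                (tensor_app (m_tensor F K \<alpha> \<beta>) (complex_field X))
                (tensor_app (m_tensor F K \<alpha> \<beta>) (complex_field Y)) = (\<lambda>p c. 0)))
       \<and> (integrable_distribution A (D_m A F K \<alpha> \<beta>) \<longleftrightarrow>
           (\<forall>X Y :: ('m, 'n, real) vfield.
              smooth_vector_field A X \<longrightarrow> smooth_vector_field A Y \<longrightarrow>
              tensor_app (l_tensor F K \<alpha> \<beta>)
                (nijenhuis A (complex_tensor F)
                  (tensor_app (m_tensor F K \<alpha> \<beta>) (complex_field X))
                  (tensor_app (m_tensor F K \<alpha> \<beta>) (complex_field Y))) = (\<lambda>p c. 0)))"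
proof -
  interpret F_manifold A F K r \<alpha> \<beta>
    using assms by unfold_locales
  have 1: "integrable_distribution A (D_m A F K \<alpha> \<beta>) \<longleftrightarrow> involutive_kernel"
    using integrable_imp_involutive involutive_imp_integrable by blast
  \<comment> \<open>Both criteria coincide because \<open>l\<close> fixes the Nijenhuis tensor of
    projected fields.\<close>
  show ?thesis
    unfolding 1 nijenhuis_zero_iff_involutive[symmetric]
    by (simp add: nijenhuis_m_field(3) cong: imp_cong)
qed

end
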